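(* Let $(X,d,A)$ be a metric pair with $A\neq\emptyset$ and $(X,d)$ complete and separable. Then $W_1$ is a metric on $\mathcal{M}_1^+(X,A)$, and there is an isometric embedding of the quotient metric space $X/A$ into $(\mathcal{M}_1^+(X,A),W_1)$ given by $x\mapsto\delta_x$ if $x\notin A$ and $A\mapsto 0$. If moreover $X$ is boundedly compact, then for all $\mu,\nu\in\mathcal{M}_1^+(X,A)$ there exists $\pi^*\in\Pi(\mu,\nu)$ with $W_1(\mu,\nu)=\int_{X\times X}\bar d\,d\pi^*$.
   Context: A metric pair $(X,d,A)$ is a metric space $(X,d)$ with a closed subset $A\subset X$; $d_A(x)=\inf_{a\in A}d(x,a)$. $X$ is boundedly compact if every closed bounded subset is compact. Measures take values in $[0,\infty]$. Let $\mathcal{B}^+(X)$ be the commutative monoid of Borel measures on $X$ and $\mathcal{B}^+(X,A)=\mathcal{B}^+(X)/\mathcal{B}^+(A)$ the quotient monoid: $\mu\sim\nu$ iff $\mu+\sigma=\nu+\tau$ for some Borel measures $\sigma,\tau$ concentrated on $A$; equivalently $\mu,\nu$ agree on Borel subsets of $X\setminus A$, so relative Borel measures correspond bijectively to Borel measures on $X\setminus A$. Integrals of functions vanishing on $A$ are well defined. $\mu$ is tight if $\mu(E)=\sup\{\mu(K): K\subset E \text{ compact}\}$ for every Borel $E\subset X\setminus A$. $\mathcal{M}_1^+(X,A)$ is the set of tight $\mu\in\mathcal{B}^+(X,A)$ with $\mu(d_A)=\int d_A\,d\mu<\infty$. The product pair is $(X\times X,d+d,A\times A)$, and $\mathcal{B}^+(X^2,A^2)$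 is defined in the same way. The projections $p_1,p_2:X^2\to X$ map $A^2$ into $A$ and induce pushforwards $(p_i)_*:\mathcal{B}^+(X^2,A^2)\to\mathcal{B}^+(X,A)$. A coupling of $\mu,\nu\in\mathcal{B}^+(X,A)$ is $\pi\in\mathcal{B}^+(X^2,A^2)$ with $(p_1)_*\pi=\mu$, $(p_2)_*\pi=\nu$; $\Pi(\mu,\nu)$ is the set of couplings. Let $\bar d(x,y)=\min(d(x,y),\,d_A(x)+d_A(y))$, which vanishes on $A\times A$. The relative $1$-Wasserstein distance is $W_1(\mu,\nu)=\inf_{\pi\in\Pi(\mu,\nu)}\int_{X\times X}\bar d\,d\pi$. The quotient metric space $X/A$ is the set obtained by collapsing $A$ to a point, with the metric induced by $\bar d$. *)

theory Defs
  imports "HOL-Probability.Probability"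
begin

section \<open>Relative Borel measures\<close>

definition borel_measures :: "'a::topological_space measure set" where
  "borel_measures = {M. sets M = sets borel}"

definition concentrated_on :: "'a measure \<Rightarrow> 'a set \<Rightarrow> bool" where
  "concentrated_on M A \<longleftrightarrow> emeasure M (- A) = 0"

text \<open>The congruence whose quotient is \<open>B\<^sup>+(X)/B\<^sup>+(A)\<close>. Borel measures on the closed set \<open>A\<close> are
  identified with the Borel measures on \<open>X\<close> concentrated on \<open>A\<close>. As there is no addition on type
  \<open>measure\<close>, the equation \<open>\<mu> + \<sigma> = \<nu> + \<tau>\<close> is written setwise.\<close>

definition rel_equiv :: "'a::topological_space set \<Rightarrow> ('a measure \<times> 'a measure) set" where
  "rel_equiv A = {(\<mu>, \<nu>). \<mu> \<in> borel_measures \<and> \<nu> \<in> borel_measures \<and>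
     (\<exists>\<sigma>\<in>borel_measures. \<exists>\<tau>\<in>borel_measures. concentrated_on \<sigma> A \<and> concentrated_on \<tau> A \<and>
        (\<forall>E\<in>sets borel. emeasure \<mu> E + emeasure \<sigma> E = emeasure \<nu> E + emeasure \<tau> E))}"

definition rel_borel_measures :: "'a::topological_space set \<Rightarrow> 'a measure set set" where
  "rel_borel_measures A = borel_measures // rel_equiv A"

definition rel_class :: "'a::topological_space set \<Rightarrow> 'a measure \<Rightarrow> 'a measure set" where
  "rel_class A M = rel_equiv A `` {M}"

definition rel_rep :: "'a measure set \<Rightarrow> 'a measure" where
  "rel_rep \<mu> = (SOME M. M \<in> \<mu>)"

text \<open>The next three operations are computed on a representative. They do not depend on its choice
  for \<open>E \<subseteq> - A\<close>, for \<open>f\<close> vanishing on \<open>A\<close>, and for \<open>p\<close> mapping \<open>A\<close> into \<open>B\<close> respectively; see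
  \<open>rel_emeasure_rel_class\<close>, \<open>rel_nn_integral_rel_class\<close> and \<open>rel_push_rel_class\<close> below.\<close>

definition rel_emeasure :: "'a measure set \<Rightarrow> 'a set \<Rightarrow> ennreal" where
  "rel_emeasure \<mu> E = emeasure (rel_rep \<mu>) E"

definition rel_nn_integral :: "'a measure set \<Rightarrow> ('a \<Rightarrow> ennreal) \<Rightarrow> ennreal" where
  "rel_nn_integral \<mu> f = (\<integral>\<^sup>+x. f x \<partial>(rel_rep \<mu>))"

definition rel_push ::
    "'b::topological_space set \<Rightarrow> ('a \<Rightarrow> 'b) \<Rightarrow> 'a measure set \<Rightarrow> 'b measure set" where
  "rel_push B p \<mu> = rel_class B (distr (rel_rep \<mu>) borel p)"

definition tight_rel :: "'a::topological_space set \<Rightarrow> 'a measure set \<Rightarrow> bool" where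
  "tight_rel A \<mu> \<longleftrightarrow> (\<forall>E\<in>sets borel. E \<subseteq> - A \<longrightarrow>
     rel_emeasure \<mu> E = (SUP K\<in>{K. compact K \<and> K \<subseteq> E}. rel_emeasure \<mu> K))"

definition M1 :: "'a::metric_space set \<Rightarrow> 'a measure set set" where
  "M1 A = {\<mu> \<in> rel_borel_measures A. tight_rel A \<mu> \<and>
     rel_nn_integral \<mu> (\<lambda>x. ennreal (infdist x A)) < \<infinity>}"

definition rel_zero :: "'a::topological_space set \<Rightarrow> 'a measure set" where
  "rel_zero A = rel_class A (null_measure borel)"

definition rel_dirac :: "'a::topological_space set \<Rightarrow> 'a \<Rightarrow> 'a measure set" where
  "rel_dirac A x = rel_class A (return borel x)"


section \<open>Couplings and the relative Wasserstein distance\<close>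

text \<open>The pair \<open>(X \<times> X, A \<times> A)\<close> enters only through its Borel structure. The metric of the type
  \<open>'a \<times> 'a\<close> is the Euclidean combination of the two distances rather than their sum \<open>d + d\<close>; both
  induce the product topology.\<close>

definition couplings ::
    "'a::topological_space set \<Rightarrow> 'a measure set \<Rightarrow> 'a measure set \<Rightarrow> ('a \<times> 'a) measure set set" where
  "couplings A \<mu> \<nu> = {\<pi> \<in> rel_borel_measures (A \<times> A). rel_push A fst \<pi> = \<mu> \<and> rel_push A snd \<pi> = \<nu>}"

definition dbar :: "'a::metric_space set \<Rightarrow> 'a \<Rightarrow> 'a \<Rightarrow> real" where
  "dbar A x y = min (dist x y) (infdist x A + infdist y A)"

definition transport_cost :: "'a::metric_space set \<Rightarrow> ('a \<times> 'a) measure set \<Rightarrow> ennreal" where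
  "transport_cost A \<pi> = rel_nn_integral \<pi> (\<lambda>(x, y). ennreal (dbar A x y))"

definition W1 :: "'a::metric_space set \<Rightarrow> 'a measure set \<Rightarrow> 'a measure set \<Rightarrow> ennreal" where
  "W1 A \<mu> \<nu> = (INF \<pi>\<in>couplings A \<mu> \<nu>. transport_cost A \<pi>)"


section \<open>The quotient metric space \<open>X/A\<close>\<close>

definition collapse :: "'a set \<Rightarrow> ('a \<times> 'a) set" where
  "collapse A = {(x, y). x = y \<or> x \<in> A \<and> y \<in> A}"

definition quotient_space :: "'a set \<Rightarrow> 'a set set" where
  "quotient_space A = UNIV // collapse A"

definition quotient_dist :: "'a::metric_space set \<Rightarrow> 'a set \<Rightarrow> 'a set \<Rightarrow> real" where
  "quotient_dist A C D = dbar A (SOME x. x \<in> C) (SOME y. y \<in> D)"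

text \<open>The points of \<open>X/A\<close> are the set \<open>A\<close> itself and the singletons \<open>{x}\<close> with \<open>x \<notin> A\<close>.\<close>

definition quotient_embedding :: "'a::topological_space set \<Rightarrow> 'a set \<Rightarrow> 'a measure set" where
  "quotient_embedding A C = (if C = A then rel_zero A else rel_dirac A (the_elem C))"

definition isometric_embedding ::
    "'a set \<Rightarrow> ('a \<Rightarrow> 'a \<Rightarrow> real) \<Rightarrow> 'b set \<Rightarrow> ('b \<Rightarrow> 'b \<Rightarrow> real) \<Rightarrow> ('a \<Rightarrow> 'b) \<Rightarrow> bool" where
  "isometric_embedding M d N e f \<longleftrightarrow>
     f \<in> M \<rightarrow> N \<and> (\<forall>x\<in>M. \<forall>y\<in>M. e (f x) (f y) = d x y)"


section \<open>Well-definedness\<close>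

lemma rel_equiv_iff:
  fixes A :: "'a::topological_space set"
  assumes A: "closed A"
  shows "(\<mu>, \<nu>) \<in> rel_equiv A \<longleftrightarrow> \<mu> \<in> borel_measures \<and> \<nu> \<in> borel_measures \<and>
     (\<forall>E\<in>sets borel. E \<subseteq> - A \<longrightarrow> emeasure \<mu> E = emeasure \<nu> E)" (is "?L \<longleftrightarrow> ?R")
proof
  assume ?L
  then obtain \<sigma> \<tau> where b: "\<mu> \<in> borel_measures" "\<nu> \<in> borel_measures"
      "\<sigma> \<in> borel_measures" "\<tau> \<in> borel_measures"
    and c: "concentrated_on \<sigma> A" "concentrated_on \<tau> A"
    and eq: "\<And>E. E \<in> sets borel \<Longrightarrow> emeasure \<mu> E + emeasure \<sigma> E = emeasure \<nu> E + emeasure \<tau> E"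
    unfolding rel_equiv_def by blast
  have "emeasure \<mu> E = emeasure \<nu> E" if E: "E \<in> sets borel" "E \<subseteq> - A" for E
  proof -
    have "- A \<in> sets borel" using A by auto
    then have "emeasure \<sigma> E = 0" "emeasure \<tau> E = 0"
      using emeasure_mono[of E "- A" \<sigma>] emeasure_mono[of E "- A" \<tau>] b c E
      by (auto simp: borel_measures_def concentrated_on_def)
    with eq[OF E(1)] show ?thesis by simp
  qed
  with b show ?R by blast
next
  assume R: ?R
  then have s: "sets \<mu> = sets borel" "sets \<nu> = sets borel" by (auto simp: borel_measures_def)
  have Ab: "A \<in> sets borel" "- A \<in> sets borel" using A by auto
  define \<sigma> where "\<sigma> = density \<nu> (indicator A)"
  define \<tau> where "\<tau> = density \<mu> (indicator A)"
  have em: "emeasure \<sigma> E = emeasure \<nu> (A \<inter> E)" "emeasure \<tau> E = emeasure \<mu> (A \<inter> E)"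
    if "E \<in> sets borel" for E
    using that Ab s unfolding \<sigma>_def \<tau>_def
    by (simp_all add: emeasure_density indicator_inter_arith[symmetric] sets.Int)
  have "emeasure \<mu> E + emeasure \<sigma> E = emeasure \<nu> E + emeasure \<tau> E" if E: "E \<in> sets borel" for E
  proof -
    have split: "emeasure M E = emeasure M (E \<inter> - A) + emeasure M (A \<inter> E)"
      if "sets M = sets borel" for M
      using plus_emeasure[of "E \<inter> - A" M "A \<inter> E"] that E Ab
      by (simp add: sets.Int disjoint_iff) (metis Int_Diff Int_commute Un_Diff_Int Diff_eq)
    have "emeasure \<mu> (E \<inter> - A) = emeasure \<nu> (E \<inter> - A)"
      using R E Ab by (simp add: sets.Int)
    then show ?thesis using split[OF s(1)] split[OF s(2)] em[OF E]
      by (simp add: ac_simps)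
  qed
  moreover have "sets \<sigma> = sets borel" "sets \<tau> = sets borel" by (simp_all add: \<sigma>_def \<tau>_def s)
  moreover have "emeasure \<sigma> (- A) = 0" "emeasure \<tau> (- A) = 0" using em[OF Ab(2)] by simp_all
  ultimately show ?L using R unfolding rel_equiv_def borel_measures_def concentrated_on_def by blast
qed

lemma equiv_rel_equiv:
  fixes A :: "'a::topological_space set"
  assumes "closed A"
  shows "equiv borel_measures (rel_equiv A)"
  by (rule equivI) (auto simp: refl_on_def sym_def trans_def rel_equiv_iff[OF assms])

lemma rel_rep_rel_class:
  fixes A :: "'a::topological_space set"
  assumes "closed A" "M \<in> borel_measures"
  shows "(M, rel_rep (rel_class A M)) \<in> rel_equiv A"
proof -
  have "M \<in> rel_class A M"
    using assms by (simp add: rel_class_def rel_equiv_iff)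
  then have "rel_rep (rel_class A M) \<in> rel_class A M"
    unfolding rel_rep_def by (rule someI)
  then show ?thesis by (simp add: rel_class_def)
qed

lemma rel_emeasure_rel_class:
  fixes A :: "'a::topological_space set"
  assumes "closed A" "M \<in> borel_measures" "E \<in> sets borel" "E \<subseteq> - A"
  shows "rel_emeasure (rel_class A M) E = emeasure M E"
  using rel_rep_rel_class[OF assms(1,2)] assms by (simp add: rel_emeasure_def rel_equiv_iff)

lemma rel_nn_integral_rel_class:
  fixes A :: "'a::topological_space set"
  assumes A: "closed A" and M: "M \<in> borel_measures" and f: "f \<in> borel_measurable borel"
    and f0: "\<And>x. x \<in> A \<Longrightarrow> f x = 0"
  shows "rel_nn_integral (rel_class A M) f = (\<integral>\<^sup>+x. f x \<partial>M)"
proof -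
  define N where "N = rel_rep (rel_class A M)"
  have "(M, N) \<in> rel_equiv A" unfolding N_def by (rule rel_rep_rel_class[OF A M])
  then have s: "sets M = sets borel" "sets N = sets borel"
    and eq: "\<And>E. E \<in> sets borel \<Longrightarrow> E \<subseteq> - A \<Longrightarrow> emeasure M E = emeasure N E"
    by (auto simp: rel_equiv_iff[OF A] borel_measures_def)
  have Ab: "- A \<in> sets borel" using A by auto
  have *: "(\<integral>\<^sup>+x. f x \<partial>L) = (\<integral>\<^sup>+x. f x \<partial>density L (indicator (- A)))"
    if L: "sets L = sets borel" for L
  proof -
    have "f \<in> borel_measurable L" "(indicator (- A) :: _ \<Rightarrow> ennreal) \<in> borel_measurable L"
      using f Ab L by (auto simp: measurable_cong_sets[OF L refl])
    then have "(\<integral>\<^sup>+x. f x \<partial>density L (indicator (- A))) = (\<integral>\<^sup>+x. indicator (- A) x * f x \<partial>L)"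
      by (subst nn_integral_density) auto
    also have "\<dots> = (\<integral>\<^sup>+x. f x \<partial>L)"
      by (rule nn_integral_cong) (auto simp: indicator_def f0)
    finally show ?thesis ..
  qed
  have "density M (indicator (- A)) = density N (indicator (- A))"
  proof (rule measure_eqI)
    fix E assume "E \<in> sets (density M (indicator (- A)))"
    then have E: "E \<in> sets borel" by (simp add: s)
    have "emeasure (density L (indicator (- A))) E = emeasure L (- A \<inter> E)"
      if "sets L = sets borel" for L
      using that E Ab by (simp add: emeasure_density indicator_inter_arith[symmetric] sets.Int)
    then show "emeasure (density M (indicator (- A))) E = emeasure (density N (indicator (- A))) E"
      using s eq[of "- A \<inter> E"] E Ab by (simp add: sets.Int)
  qed (simp add: s)
  with *[OF s(1)] *[OF s(2)] show ?thesis
    by (simp add: rel_nn_integral_def N_def)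
qed

lemma rel_push_rel_class:
  fixes A :: "'a::topological_space set" and B :: "'b::topological_space set"
  assumes A: "closed A" and B: "closed B" and M: "M \<in> borel_measures"
    and p: "p \<in> borel_measurable borel" "p ` A \<subseteq> B"
  shows "rel_push B p (rel_class A M) = rel_class B (distr M borel p)"
proof -
  define N where "N = rel_rep (rel_class A M)"
  have "(M, N) \<in> rel_equiv A" unfolding N_def by (rule rel_rep_rel_class[OF A M])
  then have s: "sets M = sets borel" "sets N = sets borel"
    and eq: "\<And>E. E \<in> sets borel \<Longrightarrow> E \<subseteq> - A \<Longrightarrow> emeasure M E = emeasure N E"
    by (auto simp: rel_equiv_iff[OF A] borel_measures_def)
  have pm: "p \<in> borel_measurable M" "p \<in> borel_measurable N"
    using p(1) by (auto simp: measurable_cong_sets[OF s(1) refl] measurable_cong_sets[OF s(2) refl])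
  have sp: "space M = UNIV" "space N = UNIV"
    using sets_eq_imp_space_eq[OF s(1)] sets_eq_imp_space_eq[OF s(2)] by auto
  have "(distr M borel p, distr N borel p) \<in> rel_equiv B"
    unfolding rel_equiv_iff[OF B]
  proof (intro conjI ballI impI)
    fix E :: "'b set" assume E: "E \<in> sets borel" "E \<subseteq> - B"
    have "p -` E \<in> sets borel" using measurable_sets[OF p(1) E(1)] by simp
    moreover have "p -` E \<subseteq> - A" using E(2) p(2) by auto
    ultimately show "emeasure (distr M borel p) E = emeasure (distr N borel p) E"
      using eq E pm by (simp add: emeasure_distr sp)
  qed (simp_all add: borel_measures_def)
  then show ?thesis
    unfolding rel_push_def N_def[symmetric] unfolding rel_class_def
    by (rule equiv_class_eq[OF equiv_rel_equiv[OF B], symmetric])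
qed

lemma dbar_triangle: "dbar A x z \<le> dbar A x y + dbar A y z"
  using infdist_triangle[of x A y] infdist_triangle[of z A y] dist_triangle[of x z y]
    infdist_nonneg[of x A] infdist_nonneg[of y A] infdist_nonneg[of z A]
  unfolding dbar_def min_def by (auto simp: dist_commute)

lemma dbar_eq_0_iff:
  assumes "closed A" "A \<noteq> {}"
  shows "dbar A x y = 0 \<longleftrightarrow> (x, y) \<in> collapse A"
  using infdist_nonneg[of x A] infdist_nonneg[of y A]
    in_closed_iff_infdist_zero[OF assms, of x] in_closed_iff_infdist_zero[OF assms, of y]
  unfolding dbar_def min_def collapse_def by (auto simp: add_nonneg_eq_0_iff)

lemma equiv_collapse: "equiv UNIV (collapse A)"
  by (rule equivI) (auto simp: collapse_def refl_on_def sym_def trans_def)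

lemma quotient_dist_collapse:
  assumes A: "closed A" "A \<noteq> {}"
  shows "quotient_dist A (collapse A `` {x}) (collapse A `` {y}) = dbar A x y"
proof -
  have rep: "(z, SOME w. w \<in> collapse A `` {z}) \<in> collapse A" for z
    using someI[of "\<lambda>w. w \<in> collapse A `` {z}" z] by (simp add: collapse_def)
  define x' where "x' = (SOME w. w \<in> collapse A `` {x})"
  define y' where "y' = (SOME w. w \<in> collapse A `` {y})"
  have "dbar A x x' = 0" "dbar A y y' = 0" "dbar A x' x = 0" "dbar A y' y = 0"
    using rep[of x] rep[of y] unfolding dbar_eq_0_iff[OF A] x'_def y'_def
    by (auto simp: collapse_def)
  moreover note dbar_triangle[of A x y x'] dbar_triangle[of A x' y y']
    dbar_triangle[of A x' y' x] dbar_triangle[of A x y' y]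
  ultimately have "dbar A x' y' = dbar A x y" by linarith
  then show ?thesis by (simp add: quotient_dist_def x'_def y'_def)
qed

lemma Metric_space_quotient:
  assumes A: "closed A" "A \<noteq> {}"
  shows "Metric_space (quotient_space A) (quotient_dist A)"
proof
  fix C D :: "'a set"
  show "0 \<le> quotient_dist A C D" by (simp add: quotient_dist_def dbar_def infdist_nonneg)
  show "quotient_dist A C D = quotient_dist A D C"
    by (simp add: quotient_dist_def dbar_def dist_commute add.commute)
next
  fix C D assume "C \<in> quotient_space A" "D \<in> quotient_space A"
  then show "quotient_dist A C D = 0 \<longleftrightarrow> C = D"
    by (auto simp: quotient_space_def quotient_dist_collapse[OF A] dbar_eq_0_iff[OF A]
        elim!: quotientE) (auto simp: collapse_def)
next
  fix C D E assume "C \<in> quotient_space A" "D \<in> quotient_space A" "E \<in> quotient_space A"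
  then show "quotient_dist A C E \<le> quotient_dist A C D + quotient_dist A D E"
    by (auto simp: quotient_space_def quotient_dist_collapse[OF A] dbar_triangle elim!: quotientE)
qed

end

theory Submission
  imports Defs
begin

text \<open>
  Relative measures are handled through Borel representatives, which may be infinite on \<open>A\<close>.

  The triangle inequality is proved without disintegration. Partition \<open>- A\<close> into countably many
  Borel cells in which \<open>dist y y' \<le> e (d\<^sub>A y + d\<^sub>A y')\<close>; on each cell glue the two couplings by a normalised product, and route through a point of \<open>A\<close> the mass whose middle
  coordinate lies in \<open>A\<close>. The cost increases by at most \<open>2 e \<integral> d\<^sub>A d\<nu>\<close>.

  For the existence of optimal couplings put \<open>m = min (d\<^sub>A x) (d\<^sub>A y)\<close>. The measures \<open>m P\<^sub>n\<close> of a
  minimising sequence have marginals dominated by the finite measures \<open>d\<^sub>A \<mu>\<close> and \<open>d\<^sub>A \<nu>\<close>, so a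
  subfilter converges on all Borel rectangles to a measure \<open>R\<close>. The identity
  \<open>dbar + 2 m = (dbar - \<bar>d\<^sub>A x - d\<^sub>A y\<bar>) + d\<^sub>A x + d\<^sub>A y\<close> splits the cost into a lower
  semicontinuous part, a part given by total masses of \<open>m P\<^sub>n\<close>, which converge, and a constant.
  The optimal coupling is \<open>R / m\<close>, completed by sending to \<open>A\<close> the mass lost in the limit.
\<close>

section \<open>Sums of Borel measures\<close>

text \<open>The obstacle is mass. Integrability of \<open>infdist x A\<close> bounds a measure only
  away from \<open>A\<close>: it may be infinite near \<open>A\<close>, it need not even be
  sigma-finite on \<open>A\<close>, and two couplings with a common middle measure may disagree
  about it on \<open>A\<close>. Hence products, differences and uniqueness of measures are used only
  on pieces of \<open>- A\<close> at positive distance from \<open>A\<close>, where Markov's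
  inequality gives finite mass, and integral identities are written without subtraction. The weight
  \<open>m\<close> plays the same part for compactness: it makes the measures finite and vanishes
  exactly on pairs with a coordinate in \<open>A\<close>. Convergence is taken setwise on Borel
  rectangles rather than weakly, so that marginal bounds pass to the limit directly for every Borel
  set. Mass lost in the limit, once sent to \<open>A\<close>, is invisible both to \<open>m\<close>
  and to the lower semicontinuous part of the cost; this is why the identity, and not semicontinuity
  of the cost alone, yields optimality.\<close>

lemma space_borel_eq: "sets M = sets (borel :: 'a::topological_space measure) \<Longrightarrow> space M = UNIV"
  using sets_eq_imp_space_eq[of M borel] by simp

text \<open>The index is integrated against counting measure, so that one construction serves series
  (index type \<open>nat\<close>) and sums of two measures (index type \<open>bool\<close>).\<close>

definition sum_measure :: "('i \<Rightarrow> 'a::topological_space measure) \<Rightarrow> 'a measure" where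
  "sum_measure M = measure_of UNIV (sets borel) (\<lambda>E. \<integral>\<^sup>+i. emeasure (M i) E \<partial>count_space UNIV)"

lemma sets_sum_measure [simp, measurable_cong]: "sets (sum_measure M) = sets borel"
  unfolding sum_measure_def
  by (metis sets.sets_measure_of_eq space_borel)

lemma space_sum_measure [simp]: "space (sum_measure M) = UNIV"
  by (rule space_borel_eq) simp

lemma emeasure_sum_measure:
  assumes M: "\<And>i. sets (M i) = sets borel" and E: "E \<in> sets borel"
  shows "emeasure (sum_measure M) E = (\<integral>\<^sup>+i. emeasure (M i) E \<partial>count_space UNIV)"
proof (rule emeasure_measure_of[OF sum_measure_def])
  show "countably_additive (sets (sum_measure M)) (\<lambda>E. \<integral>\<^sup>+i. emeasure (M i) E \<partial>count_space UNIV)"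
  proof (rule countably_additiveI)
    fix F :: "nat \<Rightarrow> _" assume F: "range F \<subseteq> sets (sum_measure M)" "disjoint_family F"
    have "(\<Sum>j. \<integral>\<^sup>+i. emeasure (M i) (F j) \<partial>count_space UNIV)
        = (\<integral>\<^sup>+i. (\<Sum>j. emeasure (M i) (F j)) \<partial>count_space UNIV)"
      by (rule nn_integral_suminf[symmetric]) simp
    also have "\<dots> = (\<integral>\<^sup>+i. emeasure (M i) (\<Union>j. F j) \<partial>count_space UNIV)"
      using F M by (intro nn_integral_cong suminf_emeasure) auto
    finally show "(\<Sum>j. \<integral>\<^sup>+i. emeasure (M i) (F j) \<partial>count_space UNIV)
        = (\<integral>\<^sup>+i. emeasure (M i) (\<Union>j. F j) \<partial>count_space UNIV)" .
  qed
qed (use E in \<open>auto simp: positive_def\<close>)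

lemma nn_integral_sum_measure:
  assumes M: "\<And>i. sets (M i) = sets borel" and f: "f \<in> borel_measurable borel"
  shows "(\<integral>\<^sup>+x. f x \<partial>sum_measure M) = (\<integral>\<^sup>+i. (\<integral>\<^sup>+x. f x \<partial>M i) \<partial>count_space UNIV)"
  using f
proof (induction rule: borel_measurable_induct)
  case (cong f g)
  then show ?case by (simp add: fun_eq_iff)
next
  case (set E)
  then show ?case
    using M by (simp add: emeasure_sum_measure)
next
  case (mult u c)
  moreover have "u \<in> borel_measurable (M i)" "u \<in> borel_measurable (sum_measure M)" for i
    using mult(2) by (simp_all add: measurable_cong_sets[OF M refl] measurable_cong_sets[OF sets_sum_measure refl])
  ultimately show ?case
    by (simp add: nn_integral_cmult)
next
  case (add u v)
  moreover have "u \<in> borel_measurable (M i)" "v \<in> borel_measurable (M i)"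
      "u \<in> borel_measurable (sum_measure M)" "v \<in> borel_measurable (sum_measure M)" for i
    using add.hyps by (simp_all add: measurable_cong_sets[OF M refl] measurable_cong_sets[OF sets_sum_measure refl])
  ultimately show ?case
    by (simp add: nn_integral_add)
next
  case (seq U)
  have m: "U k \<in> borel_measurable (M i)" "U k \<in> borel_measurable (sum_measure M)" for i k
    using seq(1) by (simp_all add: measurable_cong_sets[OF M refl] measurable_cong_sets[OF sets_sum_measure refl])
  have "(\<integral>\<^sup>+i. (\<integral>\<^sup>+x. (SUP k. U k x) \<partial>M i) \<partial>count_space UNIV)
      = (\<integral>\<^sup>+i. (SUP k. (\<integral>\<^sup>+x. U k x \<partial>M i)) \<partial>count_space UNIV)"
    using seq m by (intro nn_integral_cong nn_integral_monotone_convergence_SUP) auto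
  also have "\<dots> = (SUP k. \<integral>\<^sup>+i. (\<integral>\<^sup>+x. U k x \<partial>M i) \<partial>count_space UNIV)"
    using seq m
    by (intro nn_integral_monotone_convergence_SUP)
       (auto simp: incseq_def le_fun_def intro!: nn_integral_mono)
  also have "\<dots> = (SUP k. \<integral>\<^sup>+x. U k x \<partial>sum_measure M)"
    using seq.IH by simp
  also have "\<dots> = (\<integral>\<^sup>+x. (SUP k. U k x) \<partial>sum_measure M)"
    using seq m by (intro nn_integral_monotone_convergence_SUP[symmetric]) auto
  finally show ?case by (simp add: image_comp)
qed

definition add_measure :: "'a::topological_space measure \<Rightarrow> 'a measure \<Rightarrow> 'a measure" where
  "add_measure M N = sum_measure (\<lambda>b. if b then M else N)"

lemma sets_add_measure [simp, measurable_cong]: "sets (add_measure M N) = sets borel"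
  by (simp add: add_measure_def)

lemma emeasure_add_measure:
  assumes "sets M = sets borel" "sets N = sets borel" "E \<in> sets borel"
  shows "emeasure (add_measure M N) E = emeasure M E + emeasure N E"
  using assms unfolding add_measure_def
  by (subst emeasure_sum_measure) (auto simp: nn_integral_count_space_finite UNIV_bool add.commute)

lemma nn_integral_add_measure:
  assumes "sets M = sets borel" "sets N = sets borel" "f \<in> borel_measurable borel"
  shows "(\<integral>\<^sup>+x. f x \<partial>add_measure M N) = (\<integral>\<^sup>+x. f x \<partial>M) + (\<integral>\<^sup>+x. f x \<partial>N)"
  using assms unfolding add_measure_def
  by (subst nn_integral_sum_measure) (auto simp: nn_integral_count_space_finite UNIV_bool add.commute)

section \<open>Couplings of representatives\<close>

lemma rel_equiv_class_eq:
  fixes A :: "'a::topological_space set"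
  assumes "closed A" "(M, N) \<in> rel_equiv A"
  shows "rel_class A M = rel_class A N"
  unfolding rel_class_def by (rule equiv_class_eq[OF equiv_rel_equiv[OF assms(1)] assms(2)])

lemma rel_class_eq_iff:
  fixes A :: "'a::topological_space set"
  assumes "closed A" "M \<in> borel_measures" "N \<in> borel_measures"
  shows "rel_class A M = rel_class A N \<longleftrightarrow> (M, N) \<in> rel_equiv A"
  unfolding rel_class_def by (rule eq_equiv_class_iff[OF equiv_rel_equiv[OF assms(1)] assms(2,3)])

lemma rel_equiv_nn_integral_eq:
  fixes A :: "'a::topological_space set"
  assumes A: "closed A" and MN: "(M, N) \<in> rel_equiv A" and f: "f \<in> borel_measurable borel"
    and f0: "\<And>x. x \<in> A \<Longrightarrow> f x = 0"
  shows "(\<integral>\<^sup>+x. f x \<partial>M) = (\<integral>\<^sup>+x. f x \<partial>N)"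
proof -
  have "M \<in> borel_measures" "N \<in> borel_measures"
    using MN by (auto simp: rel_equiv_iff[OF A])
  then show ?thesis
    using rel_nn_integral_rel_class[OF A _ f f0] rel_equiv_class_eq[OF A MN] by metis
qed

text \<open>Couplings at the level of representatives. The marginals are prescribed only off
  \<open>A\<close>, so the mass on \<open>A \<times> A\<close> is unrestricted and either marginal
  may differ from \<open>M\<close> or \<open>N\<close> on \<open>A\<close>.\<close>

definition coupling :: "'a::topological_space set \<Rightarrow> 'a measure \<Rightarrow> 'a measure \<Rightarrow> ('a \<times> 'a) measure \<Rightarrow> bool" where
  "coupling A M N P \<longleftrightarrow> sets P = sets borel \<and>
     (distr P borel fst, M) \<in> rel_equiv A \<and> (distr P borel snd, N) \<in> rel_equiv A"

lemma borel_measurable_fst_snd: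
  "fst \<in> borel_measurable (borel :: ('a::topological_space \<times> 'b::topological_space) measure)"
  "snd \<in> borel_measurable (borel :: ('a::topological_space \<times> 'b::topological_space) measure)"
  by (auto intro!: borel_measurable_continuous_onI continuous_intros)

lemma sets_borel_Times:
  fixes E :: "'a::topological_space set" and F :: "'b::topological_space set"
  assumes "E \<in> sets borel" "F \<in> sets borel"
  shows "E \<times> F \<in> sets borel"
proof -
  have "E \<times> F = fst -` E \<inter> snd -` F" by auto
  then show ?thesis
    using measurable_sets[OF borel_measurable_fst_snd(1) assms(1)]
      measurable_sets[OF borel_measurable_fst_snd(2) assms(2)] by auto
qed

lemma coupling_iff:
  fixes A :: "'a::topological_space set"
  assumes A: "closed A" and M: "sets M = sets borel" and N: "sets N = sets borel"
    and P: "sets P = sets borel"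
  shows "coupling A M N P \<longleftrightarrow>
    (\<forall>E\<in>sets borel. E \<subseteq> - A \<longrightarrow> emeasure P (E \<times> UNIV) = emeasure M E \<and> emeasure P (UNIV \<times> E) = emeasure N E)"
proof -
  have m: "fst \<in> borel_measurable P" "snd \<in> borel_measurable P"
    using borel_measurable_fst_snd by (auto simp: measurable_cong_sets[OF P refl])
  have "fst -` E = E \<times> (UNIV :: 'a set)" "snd -` E = (UNIV :: 'a set) \<times> E" for E :: "'a set" by auto
  then show ?thesis
    using m P M N by (auto simp: coupling_def rel_equiv_iff[OF A] borel_measures_def emeasure_distr space_borel_eq[OF P])
qed

text \<open>The marginals agree with \<open>M\<close> and \<open>N\<close> off \<open>A\<close>, and
  a function vanishing on \<open>A\<close> sees nothing else.\<close>

lemma nn_integral_coupling: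
  fixes A :: "'a::topological_space set"
  assumes A: "closed A" and P: "coupling A M N P" and f: "f \<in> borel_measurable borel"
    and f0: "\<And>x. x \<in> A \<Longrightarrow> f x = 0"
  shows "(\<integral>\<^sup>+z. f (fst z) \<partial>P) = (\<integral>\<^sup>+x. f x \<partial>M)" "(\<integral>\<^sup>+z. f (snd z) \<partial>P) = (\<integral>\<^sup>+x. f x \<partial>N)"
proof -
  have P': "sets P = sets borel" using P by (simp add: coupling_def)
  have m: "fst \<in> borel_measurable P" "snd \<in> borel_measurable P"
    using borel_measurable_fst_snd by (auto simp: measurable_cong_sets[OF P' refl])
  show "(\<integral>\<^sup>+z. f (fst z) \<partial>P) = (\<integral>\<^sup>+x. f x \<partial>M)"
    using rel_equiv_nn_integral_eq[OF A _ f f0, of "distr P borel fst" M] P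
    by (simp add: nn_integral_distr[OF m(1)] f coupling_def)
  show "(\<integral>\<^sup>+z. f (snd z) \<partial>P) = (\<integral>\<^sup>+x. f x \<partial>N)"
    using rel_equiv_nn_integral_eq[OF A _ f f0, of "distr P borel snd" N] P
    by (simp add: nn_integral_distr[OF m(2)] f coupling_def)
qed

lemma rel_class_in_couplings_iff:
  fixes A :: "'a::topological_space set"
  assumes A: "closed A" and M: "M \<in> borel_measures" "N \<in> borel_measures" and P: "P \<in> borel_measures"
  shows "rel_class (A \<times> A) P \<in> couplings A (rel_class A M) (rel_class A N) \<longleftrightarrow> coupling A M N P"
proof -
  have AA: "closed (A \<times> A)" using A by (intro closed_Times)
  have "rel_class (A \<times> A) P \<in> rel_borel_measures (A \<times> A)"
    using P by (simp add: rel_class_def rel_borel_measures_def quotientI)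
  moreover have "distr P borel fst \<in> borel_measures" "distr P borel snd \<in> borel_measures"
    by (simp_all add: borel_measures_def)
  moreover have "rel_push A fst (rel_class (A \<times> A) P) = rel_class A (distr P borel fst)"
      "rel_push A snd (rel_class (A \<times> A) P) = rel_class A (distr P borel snd)"
    by (rule rel_push_rel_class[OF AA A P]; use borel_measurable_fst_snd in auto)+
  ultimately show ?thesis
    using M P by (auto simp: couplings_def coupling_def rel_class_eq_iff[OF A] borel_measures_def)
qed

lemma couplings_eq:
  fixes A :: "'a::topological_space set"
  assumes A: "closed A" and M: "M \<in> borel_measures" "N \<in> borel_measures"
  shows "couplings A (rel_class A M) (rel_class A N) = rel_class (A \<times> A) ` {P. coupling A M N P}"
proof (intro equalityI subsetI)
  fix \<pi> assume \<pi>: "\<pi> \<in> couplings A (rel_class A M) (rel_class A N)"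
  then have "\<pi> \<in> borel_measures // rel_equiv (A \<times> A)"
    by (simp add: couplings_def rel_borel_measures_def)
  then obtain P where P: "P \<in> borel_measures" "\<pi> = rel_class (A \<times> A) P"
    by (auto elim: quotientE simp: rel_class_def)
  then show "\<pi> \<in> rel_class (A \<times> A) ` {P. coupling A M N P}"
    using \<pi> rel_class_in_couplings_iff[OF A M P(1)] by auto
next
  fix \<pi> assume "\<pi> \<in> rel_class (A \<times> A) ` {P. coupling A M N P}"
  then obtain P where P: "coupling A M N P" "\<pi> = rel_class (A \<times> A) P" by auto
  moreover have "P \<in> borel_measures" using P by (simp add: coupling_def borel_measures_def)
  ultimately show "\<pi> \<in> couplings A (rel_class A M) (rel_class A N)"
    using rel_class_in_couplings_iff[OF A M] by auto
qed

section \<open>Cost and distance computed on representatives\<close>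

definition cost :: "'a::metric_space set \<Rightarrow> ('a \<times> 'a) measure \<Rightarrow> ennreal" where
  "cost A P = (\<integral>\<^sup>+z. ennreal (dbar A (fst z) (snd z)) \<partial>P)"

lemma dbar_nonneg: "0 \<le> dbar A x y"
  by (simp add: dbar_def infdist_nonneg)

lemma dbar_sym: "dbar A x y = dbar A y x"
  by (simp add: dbar_def dist_commute add.commute)

lemma dbar_same [simp]: "dbar A x x = 0"
  using infdist_nonneg[of x A] by (simp add: dbar_def)

text \<open>The direct distance to a point of \<open>A\<close> is never shorter than the distance to
  \<open>A\<close>, so the minimum is attained by the route through \<open>A\<close>.\<close>

lemma dbar_in:
  assumes "a \<in> A"
  shows "dbar A x a = infdist x A" "dbar A a x = infdist x A"
  using infdist_le[OF assms, of x] assms infdist_nonneg[of x A]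
  by (auto simp: dbar_def min_def dist_commute)

text \<open>The function \<open>infdist _ A\<close> is 1-Lipschitz, which settles the branch
  \<open>dist x y\<close> of the minimum; in the other branch a difference of nonnegative numbers is
  below their sum. This makes \<open>excess\<close> nonnegative later on.\<close>

lemma abs_infdist_diff_le_dbar: "\<bar>infdist x A - infdist y A\<bar> \<le> dbar A x y"
  using infdist_triangle[of x A y] infdist_triangle[of y A x] infdist_nonneg[of x A] infdist_nonneg[of y A]
  by (auto simp: dbar_def min_def dist_commute)

lemma continuous_on_dbar: "continuous_on UNIV (\<lambda>z. dbar A (fst z) (snd z))"
  unfolding dbar_def by (intro continuous_intros)

lemma borel_measurable_dbar [measurable]:
  "(\<lambda>z. dbar A (fst z) (snd z)) \<in> borel_measurable borel"
  by (rule borel_measurable_continuous_onI[OF continuous_on_dbar])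

lemma borel_measurable_infdist [measurable]:
  "(\<lambda>x. infdist x A) \<in> borel_measurable borel"
  by (intro borel_measurable_continuous_onI continuous_intros)

lemma transport_cost_rel_class:
  fixes A :: "'a::metric_space set"
  assumes A: "closed A" and P: "P \<in> borel_measures"
  shows "transport_cost A (rel_class (A \<times> A) P) = cost A P"
proof -
  have "rel_nn_integral (rel_class (A \<times> A) P) (\<lambda>z. ennreal (dbar A (fst z) (snd z)))
      = (\<integral>\<^sup>+z. ennreal (dbar A (fst z) (snd z)) \<partial>P)"
    by (rule rel_nn_integral_rel_class[OF _ P]) (use A in \<open>auto simp: dbar_in closed_Times\<close>)
  then show ?thesis by (simp add: transport_cost_def cost_def case_prod_unfold)
qed

lemma W1_rel_class:
  fixes A :: "'a::metric_space set"
  assumes A: "closed A" and M: "M \<in> borel_measures" "N \<in> borel_measures"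
  shows "W1 A (rel_class A M) (rel_class A N) = (INF P\<in>{P. coupling A M N P}. cost A P)"
proof -
  have "transport_cost A (rel_class (A \<times> A) P) = cost A P" if "coupling A M N P" for P
    using that by (intro transport_cost_rel_class[OF A]) (simp add: coupling_def borel_measures_def)
  then show ?thesis
    unfolding W1_def couplings_eq[OF A M] image_image by (intro INF_cong) auto
qed

lemma M1_representative:
  fixes A :: "'a::metric_space set"
  assumes A: "closed A" and \<mu>: "\<mu> \<in> M1 A"
  obtains M where "sets M = sets borel" "\<mu> = rel_class A M" "(\<integral>\<^sup>+x. ennreal (infdist x A) \<partial>M) < \<infinity>"
proof -
  have "\<mu> \<in> borel_measures // rel_equiv A" using \<mu> by (simp add: M1_def rel_borel_measures_def)
  then obtain M where M: "M \<in> borel_measures" "\<mu> = rel_class A M"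
    by (auto elim: quotientE simp: rel_class_def)
  moreover have "rel_nn_integral \<mu> (\<lambda>x. ennreal (infdist x A)) = (\<integral>\<^sup>+x. ennreal (infdist x A) \<partial>M)"
    unfolding M(2) by (rule rel_nn_integral_rel_class[OF A M(1)]) auto
  ultimately show ?thesis using that[of M] \<mu> by (auto simp: M1_def borel_measures_def)
qed

section \<open>Transport of all mass to a point of A\<close>

lemma borel_measurable_Pair_const:
  "(\<lambda>x. (x, a)) \<in> borel_measurable (borel :: 'a::topological_space measure)"
  "(\<lambda>x. (a, x)) \<in> borel_measurable (borel :: 'a::topological_space measure)"
  by (auto intro!: borel_measurable_continuous_onI continuous_intros)

text \<open>Every source point is sent to \<open>a\<close> and every target point is filled from
  \<open>a\<close>. For \<open>a\<close> in \<open>A\<close> the mass piled up at \<open>a\<close>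
  is ignored by the relative marginals, so measures of arbitrary and different total mass can be
  coupled.\<close>

definition to_point :: "'a::topological_space \<Rightarrow> 'a measure \<Rightarrow> 'a measure \<Rightarrow> ('a \<times> 'a) measure" where
  "to_point a M N = add_measure (distr M borel (\<lambda>x. (x, a))) (distr N borel (\<lambda>y. (a, y)))"

lemma sets_to_point [simp]: "sets (to_point a M N) = sets borel"
  by (simp add: to_point_def)

lemma nn_integral_to_point:
  assumes M: "sets M = sets borel" "sets N = sets borel" and f: "f \<in> borel_measurable borel"
  shows "(\<integral>\<^sup>+z. f z \<partial>to_point a M N) = (\<integral>\<^sup>+x. f (x, a) \<partial>M) + (\<integral>\<^sup>+y. f (a, y) \<partial>N)"
proof -
  have m: "(\<lambda>x. (x, a)) \<in> borel_measurable M" "(\<lambda>y. (a, y)) \<in> borel_measurable N"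
    using borel_measurable_Pair_const[of a]
    by (auto simp: measurable_cong_sets[OF M(1) refl] measurable_cong_sets[OF M(2) refl])
  show ?thesis
    unfolding to_point_def using f
    by (subst nn_integral_add_measure) (auto simp: nn_integral_distr[OF m(1)] nn_integral_distr[OF m(2)])
qed

lemma emeasure_to_point_Times:
  assumes M: "sets M = sets borel" "sets N = sets borel" and E: "E \<in> sets borel" "a \<notin> E"
  shows "emeasure (to_point a M N) (E \<times> UNIV) = emeasure M E"
    "emeasure (to_point a M N) (UNIV \<times> E) = emeasure N E"
proof -
  have *: "emeasure (to_point a M N) X = (\<integral>\<^sup>+x. indicator X (x, a) \<partial>M) + (\<integral>\<^sup>+y. indicator X (a, y) \<partial>N)"
    if "X \<in> sets borel" for X
    using that nn_integral_to_point[OF M, of "indicator X" a] by simp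
  have E': "E \<times> UNIV \<in> sets borel" "UNIV \<times> E \<in> sets borel"
    using E by (auto intro!: sets_borel_Times)
  have i: "(\<lambda>x. indicator (E \<times> UNIV) (x, a) :: ennreal) = indicator E"
     "(\<lambda>x. indicator (UNIV \<times> E) (a, x) :: ennreal) = indicator E"
     "(\<lambda>x. indicator (E \<times> UNIV) (a, x) :: ennreal) = (\<lambda>x. 0)"
     "(\<lambda>x. indicator (UNIV \<times> E) (x, a) :: ennreal) = (\<lambda>x. 0)"
    using E(2) by (auto simp: fun_eq_iff indicator_def)
  show "emeasure (to_point a M N) (E \<times> UNIV) = emeasure M E"
    "emeasure (to_point a M N) (UNIV \<times> E) = emeasure N E"
    using *[OF E'(1)] *[OF E'(2)] E(1) M by (simp_all add: i)
qed

lemma coupling_to_point: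
  fixes A :: "'a::topological_space set"
  assumes A: "closed A" and a: "a \<in> A" and M: "sets M = sets borel" "sets N = sets borel"
  shows "coupling A M N (to_point a M N)"
  unfolding coupling_iff[OF A M sets_to_point]
  using a by (auto intro!: emeasure_to_point_Times[OF M])

lemma cost_to_point:
  fixes A :: "'a::metric_space set"
  assumes a: "a \<in> A" and M: "sets M = sets borel" "sets N = sets borel"
  shows "cost A (to_point a M N) = (\<integral>\<^sup>+x. infdist x A \<partial>M) + (\<integral>\<^sup>+y. infdist y A \<partial>N)"
  unfolding cost_def by (subst nn_integral_to_point[OF M]) (auto simp: dbar_in[OF a])

lemma W1_finite:
  fixes A :: "'a::metric_space set"
  assumes A: "closed A" "A \<noteq> {}" and \<mu>: "\<mu> \<in> M1 A" "\<nu> \<in> M1 A"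
  shows "W1 A \<mu> \<nu> < \<infinity>"
proof -
  obtain M where M: "sets M = sets borel" "\<mu> = rel_class A M" "(\<integral>\<^sup>+x. ennreal (infdist x A) \<partial>M) < \<infinity>"
    using M1_representative[OF A(1) \<mu>(1)] .
  obtain N where N: "sets N = sets borel" "\<nu> = rel_class A N" "(\<integral>\<^sup>+x. ennreal (infdist x A) \<partial>N) < \<infinity>"
    using M1_representative[OF A(1) \<mu>(2)] .
  obtain a where a: "a \<in> A" using A by auto
  have "W1 A \<mu> \<nu> \<le> cost A (to_point a M N)"
    unfolding M(2) N(2)
    using M(1) N(1) coupling_to_point[OF A(1) a M(1) N(1)]
    by (subst W1_rel_class[OF A(1)]) (auto simp: borel_measures_def intro: INF_lower)
  also have "\<dots> < \<infinity>" using M(3) N(3) by (simp add: cost_to_point[OF a M(1) N(1)])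
  finally show ?thesis .
qed

section \<open>Symmetry, and the distance of a measure to itself\<close>

lemma coupling_swap:
  fixes A :: "'a::metric_space set"
  assumes A: "closed A" and P: "coupling A M N P"
  shows "coupling A N M (distr P borel prod.swap)" "cost A (distr P borel prod.swap) = cost A P"
proof -
  have s: "sets P = sets borel" using P by (simp add: coupling_def)
  have "prod.swap \<in> borel_measurable (borel :: ('a \<times> 'a) measure)"
    by (intro borel_measurable_continuous_onI continuous_on_swap)
  then have sw: "prod.swap \<in> borel_measurable P"
    by (simp add: measurable_cong_sets[OF s refl])
  have "distr (distr P borel prod.swap) borel fst = distr P borel snd"
      "distr (distr P borel prod.swap) borel snd = distr P borel fst"
    using sw by (simp_all add: distr_distr borel_measurable_fst_snd comp_def)
  then show "coupling A N M (distr P borel prod.swap)"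
    using P by (simp add: coupling_def)
  show "cost A (distr P borel prod.swap) = cost A P"
    unfolding cost_def by (subst nn_integral_distr[OF sw]) (auto simp: dbar_sym)
qed

lemma W1_sym_le:
  fixes A :: "'a::metric_space set"
  assumes A: "closed A" and M: "M \<in> borel_measures" "N \<in> borel_measures"
  shows "W1 A (rel_class A M) (rel_class A N) \<le> W1 A (rel_class A N) (rel_class A M)"
  unfolding W1_rel_class[OF A M] W1_rel_class[OF A M(2) M(1)]
  by (rule INF_mono) (use coupling_swap[OF A] in \<open>metis mem_Collect_eq order_refl\<close>)

lemma couplings_imp_classes:
  assumes "\<pi> \<in> couplings A \<mu> \<nu>"
  obtains M N where "M \<in> borel_measures" "N \<in> borel_measures" "\<mu> = rel_class A M" "\<nu> = rel_class A N"
proof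
  show "\<mu> = rel_class A (distr (rel_rep \<pi>) borel fst)" "\<nu> = rel_class A (distr (rel_rep \<pi>) borel snd)"
    using assms by (auto simp: couplings_def rel_push_def)
qed (simp_all add: borel_measures_def)

text \<open>The locale \<^locale>\<open>Metric_space\<close> demands symmetry on the whole type. If one of the arguments
  is not a relative measure, there is no coupling and both sides are infinite.\<close>

lemma W1_sym:
  fixes A :: "'a::metric_space set"
  assumes A: "closed A"
  shows "W1 A \<mu> \<nu> = W1 A \<nu> \<mu>"
proof (cases "\<exists>M\<in>borel_measures. \<exists>N\<in>borel_measures. \<mu> = rel_class A M \<and> \<nu> = rel_class A N")
  case True
  then show ?thesis by (auto intro!: antisym W1_sym_le[OF A])
next
  case False
  then have "couplings A \<mu> \<nu> = {}" "couplings A \<nu> \<mu> = {}"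
    using couplings_imp_classes by (metis equals0I)+
  then show ?thesis by (simp add: W1_def)
qed

lemma W1_self:
  fixes A :: "'a::metric_space set"
  assumes A: "closed A" and M: "sets M = sets borel"
  shows "W1 A (rel_class A M) (rel_class A M) = 0"
proof -
  have "(\<lambda>x. (x, x)) \<in> borel_measurable (borel :: 'a measure)"
    by (intro borel_measurable_continuous_onI continuous_intros)
  then have d: "(\<lambda>x. (x, x)) \<in> borel_measurable M"
    by (simp add: measurable_cong_sets[OF M refl])
  \<comment> \<open>The diagonal coupling, carried by the set where \<open>dbar\<close>
    vanishes.\<close>
  define P where "P = distr M borel (\<lambda>x. (x, x))"
  have MM: "M \<in> borel_measures" using M by (simp add: borel_measures_def)
  have "distr P borel fst = M" "distr P borel snd = M"
    unfolding P_def using d M by (simp_all add: distr_distr borel_measurable_fst_snd comp_def distr_id2)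
  then have "coupling A M M P"
    using MM by (simp add: coupling_def P_def rel_equiv_iff[OF A])
  moreover have "cost A P = 0"
    unfolding cost_def P_def by (subst nn_integral_distr[OF d]) auto
  ultimately have "(INF P\<in>{P. coupling A M M P}. cost A P) \<le> 0"
    by (intro INF_lower2[of P]) auto
  then show ?thesis
    using W1_rel_class[OF A MM MM] by simp
qed

section \<open>Lower bounds by duality\<close>

text \<open>A Kantorovich potential \<open>g - h\<close> changes sign in general. As the total masses may be infinite,
  its two parts are kept on different sides of the inequality.\<close>

lemma coupling_dual_bound:
  fixes A :: "'a::metric_space set"
  assumes A: "closed A" and P: "coupling A M N P"
    and g: "g \<in> borel_measurable borel" "\<And>x. x \<in> A \<Longrightarrow> g x = 0"
    and h: "h \<in> borel_measurable borel" "\<And>x. x \<in> A \<Longrightarrow> h x = 0"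
    and c: "0 \<le> c"
    and le: "\<And>x y. g x + h y \<le> g y + h x + ennreal (c * dbar A x y)"
  shows "(\<integral>\<^sup>+x. g x \<partial>M) + (\<integral>\<^sup>+x. h x \<partial>N) \<le> (\<integral>\<^sup>+x. g x \<partial>N) + (\<integral>\<^sup>+x. h x \<partial>M) + c * cost A P"
proof -
  have s: "sets P = sets borel" using P by (simp add: coupling_def)
  have m: "(\<lambda>z. f (fst z)) \<in> borel_measurable P" "(\<lambda>z. f (snd z)) \<in> borel_measurable P"
    if "f \<in> borel_measurable borel" for f :: "'a \<Rightarrow> ennreal"
    using measurable_compose[OF borel_measurable_fst_snd(1) that] measurable_compose[OF borel_measurable_fst_snd(2) that]
    by (auto simp: measurable_cong_sets[OF s refl])
  have d: "(\<lambda>z. ennreal (dbar A (fst z) (snd z))) \<in> borel_measurable P"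
    by (auto simp: measurable_cong_sets[OF s refl])
  \<comment> \<open>Both potentials vanish on \<open>A\<close>, so their integrals over
    \<open>P\<close> depend on the relative marginals alone.\<close>
  note I = nn_integral_coupling[OF A P g, symmetric] nn_integral_coupling[OF A P h, symmetric]
  have "(\<integral>\<^sup>+x. g x \<partial>M) + (\<integral>\<^sup>+x. h x \<partial>N) = (\<integral>\<^sup>+z. g (fst z) + h (snd z) \<partial>P)"
    using m[OF g(1)] m[OF h(1)] by (simp add: I nn_integral_add)
  also have "\<dots> \<le> (\<integral>\<^sup>+z. g (snd z) + h (fst z) + c * ennreal (dbar A (fst z) (snd z)) \<partial>P)"
    using le c by (intro nn_integral_mono) (simp add: ennreal_mult dbar_nonneg)
  also have "\<dots> = (\<integral>\<^sup>+x. g x \<partial>N) + (\<integral>\<^sup>+x. h x \<partial>M) + c * cost A P"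
    using m[OF g(1)] m[OF h(1)] d by (simp add: I nn_integral_add nn_integral_cmult cost_def)
  finally show ?thesis .
qed

lemma W1_approx_coupling:
  fixes A :: "'a::metric_space set"
  assumes A: "closed A" and M: "M \<in> borel_measures" "N \<in> borel_measures"
    and fin: "W1 A (rel_class A M) (rel_class A N) < \<infinity>" and e: "0 < e"
  obtains P where "coupling A M N P" "cost A P < W1 A (rel_class A M) (rel_class A N) + ennreal e"
proof -
  have "W1 A (rel_class A M) (rel_class A N) < W1 A (rel_class A M) (rel_class A N) + ennreal e"
    using fin e by (cases "W1 A (rel_class A M) (rel_class A N)") (auto simp: ennreal_less_iff simp flip: ennreal_plus)
  then have "(INF P\<in>{P. coupling A M N P}. cost A P) < W1 A (rel_class A M) (rel_class A N) + ennreal e"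
    by (simp only: W1_rel_class[OF A M])
  then show ?thesis using that unfolding INF_less_iff by blast
qed

lemma W1_dual_bound:
  fixes A :: "'a::metric_space set"
  assumes A: "closed A" and M: "M \<in> borel_measures" "N \<in> borel_measures"
    and g: "g \<in> borel_measurable borel" "\<And>x. x \<in> A \<Longrightarrow> g x = 0"
    and h: "h \<in> borel_measurable borel" "\<And>x. x \<in> A \<Longrightarrow> h x = 0"
    and c: "0 < c"
    and le: "\<And>x y. g x + h y \<le> g y + h x + ennreal (c * dbar A x y)"
  shows "(\<integral>\<^sup>+x. g x \<partial>M) + (\<integral>\<^sup>+x. h x \<partial>N)
    \<le> (\<integral>\<^sup>+x. g x \<partial>N) + (\<integral>\<^sup>+x. h x \<partial>M) + c * W1 A (rel_class A M) (rel_class A N)"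
proof (rule ennreal_le_epsilon)
  fix e :: real assume e: "0 < e"
    and fin: "(\<integral>\<^sup>+x. g x \<partial>N) + (\<integral>\<^sup>+x. h x \<partial>M) + c * W1 A (rel_class A M) (rel_class A N) < top"
  let ?W = "W1 A (rel_class A M) (rel_class A N)"
  have W: "?W < top" using fin c by (cases "?W = top") (auto simp: ennreal_mult_top less_top)
  \<comment> \<open>The slack \<open>e / c\<close> becomes \<open>e\<close> once the cost is
    multiplied by \<open>c\<close>.\<close>
  then obtain P where P: "coupling A M N P" "cost A P < ?W + ennreal (e / c)"
    using W1_approx_coupling[OF A M, of "e / c"] e c by auto
  have "(\<integral>\<^sup>+x. g x \<partial>M) + (\<integral>\<^sup>+x. h x \<partial>N) \<le> (\<integral>\<^sup>+x. g x \<partial>N) + (\<integral>\<^sup>+x. h x \<partial>M) + c * cost A P"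
    using assms c by (intro coupling_dual_bound[OF A P(1)]) auto
  also have "\<dots> \<le> (\<integral>\<^sup>+x. g x \<partial>N) + (\<integral>\<^sup>+x. h x \<partial>M) + c * (?W + e / c)"
    using P(2) by (intro add_left_mono mult_left_mono) auto
  also have "\<dots> = (\<integral>\<^sup>+x. g x \<partial>N) + (\<integral>\<^sup>+x. h x \<partial>M) + c * ?W + e"
    using c e by (simp add: distrib_left add.assoc flip: ennreal_mult)
  finally show "(\<integral>\<^sup>+x. g x \<partial>M) + (\<integral>\<^sup>+x. h x \<partial>N)
    \<le> (\<integral>\<^sup>+x. g x \<partial>N) + (\<integral>\<^sup>+x. h x \<partial>M) + c * ?W + e" .
qed

section \<open>Separation of relative measures\<close>

text \<open>Monotone approximation by Lipschitz functions. The complement of \<open>U\<close> has to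
  be nonempty because \<open>infdist x {}\<close> is 0 by convention.\<close>

lemma indicator_limit_infdist:
  fixes U :: "'a::metric_space set"
  assumes "open U" "- U \<noteq> {}"
  shows "(SUP n::nat. ennreal (min 1 (n * infdist x (- U)))) = indicator U x"
proof (cases "x \<in> U")
  case True
  then have "infdist x (- U) > 0"
    using assms in_closed_iff_infdist_zero[of "- U" x] infdist_nonneg[of x "- U"]
    by (metis ComplD closed_Compl less_eq_real_def)
  then obtain n :: nat where "1 < n * infdist x (- U)" using ex_less_of_nat_mult by blast
  then have "1 \<le> ennreal (min 1 (n * infdist x (- U)))" by (simp add: min_def)
  also have "\<dots> \<le> (SUP n::nat. ennreal (min 1 (n * infdist x (- U))))" by (rule SUP_upper) simp
  finally have "1 \<le> (SUP n::nat. ennreal (min 1 (n * infdist x (- U))))" .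
  moreover have "(SUP n::nat. ennreal (min 1 (n * infdist x (- U)))) \<le> 1"
    by (intro SUP_least) (metis ennreal_1 ennreal_leI min.cobounded1)
  ultimately have "(SUP n::nat. ennreal (min 1 (n * infdist x (- U)))) = 1" by (intro antisym)
  then show ?thesis using True by simp
qed simp

text \<open>The truncated multiples of \<open>infdist x (- U)\<close> vanish on \<open>A\<close> and
  are Lipschitz for \<open>dbar\<close>, so they are admissible potentials. At distance zero the
  dual bound orders their integrals, and monotone convergence carries the order over to
  \<open>U\<close>.\<close>

lemma W1_zero_le_on_open:
  fixes A :: "'a::metric_space set"
  assumes A: "closed A" "A \<noteq> {}" and M: "M \<in> borel_measures" "N \<in> borel_measures"
    and W: "W1 A (rel_class A M) (rel_class A N) = 0" and U: "open U" "U \<subseteq> - A"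
  shows "emeasure M U \<le> emeasure N U"
proof -
  define g where "g = (\<lambda>(n::nat) x. min 1 (n * infdist x (- U)))"
  have s: "sets M = sets borel" "sets N = sets borel" using M by (auto simp: borel_measures_def)
  have ne: "- U \<noteq> {}" using U A by auto
  have gm: "(\<lambda>x. ennreal (g n x)) \<in> borel_measurable borel" for n unfolding g_def by measurable
  have g0: "g n x \<ge> 0" for n x by (simp add: g_def infdist_nonneg)
  have infle: "infdist x (- U) \<le> infdist x A" for x
    using U A by (intro infdist_mono) auto
  have le: "g n x \<le> g n y + n * dbar A x y" for n x y
  proof -
    \<comment> \<open>If the minimum is the route through \<open>A\<close>, the estimate holds
      because \<open>A\<close> lies in \<open>- U\<close>, so that \<open>infdist x (- U)\<close> is
      already at most \<open>infdist x A\<close>.\<close>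
    have "infdist x (- U) \<le> infdist y (- U) + dbar A x y"
      using infdist_triangle[of x "- U" y] infle[of x] infdist_nonneg[of y "- U"] infdist_nonneg[of y A]
      by (auto simp: dbar_def min_def)
    then have "n * infdist x (- U) \<le> n * infdist y (- U) + n * dbar A x y"
      by (metis distrib_left mult_left_mono of_nat_0_le_iff)
    moreover have "0 \<le> n * dbar A x y" by (simp add: dbar_nonneg)
    ultimately show ?thesis unfolding g_def by linarith
  qed
  have I: "(\<integral>\<^sup>+x. g n x \<partial>M) \<le> (\<integral>\<^sup>+x. g n x \<partial>N)" if n: "n > 0" for n
  proof -
    have "(\<integral>\<^sup>+x. g n x \<partial>M) + (\<integral>\<^sup>+x. 0 \<partial>N) \<le> (\<integral>\<^sup>+x. g n x \<partial>N) + (\<integral>\<^sup>+x. 0 \<partial>M)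
        + real n * W1 A (rel_class A M) (rel_class A N)"
    proof (rule W1_dual_bound[OF A(1) M gm])
      show "ennreal (g n x) = 0" if "x \<in> A" for x
        using that infle[of x] infdist_nonneg[of x "- U"] by (simp add: g_def)
      show "ennreal (g n x) + 0 \<le> ennreal (g n y) + 0 + ennreal (real n * dbar A x y)" for x y
        using le[of n x y] g0 by (simp add: dbar_nonneg ennreal_leI flip: ennreal_plus)
    qed (use n in auto)
    then show ?thesis by (simp add: W)
  qed
  have mono: "incseq (\<lambda>n x. ennreal (g n x))"
  proof (rule incseq_SucI, rule le_funI)
    fix n x
    have "real n * infdist x (- U) \<le> real (Suc n) * infdist x (- U)"
      by (rule mult_right_mono) (simp_all add: infdist_nonneg)
    then have "g n x \<le> g (Suc n) x" unfolding g_def by linarith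
    then show "ennreal (g n x) \<le> ennreal (g (Suc n) x)" by (rule ennreal_leI)
  qed
  have lim: "emeasure L U = (SUP n. \<integral>\<^sup>+x. g n x \<partial>L)" if L: "sets L = sets borel" for L
  proof -
    have "emeasure L U = (\<integral>\<^sup>+x. indicator U x \<partial>L)"
      using U L by (subst nn_integral_indicator) auto
    also have "\<dots> = (\<integral>\<^sup>+x. (SUP n. ennreal (g n x)) \<partial>L)"
      unfolding g_def by (subst indicator_limit_infdist[OF U(1) ne]) simp
    also have "\<dots> = (SUP n. \<integral>\<^sup>+x. g n x \<partial>L)"
      using mono gm by (intro nn_integral_monotone_convergence_SUP) (auto simp: measurable_cong_sets[OF L refl])
    finally show ?thesis .
  qed
  show ?thesis
    unfolding lim[OF s(1)] lim[OF s(2)]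
  proof (rule SUP_mono)
    fix n
    show "\<exists>m\<in>UNIV. (\<integral>\<^sup>+x. g n x \<partial>M) \<le> (\<integral>\<^sup>+x. g m x \<partial>N)"
      \<comment> \<open>The dual bound wants a positive Lipschitz constant; for \<open>n = 0\<close>
        the function is zero.\<close>
      using I[of n] by (cases "n = 0") (auto simp: g_def)
  qed
qed

text \<open>Markov's inequality. It provides finiteness away from \<open>A\<close>, the substitute
  for finite total mass throughout.\<close>

lemma emeasure_away_finite:
  fixes A :: "'a::metric_space set"
  assumes s: "sets M = sets borel" and fin: "(\<integral>\<^sup>+x. ennreal (infdist x A) \<partial>M) < \<infinity>" and r: "r > 0"
  shows "emeasure M {x. r < infdist x A} < \<infinity>"
proof -
  have m: "{x. r < infdist x A} \<in> sets M" unfolding s by measurable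
  have "ennreal r * emeasure M {x. r < infdist x A} = (\<integral>\<^sup>+x. ennreal r * indicator {x. r < infdist x A} x \<partial>M)"
    using m by (simp add: nn_integral_cmult_indicator)
  also have "\<dots> \<le> (\<integral>\<^sup>+x. ennreal (infdist x A) \<partial>M)"
    by (intro nn_integral_mono) (auto simp: indicator_def intro!: ennreal_leI)
  finally have "ennreal r * emeasure M {x. r < infdist x A} < top" using fin by (auto simp: top_unique less_top)
  then show ?thesis using r by (auto simp: ennreal_mult_less_top)
qed

text \<open>Open sets are stable under intersection and generate the Borel sets, but uniqueness of
  measures needs finiteness. It is therefore applied to the restrictions to the sets
  \<open>U n\<close>, of finite mass by Markov's inequality, which increase to
  \<open>- A\<close>.\<close>

lemma rel_equiv_if_eq_on_open:
  fixes A :: "'a::metric_space set"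
  assumes A: "closed A" "A \<noteq> {}" and s: "sets M = sets borel" "sets N = sets borel"
    and fin: "(\<integral>\<^sup>+x. ennreal (infdist x A) \<partial>M) < \<infinity>"
    and eq: "\<And>U. open U \<Longrightarrow> U \<subseteq> - A \<Longrightarrow> emeasure M U = emeasure N U"
  shows "(M, N) \<in> rel_equiv A"
proof -
  define U where "U = (\<lambda>n::nat. {x. inverse (Suc n) < infdist x A})"
  have oU: "open (U n)" for n
    unfolding U_def by (intro open_Collect_less continuous_intros)
  have UA: "U n \<subseteq> - A" for n by (auto simp: U_def)
  have fU: "emeasure M (U n) < \<infinity>" for n
    unfolding U_def by (rule emeasure_away_finite[OF s(1) fin]) simp
  have restr: "emeasure (density L (indicator V)) E = emeasure L (V \<inter> E)"
    if "sets L = sets borel" "V \<in> sets borel" "E \<in> sets borel" for L :: "'a measure" and V E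
    using that by (simp add: emeasure_density indicator_inter_arith[symmetric] sets.Int)
  have d: "density M (indicator (U n)) = density N (indicator (U n))" for n
  proof (rule measure_eqI_generator_eq[where E = "{S. open S}" and \<Omega> = UNIV and A = "\<lambda>_. UNIV"])
    show "Int_stable {S::'a set. open S}" by (auto simp: Int_stable_def)
    show "emeasure (density M (indicator (U n))) X = emeasure (density N (indicator (U n))) X"
      if "X \<in> {S. open S}" for X
      using that s oU UA[of n] by (subst (1 2) restr) (auto intro!: eq)
    show "emeasure (density M (indicator (U n))) UNIV \<noteq> \<infinity>" for i :: nat
      using fU[of n] oU s by (subst restr) auto
  qed (auto simp: s borel_def sets_measure_of_conv)
  have "emeasure M E = emeasure N E" if E: "E \<in> sets borel" "E \<subseteq> - A" for E
  proof -
    have *: "emeasure L E = (SUP n. emeasure (density L (indicator (U n))) E)" if L: "sets L = sets borel" for L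
    proof -
      have un: "(\<Union>n. U n \<inter> E) = E"
      proof (intro equalityI subsetI)
        fix x assume x: "x \<in> E"
        then have "infdist x A > 0"
          using E in_closed_iff_infdist_zero[OF A, of x] infdist_nonneg[of x A] by force
        from reals_Archimedean[OF this] show "x \<in> (\<Union>n. U n \<inter> E)"
          using x by (auto simp: U_def)
      qed auto
      have inc: "incseq (\<lambda>n. U n \<inter> E)"
      proof (rule incseq_SucI)
        fix n
        have le: "inverse (real (Suc (Suc n))) \<le> inverse (real (Suc n))" by (rule le_imp_inverse_le) auto
        then show "U n \<inter> E \<subseteq> U (Suc n) \<inter> E"
          using order.strict_trans1[OF le] unfolding U_def by blast
      qed
      have ms: "U n \<in> sets borel" for n using oU[of n] by (rule borel_open)
      then have "range (\<lambda>n. U n \<inter> E) \<subseteq> sets L"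
        unfolding L using E(1) by blast
      from SUP_emeasure_incseq[OF this inc]
      have "emeasure L E = (SUP n. emeasure L (U n \<inter> E))" by (simp only: un)
      then show ?thesis by (simp only: restr[OF L ms E(1)])
    qed
    show ?thesis by (simp only: *[OF s(1)] *[OF s(2)] d)
  qed
  then show ?thesis using s by (auto simp: rel_equiv_iff[OF A(1)] borel_measures_def)
qed

lemma W1_eq_0_iff:
  fixes A :: "'a::metric_space set"
  assumes A: "closed A" "A \<noteq> {}" and \<mu>: "\<mu> \<in> M1 A" "\<nu> \<in> M1 A"
  shows "W1 A \<mu> \<nu> = 0 \<longleftrightarrow> \<mu> = \<nu>"
proof
  assume W: "W1 A \<mu> \<nu> = 0"
  obtain M where M: "sets M = sets borel" "\<mu> = rel_class A M" "(\<integral>\<^sup>+x. ennreal (infdist x A) \<partial>M) < \<infinity>"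
    using M1_representative[OF A(1) \<mu>(1)] .
  obtain N where N: "sets N = sets borel" "\<nu> = rel_class A N" "(\<integral>\<^sup>+x. ennreal (infdist x A) \<partial>N) < \<infinity>"
    using M1_representative[OF A(1) \<mu>(2)] .
  have MN: "M \<in> borel_measures" "N \<in> borel_measures" using M N by (auto simp: borel_measures_def)
  have W': "W1 A (rel_class A M) (rel_class A N) = 0" "W1 A (rel_class A N) (rel_class A M) = 0"
    using W W1_sym[OF A(1), of \<mu> \<nu>] M N by auto
  have "(M, N) \<in> rel_equiv A"
    using W1_zero_le_on_open[OF A MN W'(1)] W1_zero_le_on_open[OF A MN(2,1) W'(2)]
    by (intro rel_equiv_if_eq_on_open[OF A M(1) N(1) M(3)] antisym)
  then show "\<mu> = \<nu>" unfolding M N by (rule rel_equiv_class_eq[OF A(1)])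
next
  assume "\<mu> = \<nu>"
  then show "W1 A \<mu> \<nu> = 0"
    using M1_representative[OF A(1) \<mu>(1)] W1_self[OF A(1)] by metis
qed

section \<open>Dirac measures\<close>

text \<open>A unit mass on \<open>A\<close> is relatively zero. Hence the collapsed point needs no
  separate treatment in the embedding: every class of the quotient goes to the Dirac measure at any
  of its points.\<close>

lemma rel_zero_eq_dirac:
  fixes A :: "'a::t1_space set"
  assumes "closed A" "a \<in> A"
  shows "rel_zero A = rel_dirac A a"
  unfolding rel_zero_def rel_dirac_def
  by (rule rel_equiv_class_eq[OF assms(1)])
     (use assms in \<open>auto simp: rel_equiv_iff borel_measures_def indicator_def\<close>)

lemma rel_dirac_in_M1:
  fixes A :: "'a::metric_space set"
  assumes A: "closed A"
  shows "rel_dirac A x \<in> M1 A"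
proof -
  have b: "return borel x \<in> borel_measures" by (simp add: borel_measures_def)
  have "rel_nn_integral (rel_dirac A x) (\<lambda>x. ennreal (infdist x A)) = ennreal (infdist x A)"
    unfolding rel_dirac_def
    by (subst rel_nn_integral_rel_class[OF A b]) (auto simp: nn_integral_return)
  moreover have "tight_rel A (rel_dirac A x)"
    unfolding tight_rel_def
  proof (intro ballI impI)
    fix E assume E: "E \<in> sets borel" "E \<subseteq> - A"
    have em: "rel_emeasure (rel_dirac A x) F = indicator F x" if "F \<in> sets borel" "F \<subseteq> E" for F
      using that E unfolding rel_dirac_def by (subst rel_emeasure_rel_class[OF A b]) auto
    show "rel_emeasure (rel_dirac A x) E = (SUP K\<in>{K. compact K \<and> K \<subseteq> E}. rel_emeasure (rel_dirac A x) K)"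
    proof (rule antisym)
      show "rel_emeasure (rel_dirac A x) E \<le> (SUP K\<in>{K. compact K \<and> K \<subseteq> E}. rel_emeasure (rel_dirac A x) K)"
      proof (cases "x \<in> E")
        case True
        then show ?thesis using em[OF E(1)] em[of "{x}"] by (intro SUP_upper2[of "{x}"]) auto
      qed (use em[OF E(1)] in auto)
      show "(SUP K\<in>{K. compact K \<and> K \<subseteq> E}. rel_emeasure (rel_dirac A x) K) \<le> rel_emeasure (rel_dirac A x) E"
        using em[OF E(1)] em
        by (intro SUP_least) (auto simp: borel_compact indicator_def)
    qed
  qed
  moreover have "rel_dirac A x \<in> rel_borel_measures A"
    unfolding rel_dirac_def rel_class_def rel_borel_measures_def by (rule quotientI[OF b])
  ultimately show ?thesis by (simp add: M1_def)
qed

lemma W1_dirac: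
  fixes A :: "'a::{metric_space, second_countable_topology} set"
  assumes A: "closed A" "A \<noteq> {}"
  shows "W1 A (rel_dirac A x) (rel_dirac A y) = ennreal (dbar A x y)"
proof (rule antisym)
  have b: "return borel z \<in> borel_measures" for z :: 'a by (simp add: borel_measures_def)
  define P where "P = return borel (x, y)"
  have "coupling A (return borel x) (return borel y) P"
    unfolding P_def by (subst coupling_iff[OF A(1)]) (auto simp: sets_borel_Times indicator_def)
  moreover have "cost A P = ennreal (dbar A x y)"
    unfolding cost_def P_def by (subst nn_integral_return) auto
  ultimately show "W1 A (rel_dirac A x) (rel_dirac A y) \<le> ennreal (dbar A x y)"
    unfolding rel_dirac_def W1_rel_class[OF A(1) b b] by (metis INF_lower mem_Collect_eq)
  \<comment> \<open>A Kantorovich potential. As \<open>dbar A z y\<close> equals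
    \<open>infdist y A\<close> for \<open>z\<close> in \<open>A\<close>, the constant makes
    \<open>f\<close> vanish there, and \<open>f x - f y\<close> is exactly
    \<open>dbar A x y\<close>.\<close>
  define f where "f = (\<lambda>z. dbar A z y - infdist y A)"
  have fm: "f \<in> borel_measurable borel"
    unfolding f_def dbar_def by measurable
  have f0: "f z = 0" if "z \<in> A" for z using that by (simp add: f_def dbar_in)
  have lip: "f z - f w \<le> dbar A z w" for z w
    using dbar_triangle[of A z y w] by (simp add: f_def)
  define g where "g = (\<lambda>z. max 0 (f z))"
  define h where "h = (\<lambda>z. max 0 (- f z))"
  have gh: "0 \<le> g z" "0 \<le> h z" "f z = g z - h z" for z by (auto simp: g_def h_def)
  have gm: "(\<lambda>z. ennreal (g z)) \<in> borel_measurable borel" "(\<lambda>z. ennreal (h z)) \<in> borel_measurable borel"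
    unfolding g_def h_def using fm by measurable
  have "(\<integral>\<^sup>+z. g z \<partial>return borel x) + (\<integral>\<^sup>+z. h z \<partial>return borel y)
    \<le> (\<integral>\<^sup>+z. g z \<partial>return borel y) + (\<integral>\<^sup>+z. h z \<partial>return borel x)
      + ennreal 1 * W1 A (rel_class A (return borel x)) (rel_class A (return borel y))"
  proof (rule W1_dual_bound[OF A(1) b b gm(1) _ gm(2)])
    show "ennreal (g z) + ennreal (h w) \<le> ennreal (g w) + ennreal (h z) + ennreal (1 * dbar A z w)" for z w
      using lip[of z w] gh[of z] gh[of w] by (simp add: dbar_nonneg ennreal_leI flip: ennreal_plus)
  qed (use f0 in \<open>auto simp: g_def h_def\<close>)
  then have *: "ennreal (g x) + ennreal (h y) \<le> ennreal (g y) + ennreal (h x) + W1 A (rel_dirac A x) (rel_dirac A y)"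
    using gm by (simp add: nn_integral_return rel_dirac_def)
  show "ennreal (dbar A x y) \<le> W1 A (rel_dirac A x) (rel_dirac A y)"
  \<comment> \<open>The parts of the potential are recombined in the reals; an infinite distance is
    trivially an upper bound.\<close>
  proof (cases "W1 A (rel_dirac A x) (rel_dirac A y)")
    case (real r)
    then have "g x + h y \<le> g y + h x + r"
      using * gh by (simp flip: ennreal_plus)
    moreover have "f x - f y = dbar A x y" by (simp add: f_def)
    ultimately have "dbar A x y \<le> r" using gh(3)[of x] gh(3)[of y] by linarith
    then show ?thesis using real by (simp add: ennreal_leI)
  qed simp
qed

section \<open>Gluing couplings along small cells\<close>

text \<open>A density rather than a measure on a subspace: space and sigma-algebra remain those of
  \<open>M\<close>, so that restrictions to different sets can be summed.\<close>

definition restrict_to :: "'a measure \<Rightarrow> 'a set \<Rightarrow> 'a measure" where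
  "restrict_to M S = density M (indicator S)"

lemma sets_restrict_to [simp]: "sets (restrict_to M S) = sets M"
  by (simp add: restrict_to_def)

lemma emeasure_restrict_to:
  assumes "S \<in> sets M" "E \<in> sets M"
  shows "emeasure (restrict_to M S) E = emeasure M (S \<inter> E)"
  using assms unfolding restrict_to_def
  by (simp add: emeasure_density indicator_inter_arith[symmetric] sets.Int)

lemma nn_integral_restrict_to:
  assumes "S \<in> sets M" "f \<in> borel_measurable M"
  shows "(\<integral>\<^sup>+x. f x \<partial>restrict_to M S) = (\<integral>\<^sup>+x. indicator S x * f x \<partial>M)"
  using assms unfolding restrict_to_def by (subst nn_integral_density) auto

lemma nn_integral_restrict_to_UN:
  fixes S :: "nat \<Rightarrow> 'a set"
  assumes S: "\<And>j. S j \<in> sets M" "disjoint_family S" and f: "f \<in> borel_measurable M"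
  shows "(\<integral>\<^sup>+j. (\<integral>\<^sup>+x. f x \<partial>restrict_to M (S j)) \<partial>count_space UNIV) = (\<integral>\<^sup>+x. f x \<partial>restrict_to M (\<Union>j. S j))"
proof -
  have "(\<integral>\<^sup>+j. (\<integral>\<^sup>+x. f x \<partial>restrict_to M (S j)) \<partial>count_space UNIV)
      = (\<Sum>j. \<integral>\<^sup>+x. indicator (S j) x * f x \<partial>M)"
    using S f by (simp add: nn_integral_restrict_to nn_integral_count_space_nat)
  also have "\<dots> = (\<integral>\<^sup>+x. (\<Sum>j. indicator (S j) x * f x) \<partial>M)"
    using S f by (intro nn_integral_suminf[symmetric]) auto
  also have "\<dots> = (\<integral>\<^sup>+x. indicator (\<Union>j. S j) x * f x \<partial>M)"
    using S by (simp add: suminf_indicator)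
  also have "\<dots> = (\<integral>\<^sup>+x. f x \<partial>restrict_to M (\<Union>j. S j))"
    using S f by (subst nn_integral_restrict_to) auto
  finally show ?thesis .
qed

lemma nn_integral_restrict_to_split:
  assumes S: "S \<in> sets M" "T \<in> sets M" "S \<union> T = space M" "S \<inter> T = {}" and f: "f \<in> borel_measurable M"
  shows "(\<integral>\<^sup>+x. f x \<partial>restrict_to M S) + (\<integral>\<^sup>+x. f x \<partial>restrict_to M T) = (\<integral>\<^sup>+x. f x \<partial>M)"
proof -
  have "(\<integral>\<^sup>+x. f x \<partial>restrict_to M S) + (\<integral>\<^sup>+x. f x \<partial>restrict_to M T)
      = (\<integral>\<^sup>+x. indicator S x * f x + indicator T x * f x \<partial>M)"
    using S f by (simp add: nn_integral_restrict_to nn_integral_add)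
  also have "\<dots> = (\<integral>\<^sup>+x. f x \<partial>M)"
    using S by (intro nn_integral_cong) (auto simp: indicator_def)
  finally show ?thesis .
qed

lemma AE_restrict_to:
  assumes "S \<in> sets M"
  shows "AE x in restrict_to M S. x \<in> S"
  unfolding restrict_to_def using assms by (subst AE_density) (auto simp: indicator_def)

section \<open>Gluing two couplings over one cell\<close>

text \<open>For equal masses \<open>n\<close>, the product divided by \<open>n\<close> has marginals
  \<open>P\<close> and \<open>Q\<close>. The integrand \<open>u + v\<close> is the form in which the
  triangle inequality bounds a glued cost.\<close>

lemma nn_integral_normalised_product:
  assumes P: "finite_measure P" and Q: "finite_measure Q"
    and n: "emeasure P (space P) = n" "emeasure Q (space Q) = n"
    and u: "u \<in> borel_measurable P" and v: "v \<in> borel_measurable Q"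
  shows "(\<integral>\<^sup>+w. u (fst w) + v (snd w) \<partial>scale_measure (inverse n) (P \<Otimes>\<^sub>M Q)) = (\<integral>\<^sup>+p. u p \<partial>P) + (\<integral>\<^sup>+q. v q \<partial>Q)"
proof -
  interpret P: finite_measure P by fact
  interpret Q: finite_measure Q by fact
  have m: "(\<lambda>w. u (fst w)) \<in> borel_measurable (P \<Otimes>\<^sub>M Q)" "(\<lambda>w. v (snd w)) \<in> borel_measurable (P \<Otimes>\<^sub>M Q)"
    using u v by (auto intro: measurable_compose[OF measurable_fst] measurable_compose[OF measurable_snd])
  have nfin: "n \<noteq> top" using n P.emeasure_finite by auto
  have "(\<integral>\<^sup>+w. u (fst w) + v (snd w) \<partial>scale_measure (inverse n) (P \<Otimes>\<^sub>M Q))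
      = inverse n * (\<integral>\<^sup>+w. u (fst w) + v (snd w) \<partial>(P \<Otimes>\<^sub>M Q))"
    using m by (intro nn_integral_scale_measure) auto
  also have "(\<integral>\<^sup>+w. u (fst w) + v (snd w) \<partial>(P \<Otimes>\<^sub>M Q)) = (\<integral>\<^sup>+p. (\<integral>\<^sup>+q. u p + v q \<partial>Q) \<partial>P)"
    using m by (subst Q.nn_integral_fst[symmetric]) auto
  also have "\<dots> = (\<integral>\<^sup>+p. n * u p + (\<integral>\<^sup>+q. v q \<partial>Q) \<partial>P)"
    using v n by (intro nn_integral_cong) (simp add: nn_integral_add mult.commute)
  also have "\<dots> = n * (\<integral>\<^sup>+p. u p \<partial>P) + (\<integral>\<^sup>+q. v q \<partial>Q) * n"
    using u n by (simp add: nn_integral_add nn_integral_cmult)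
  also have "\<dots> = n * ((\<integral>\<^sup>+p. u p \<partial>P) + (\<integral>\<^sup>+q. v q \<partial>Q))"
    by (simp only: distrib_left mult.commute[of "\<integral>\<^sup>+q. v q \<partial>Q" n])
  finally have *: "(\<integral>\<^sup>+w. u (fst w) + v (snd w) \<partial>scale_measure (inverse n) (P \<Otimes>\<^sub>M Q))
      = inverse n * (n * ((\<integral>\<^sup>+p. u p \<partial>P) + (\<integral>\<^sup>+q. v q \<partial>Q)))" .
  show ?thesis
  proof (cases "n = 0")
    \<comment> \<open>Here \<open>inverse n\<close> is \<open>top\<close>, but it multiplies zero,
      and integrals over the null measures \<open>P\<close> and \<open>Q\<close> vanish as
      well.\<close>
    case True
    then have "AE p in P. False" "AE q in Q. False"
      using n by (auto intro!: AE_I[of _ _ "space P"] AE_I[of _ _ "space Q"])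
    then have "(\<integral>\<^sup>+p. u p \<partial>P) = 0" "(\<integral>\<^sup>+q. v q \<partial>Q) = 0"
      using u v by (auto simp: nn_integral_0_iff_AE elim: AE_mp)
    then show ?thesis using * by simp
  next
    case False
    have "n / n = 1"
      using mult_divide_eq_ennreal[OF False nfin, of 1] by simp
    then have "inverse n * n = 1" by (simp only: divide_ennreal_def mult.commute[of "inverse n" n])
    then show ?thesis by (simp only: * mult.assoc[symmetric] mult_1)
  qed
qed

text \<open>Pairs \<open>(x, y)\<close> and \<open>(y', z)\<close> are drawn independently and only
  \<open>(x, z)\<close> is kept. The middle points \<open>y\<close> and \<open>y'\<close> need not
  coincide; the price is their distance, which is why the cells have to be small.\<close>

definition glue :: "('a \<times> 'a) measure \<Rightarrow> ('a \<times> 'a) measure \<Rightarrow> ('a::topological_space \<times> 'a) measure" where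
  "glue P Q = distr (scale_measure (inverse (emeasure P (space P))) (P \<Otimes>\<^sub>M Q)) borel (\<lambda>w. (fst (fst w), snd (snd w)))"

lemma sets_glue [simp]: "sets (glue P Q) = sets borel"
  by (simp add: glue_def)

lemma
  fixes P Q :: "('a::second_countable_topology \<times> 'a) measure"
  assumes P: "finite_measure P" "sets P = sets borel" and Q: "finite_measure Q" "sets Q = sets borel"
    and n: "emeasure P (space P) = emeasure Q (space Q)"
  shows nn_integral_glue_le: "f \<in> borel_measurable borel \<Longrightarrow> u \<in> borel_measurable borel \<Longrightarrow> v \<in> borel_measurable borel \<Longrightarrow>
      S \<in> sets borel \<Longrightarrow> T \<in> sets borel \<Longrightarrow> AE p in P. p \<in> S \<Longrightarrow> AE q in Q. q \<in> T \<Longrightarrow>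
      (\<And>p q. p \<in> S \<Longrightarrow> q \<in> T \<Longrightarrow> f (fst p, snd q) \<le> u p + v q) \<Longrightarrow>
      (\<integral>\<^sup>+z. f z \<partial>glue P Q) \<le> (\<integral>\<^sup>+p. u p \<partial>P) + (\<integral>\<^sup>+q. v q \<partial>Q)"
    and nn_integral_glue_fst: "g \<in> borel_measurable borel \<Longrightarrow> (\<integral>\<^sup>+z. g (fst z) \<partial>glue P Q) = (\<integral>\<^sup>+p. g (fst p) \<partial>P)"
    and nn_integral_glue_snd: "g \<in> borel_measurable borel \<Longrightarrow> (\<integral>\<^sup>+z. g (snd z) \<partial>glue P Q) = (\<integral>\<^sup>+p. g (snd p) \<partial>Q)"
proof -
  interpret P: finite_measure P by fact
  interpret Q: finite_measure Q by fact
  let ?S = "scale_measure (inverse (emeasure P (space P))) (P \<Otimes>\<^sub>M Q)"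
  have m: "(\<lambda>w. (fst (fst w), snd (snd w))) \<in> borel_measurable ?S"
  proof -
    have "sets ?S = sets (borel \<Otimes>\<^sub>M borel :: (('a \<times> 'a) \<times> ('a \<times> 'a)) measure)"
      by (simp add: P(2) Q(2) cong: sets_pair_measure_cong)
    also have "\<dots> = sets borel" by (simp only: borel_prod)
    finally show ?thesis
      by (subst measurable_cong_sets[OF _ refl]) (auto intro!: borel_measurable_continuous_onI continuous_intros)
  qed
  have I: "(\<integral>\<^sup>+z. f z \<partial>glue P Q) = (\<integral>\<^sup>+w. f (fst (fst w), snd (snd w)) \<partial>?S)"
    if "f \<in> borel_measurable borel" for f
    unfolding glue_def using that by (subst nn_integral_distr[OF m]) auto
  have N: "(\<integral>\<^sup>+w. u (fst w) + v (snd w) \<partial>?S) = (\<integral>\<^sup>+p. u p \<partial>P) + (\<integral>\<^sup>+q. v q \<partial>Q)"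
    if "u \<in> borel_measurable borel" "v \<in> borel_measurable borel" for u v
    using that n
    by (intro nn_integral_normalised_product[OF P(1) Q(1)])
       (auto simp: measurable_cong_sets[OF P(2) refl] measurable_cong_sets[OF Q(2) refl])
  show "(\<integral>\<^sup>+z. g (fst z) \<partial>glue P Q) = (\<integral>\<^sup>+p. g (fst p) \<partial>P)" if "g \<in> borel_measurable borel"
    using N[of "\<lambda>p. g (fst p)" "\<lambda>_. 0"] I[of "\<lambda>z. g (fst z)"] measurable_compose[OF borel_measurable_fst_snd(1) that] by simp
  show "(\<integral>\<^sup>+z. g (snd z) \<partial>glue P Q) = (\<integral>\<^sup>+p. g (snd p) \<partial>Q)" if "g \<in> borel_measurable borel"
    using N[of "\<lambda>_. 0" "\<lambda>p. g (snd p)"] I[of "\<lambda>z. g (snd z)"] measurable_compose[OF borel_measurable_fst_snd(2) that] by simp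
  show "(\<integral>\<^sup>+z. f z \<partial>glue P Q) \<le> (\<integral>\<^sup>+p. u p \<partial>P) + (\<integral>\<^sup>+q. v q \<partial>Q)"
    if f: "f \<in> borel_measurable borel" and uv: "u \<in> borel_measurable borel" "v \<in> borel_measurable borel"
      and S: "S \<in> sets borel" "T \<in> sets borel" "AE p in P. p \<in> S" "AE q in Q. q \<in> T"
      and le: "\<And>p q. p \<in> S \<Longrightarrow> q \<in> T \<Longrightarrow> f (fst p, snd q) \<le> u p + v q"
  proof -
    \<comment> \<open>The value \<open>\<infinity>\<close> off \<open>S\<close> and \<open>T\<close>
      makes the inequality hold everywhere, so that no null sets of the product have to be
      described; the integrals over \<open>P\<close> and \<open>Q\<close> do not change.\<close>
    define u' where "u' = (\<lambda>p. if p \<in> S then u p else \<infinity>)"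
    define v' where "v' = (\<lambda>q. if q \<in> T then v q else \<infinity>)"
    have uv': "u' \<in> borel_measurable borel" "v' \<in> borel_measurable borel"
      unfolding u'_def v'_def using S uv by measurable
    have "(\<integral>\<^sup>+z. f z \<partial>glue P Q) \<le> (\<integral>\<^sup>+w. u' (fst w) + v' (snd w) \<partial>?S)"
      unfolding I[OF f] by (intro nn_integral_mono) (auto simp: u'_def v'_def intro!: le)
    also have "\<dots> = (\<integral>\<^sup>+p. u' p \<partial>P) + (\<integral>\<^sup>+q. v' q \<partial>Q)" by (rule N[OF uv'])
    also have "(\<integral>\<^sup>+p. u' p \<partial>P) = (\<integral>\<^sup>+p. u p \<partial>P)"
      using S(3) by (intro nn_integral_cong_AE) (auto simp: u'_def elim!: eventually_mono)
    also have "(\<integral>\<^sup>+q. v' q \<partial>Q) = (\<integral>\<^sup>+q. v q \<partial>Q)"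
      using S(4) by (intro nn_integral_cong_AE) (auto simp: v'_def elim!: eventually_mono)
    finally show ?thesis .
  qed
qed

section \<open>Cells small relative to the distance to A\<close>

text \<open>A Whitney-type partition. The sets \<open>S j\<close> around a dense sequence compare
  the distance to the centre with the distance to \<open>A\<close> of the point itself, so two
  points of a cell are compared through the centre without further constants. Positive distance from
  \<open>A\<close> is what gives the cells finite mass.\<close>

lemma small_cells:
  fixes A :: "'a::polish_space set"
  assumes A: "closed A" "A \<noteq> {}" and e: "0 < e" "e \<le> 1"
  obtains D :: "nat \<Rightarrow> 'a set" where "disjoint_family D" "(\<Union>j. D j) = - A" "\<And>j. D j \<in> sets borel"
    "\<And>j y y'. y \<in> D j \<Longrightarrow> y' \<in> D j \<Longrightarrow> dist y y' \<le> e * (infdist y A + infdist y' A)"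
    "\<And>j. \<exists>r>0. D j \<subseteq> {y. r < infdist y A}"
proof -
  obtain C :: "'a set" where C: "countable C" "\<And>X. open X \<Longrightarrow> X \<noteq> {} \<Longrightarrow> \<exists>d\<in>C. d \<in> X"
    using countable_dense_exists[where 'a = 'a] by auto
  have "C \<noteq> {}" using C(2)[of UNIV] by auto
  define q where "q = from_nat_into C"
  define S where "S = (\<lambda>j. {y. dist y (q j) < e * infdist y A})"
  have oS: "open (S j)" for j
    unfolding S_def by (intro open_Collect_less continuous_intros)
  define D where "D = disjointed S"
  have DS: "D j \<subseteq> S j" for j unfolding D_def by (rule disjointed_subset)
  show ?thesis
  proof (rule that[of D])
    show "disjoint_family D" unfolding D_def by (rule disjoint_family_disjointed)
    have "(\<Union>j. S j) = - A"
    proof (intro equalityI subsetI)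
      fix y assume "y \<in> - A"
      then have "infdist y A > 0"
        using in_closed_iff_infdist_zero[OF A, of y] infdist_nonneg[of y A] by force
      then have "0 < e * infdist y A" by (rule mult_pos_pos[OF e(1)])
      then have "y \<in> ball y (e * infdist y A)" by simp
      then obtain d where "d \<in> C" "dist y d < e * infdist y A"
        using C(2)[of "ball y (e * infdist y A)"] by auto
      then show "y \<in> (\<Union>j. S j)"
        using from_nat_into_surj[OF C(1), of d] by (auto simp: S_def q_def)
    qed (auto simp: S_def)
    then show "(\<Union>j. D j) = - A" unfolding D_def by (simp add: UN_disjointed_eq)
    show "D j \<in> sets borel" for j
      unfolding D_def using oS by (intro sets.range_disjointed_sets[THEN subsetD, of S borel]) auto
    show "dist y y' \<le> e * (infdist y A + infdist y' A)" if "y \<in> D j" "y' \<in> D j" for j y y'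
    proof -
      have "dist y (q j) < e * infdist y A" "dist y' (q j) < e * infdist y' A"
        using that DS[of j] by (auto simp: S_def)
      then show ?thesis
        unfolding distrib_left using dist_triangle2[of y y' "q j"] by linarith
    qed
    show "\<exists>r>0. D j \<subseteq> {y. r < infdist y A}" for j
    proof (cases "q j \<in> A")
      \<comment> \<open>A centre in \<open>A\<close> yields an empty set:
        \<open>dist y (q j)\<close> is at least \<open>infdist y A\<close>, and
        \<open>e \<le> 1\<close>.\<close>
      case True
      have "S j = {}"
      proof -
        have False if "dist y (q j) < e * infdist y A" for y
        proof -
          have "e * infdist y A \<le> 1 * infdist y A" using e infdist_nonneg by (intro mult_right_mono) auto
          then show False using that infdist_le[OF True, of y] by simp
        qed
        then show ?thesis by (auto simp: S_def)
      qed
      then show ?thesis using DS[of j] by (intro exI[of _ 1]) auto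
    next
      case False
      then have p: "infdist (q j) A > 0"
        using in_closed_iff_infdist_zero[OF A, of "q j"] infdist_nonneg[of "q j" A] by force
      \<comment> \<open>The triangle inequality through \<open>y\<close> gives
        \<open>infdist (q j) A < 2 * infdist y A\<close>; a third leaves room.\<close>
      have "infdist (q j) A / 3 < infdist y A" if "y \<in> S j" for y
      proof -
        have "e * infdist y A \<le> 1 * infdist y A" using e infdist_nonneg by (intro mult_right_mono) auto
        moreover have "dist y (q j) < e * infdist y A" using that by (simp add: S_def)
        moreover have "infdist (q j) A \<le> infdist y A + dist (q j) y" by (rule infdist_triangle)
        ultimately show ?thesis using p by (simp add: dist_commute)
      qed
      then show ?thesis using p DS[of j] by (intro exI[of _ "infdist (q j) A / 3"]) auto
    qed
  qed
qed

lemma UN_Times_borel: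
  "S \<in> sets borel \<Longrightarrow> UNIV \<times> S \<in> sets (borel :: ('a::topological_space \<times> 'b::topological_space) measure)"
  "T \<in> sets borel \<Longrightarrow> T \<times> UNIV \<in> sets (borel :: ('a \<times> 'b) measure)"
  by (auto intro: sets_borel_Times)

text \<open>Over a cell both couplings carry the mass \<open>emeasure N (D j)\<close>, which is
  finite, so they can be glued there. Of the error \<open>e * (infdist y A + infdist y' A)\<close>
  one summand is charged to \<open>P\<close> and the other to \<open>Q\<close>; each integrates to
  at most \<open>e\<close> times the integral over \<open>N\<close>, whence the factor
  \<open>2 * e\<close>.\<close>

lemma glue_couplings:
  fixes A :: "'a::polish_space set"
  assumes A: "closed A" "A \<noteq> {}" and MNL: "sets M = sets borel" "sets N = sets borel" "sets L = sets borel"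
    and fin: "(\<integral>\<^sup>+x. ennreal (infdist x A) \<partial>N) < \<infinity>"
    and P: "coupling A M N P" and Q: "coupling A N L Q" and e: "0 < e" "e \<le> 1"
  obtains R where "coupling A M L R"
    "cost A R \<le> cost A P + cost A Q + ennreal (2 * e) * (\<integral>\<^sup>+x. ennreal (infdist x A) \<partial>N)"
proof -
  obtain a where a: "a \<in> A" using A by auto
  obtain D :: "nat \<Rightarrow> 'a set" where D: "disjoint_family D" "(\<Union>j. D j) = - A" and DB: "\<And>j. D j \<in> sets borel"
    and small: "\<And>j y y'. y \<in> D j \<Longrightarrow> y' \<in> D j \<Longrightarrow> dist y y' \<le> e * (infdist y A + infdist y' A)"
    and away: "\<And>j. \<exists>r>0. D j \<subseteq> {y. r < infdist y A}"
    using small_cells[OF A e] by blast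
  have DA: "D j \<subseteq> - A" for j using D(2) by auto
  have cover: "x \<in> A \<or> (\<exists>j. x \<in> D j)" for x using D(2) by blast
  have covers: "(\<Union>j. UNIV \<times> D j) \<union> UNIV \<times> A = (UNIV :: ('a \<times> 'a) set)"
      "(\<Union>j. D j \<times> UNIV) \<union> A \<times> UNIV = (UNIV :: ('a \<times> 'a) set)"
    using cover by fast+
  have disj: "(\<Union>j. UNIV \<times> D j) \<inter> UNIV \<times> A = ({} :: ('a \<times> 'a) set)"
      "(\<Union>j. D j \<times> UNIV) \<inter> A \<times> UNIV = ({} :: ('a \<times> 'a) set)"
    using DA by fast+
  have sP: "sets P = sets borel" and sQ: "sets Q = sets borel" using P Q by (auto simp: coupling_def)
  have AB: "A \<in> sets borel" using A by auto
  note cP = P[unfolded coupling_iff[OF A(1) MNL(1,2) sP], rule_format]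
  note cQ = Q[unfolded coupling_iff[OF A(1) MNL(2,3) sQ], rule_format]
  define PD where "PD = (\<lambda>j. restrict_to P (UNIV \<times> D j))"
  define QD where "QD = (\<lambda>j. restrict_to Q (D j \<times> UNIV))"
  \<comment> \<open>Over \<open>A\<close> the second marginal of \<open>P\<close> and the first
    marginal of \<open>Q\<close> may differ, so these two parts cannot be glued.\<close>
  define PA where "PA = restrict_to P (UNIV \<times> A)"
  define QA where "QA = restrict_to Q (A \<times> UNIV)"
  have Db: "UNIV \<times> D j \<in> sets (borel :: ('a \<times> 'a) measure)" "D j \<times> UNIV \<in> sets (borel :: ('a \<times> 'a) measure)" for j
    by (rule UN_Times_borel[OF DB])+
  have Ab: "UNIV \<times> A \<in> sets (borel :: ('a \<times> 'a) measure)" "A \<times> UNIV \<in> sets (borel :: ('a \<times> 'a) measure)"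
    by (rule UN_Times_borel[OF AB])+
  have DUB: "(\<Union>j. UNIV \<times> D j) \<in> sets (borel :: ('a \<times> 'a) measure)"
      "(\<Union>j. D j \<times> UNIV) \<in> sets (borel :: ('a \<times> 'a) measure)"
    using Db by (auto intro!: sets.countable_UN)
  have sPD: "sets (PD j) = sets borel" "sets (QD j) = sets borel" for j
    by (simp_all add: PD_def QD_def sP sQ)
  have sPA: "sets PA = sets borel" "sets QA = sets borel"
    by (simp_all add: PA_def QA_def sP sQ)
  have sp: "space (PD j) = UNIV" "space (QD j) = UNIV" for j
    by (simp_all add: space_borel_eq sPD)
  have n: "emeasure (PD j) UNIV = emeasure N (D j)" "emeasure (QD j) UNIV = emeasure N (D j)" for j
    using cP[OF DB[of j] DA[of j]] cQ[OF DB[of j] DA[of j]] Db[of j] unfolding PD_def QD_def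
    by (simp_all add: emeasure_restrict_to sP sQ)
  have Nfin: "emeasure N (D j) < \<infinity>" for j
  proof -
    obtain r where r: "r > 0" "D j \<subseteq> {y. r < infdist y A}" using away[of j] by auto
    have "{y. r < infdist y A} \<in> sets N" unfolding MNL by measurable
    then have "emeasure N (D j) \<le> emeasure N {y. r < infdist y A}" by (rule emeasure_mono[OF r(2)])
    also have "\<dots> < \<infinity>" by (rule emeasure_away_finite[OF MNL(2) fin r(1)])
    finally show ?thesis .
  qed
  have fm: "finite_measure (PD j)" "finite_measure (QD j)" for j
    using n[of j] Nfin[of j] by (auto intro!: finite_measureI simp: sp)
  have nn: "emeasure (PD j) (space (PD j)) = emeasure (QD j) (space (QD j))" for j by (simp add: sp n)
  \<comment> \<open>The glued cells, together with the starting points of \<open>PA\<close> sent to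
    \<open>a\<close> and the end points of \<open>QA\<close> filled from \<open>a\<close>.\<close>
  define R where "R = add_measure (sum_measure (\<lambda>j. glue (PD j) (QD j)))
    (to_point a (distr PA borel fst) (distr QA borel snd))"
  have IR: "(\<integral>\<^sup>+z. f z \<partial>R) = (\<integral>\<^sup>+j. (\<integral>\<^sup>+z. f z \<partial>glue (PD j) (QD j)) \<partial>count_space UNIV)
      + ((\<integral>\<^sup>+z. f (fst z, a) \<partial>PA) + (\<integral>\<^sup>+z. f (a, snd z) \<partial>QA))"
    if f: "f \<in> borel_measurable borel" for f
  proof -
    have m: "fst \<in> borel_measurable PA" "snd \<in> borel_measurable QA"
      using borel_measurable_fst_snd
      by (auto simp: measurable_cong_sets[OF sPA(1) refl] measurable_cong_sets[OF sPA(2) refl])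
    have f': "(\<lambda>x. f (x, a)) \<in> borel_measurable borel" "(\<lambda>x. f (a, x)) \<in> borel_measurable borel"
      using f borel_measurable_Pair_const[of a] by (auto intro: measurable_compose)
    show ?thesis
      unfolding R_def using f
      by (simp add: nn_integral_add_measure nn_integral_sum_measure nn_integral_to_point
          nn_integral_distr[OF m(1)] nn_integral_distr[OF m(2)] f')
  qed
  have mP: "f \<in> borel_measurable P" "f \<in> borel_measurable Q" if "f \<in> borel_measurable borel" for f :: "_ \<Rightarrow> ennreal"
    using that by (auto simp: measurable_cong_sets[OF sP refl] measurable_cong_sets[OF sQ refl])
  have dPD: "disjoint_family (\<lambda>j. UNIV \<times> D j)" "disjoint_family (\<lambda>j. D j \<times> UNIV)"
    using D(1) by (auto simp: disjoint_family_on_def)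
  have splitP: "(\<integral>\<^sup>+j. (\<integral>\<^sup>+z. f z \<partial>PD j) \<partial>count_space UNIV) + (\<integral>\<^sup>+z. f z \<partial>PA) = (\<integral>\<^sup>+z. f z \<partial>P)"
    if f: "f \<in> borel_measurable borel" for f
  proof -
    have "(\<integral>\<^sup>+j. (\<integral>\<^sup>+z. f z \<partial>PD j) \<partial>count_space UNIV) = (\<integral>\<^sup>+z. f z \<partial>restrict_to P (\<Union>j. UNIV \<times> D j))"
      unfolding PD_def using Db dPD sP mP[OF f] by (intro nn_integral_restrict_to_UN) auto
    moreover have "(\<integral>\<^sup>+z. f z \<partial>restrict_to P (\<Union>j. UNIV \<times> D j)) + (\<integral>\<^sup>+z. f z \<partial>PA) = (\<integral>\<^sup>+z. f z \<partial>P)"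
      unfolding PA_def
      by (rule nn_integral_restrict_to_split)
         (simp_all only: sP DUB Ab covers disj space_borel_eq[OF sP] mP[OF f])
    ultimately show ?thesis by simp
  qed
  have splitQ: "(\<integral>\<^sup>+j. (\<integral>\<^sup>+z. f z \<partial>QD j) \<partial>count_space UNIV) + (\<integral>\<^sup>+z. f z \<partial>QA) = (\<integral>\<^sup>+z. f z \<partial>Q)"
    if f: "f \<in> borel_measurable borel" for f
  proof -
    have "(\<integral>\<^sup>+j. (\<integral>\<^sup>+z. f z \<partial>QD j) \<partial>count_space UNIV) = (\<integral>\<^sup>+z. f z \<partial>restrict_to Q (\<Union>j. D j \<times> UNIV))"
      unfolding QD_def using Db dPD sQ mP[OF f] by (intro nn_integral_restrict_to_UN) auto
    moreover have "(\<integral>\<^sup>+z. f z \<partial>restrict_to Q (\<Union>j. D j \<times> UNIV)) + (\<integral>\<^sup>+z. f z \<partial>QA) = (\<integral>\<^sup>+z. f z \<partial>Q)"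
      unfolding QA_def
      by (rule nn_integral_restrict_to_split)
         (simp_all only: sQ DUB Ab covers disj space_borel_eq[OF sQ] mP[OF f])
    ultimately show ?thesis by simp
  qed
  have sR: "sets R = sets borel" by (simp add: R_def)
  show ?thesis
  proof (rule that[of R])
    show "coupling A M L R"
      unfolding coupling_iff[OF A(1) MNL(1,3) sR]
    proof (intro ballI impI conjI)
      fix E assume E: "E \<in> sets borel" "E \<subseteq> - A"
      then have aE: "a \<notin> E" using a by auto
      let ?g = "indicator E :: 'a \<Rightarrow> ennreal"
      have g: "?g \<in> borel_measurable borel" using E by simp
      have g': "(\<lambda>z. ?g (fst z)) \<in> borel_measurable borel" "(\<lambda>z. ?g (snd z)) \<in> borel_measurable borel"
        using measurable_compose[OF borel_measurable_fst_snd(1) g] measurable_compose[OF borel_measurable_fst_snd(2) g] by auto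
      have em: "emeasure S (E \<times> UNIV) = (\<integral>\<^sup>+z. ?g (fst z) \<partial>S)" "emeasure S (UNIV \<times> E) = (\<integral>\<^sup>+z. ?g (snd z) \<partial>S)"
        if "sets S = sets borel" for S :: "('a \<times> 'a) measure"
      proof -
        have "(\<integral>\<^sup>+z. ?g (fst z) \<partial>S) = (\<integral>\<^sup>+z. indicator (E \<times> UNIV) z \<partial>S)"
            "(\<integral>\<^sup>+z. ?g (snd z) \<partial>S) = (\<integral>\<^sup>+z. indicator (UNIV \<times> E) z \<partial>S)"
          by (auto intro!: nn_integral_cong simp: indicator_def)
        then show "emeasure S (E \<times> UNIV) = (\<integral>\<^sup>+z. ?g (fst z) \<partial>S)" "emeasure S (UNIV \<times> E) = (\<integral>\<^sup>+z. ?g (snd z) \<partial>S)"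
          using E(1) that by (auto simp: UN_Times_borel)
      qed
      have "emeasure R (E \<times> UNIV) = (\<integral>\<^sup>+z. ?g (fst z) \<partial>P)"
        unfolding em(1)[OF sR] IR[OF g'(1)] splitP[OF g'(1), symmetric] using aE
        by (simp add: nn_integral_glue_fst[OF fm(1) sPD(1) fm(2) sPD(2) nn g])
      then show "emeasure R (E \<times> UNIV) = emeasure M E"
        using cP[OF E] em(1)[OF sP] by simp
      have "emeasure R (UNIV \<times> E) = (\<integral>\<^sup>+z. ?g (snd z) \<partial>Q)"
        unfolding em(2)[OF sR] IR[OF g'(2)] splitQ[OF g'(2), symmetric] using aE
        by (simp add: nn_integral_glue_snd[OF fm(1) sPD(1) fm(2) sPD(2) nn g])
      then show "emeasure R (UNIV \<times> E) = emeasure L E"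
        using cQ[OF E] em(2)[OF sQ] by simp
    qed
    let ?d = "\<lambda>z. ennreal (dbar A (fst z) (snd z))"
    let ?h1 = "\<lambda>z. ennreal (infdist (fst z) A)" and ?h2 = "\<lambda>z. ennreal (infdist (snd z) A)"
    have dm: "?d \<in> borel_measurable borel" by measurable
    have im: "(\<lambda>x. ennreal (infdist x A)) \<in> borel_measurable borel" by measurable
    have hm: "?h1 \<in> borel_measurable borel" "?h2 \<in> borel_measurable borel"
      using measurable_compose[OF borel_measurable_fst_snd(1) im] measurable_compose[OF borel_measurable_fst_snd(2) im] by auto
    \<comment> \<open>Each share of the error involves only the middle coordinate of its own
      coupling, hence integrates to an integral over \<open>N\<close>.\<close>
    define u where "u = (\<lambda>z. ?d z + ennreal e * ?h2 z)"
    define v where "v = (\<lambda>z. ennreal e * ?h1 z + ?d z)"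
    have um: "u \<in> borel_measurable borel" "v \<in> borel_measurable borel"
      unfolding u_def v_def
      using dm hm by measurable
    have gl: "(\<integral>\<^sup>+z. ?d z \<partial>glue (PD j) (QD j)) \<le> (\<integral>\<^sup>+z. u z \<partial>PD j) + (\<integral>\<^sup>+z. v z \<partial>QD j)" for j
    proof (rule nn_integral_glue_le[OF fm(1) sPD(1) fm(2) sPD(2) nn dm um Db])
      show "AE p in PD j. p \<in> UNIV \<times> D j" unfolding PD_def using Db sP by (intro AE_restrict_to) auto
      show "AE q in QD j. q \<in> D j \<times> UNIV" unfolding QD_def using Db sQ by (intro AE_restrict_to) auto
      fix p q :: "'a \<times> 'a" assume pq: "p \<in> UNIV \<times> D j" "q \<in> D j \<times> UNIV"
      have "dbar A (fst p) (snd q) \<le> dbar A (fst p) (snd p) + dbar A (snd p) (fst q) + dbar A (fst q) (snd q)"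
        using dbar_triangle[of A "fst p" "snd q" "snd p"] dbar_triangle[of A "snd p" "snd q" "fst q"] by linarith
      also have "dbar A (snd p) (fst q) \<le> dist (snd p) (fst q)" by (simp add: dbar_def)
      also have "dist (snd p) (fst q) \<le> e * (infdist (snd p) A + infdist (fst q) A)"
        using small[of "snd p" j "fst q"] pq by (auto simp: mem_Times_iff)
      finally have "dbar A (fst p) (snd q) \<le> (dbar A (fst p) (snd p) + e * infdist (snd p) A)
          + (e * infdist (fst q) A + dbar A (fst q) (snd q))"
        by (simp add: distrib_left)
      then show "?d (fst p, snd q) \<le> u p + v q"
        using e by (simp add: u_def v_def dbar_nonneg infdist_nonneg ennreal_leI flip: ennreal_plus ennreal_mult)
    qed
    \<comment> \<open>Mass that ends in \<open>A\<close> has already paid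
      \<open>infdist (fst z) A\<close>, which is also its cost to reach \<open>a\<close>; rerouting
      it is free.\<close>
    have PAle: "(\<integral>\<^sup>+z. ?d (fst z, a) \<partial>PA) \<le> (\<integral>\<^sup>+z. u z \<partial>PA)"
    proof (rule nn_integral_mono_AE)
      have "AE z in PA. z \<in> UNIV \<times> A" unfolding PA_def using Ab sP by (intro AE_restrict_to) auto
      then show "AE z in PA. ?d (fst z, a) \<le> u z"
        by (rule eventually_mono) (auto simp: u_def dbar_in a)
    qed
    have QAle: "(\<integral>\<^sup>+z. ?d (a, snd z) \<partial>QA) \<le> (\<integral>\<^sup>+z. v z \<partial>QA)"
    proof (rule nn_integral_mono_AE)
      have "AE z in QA. z \<in> A \<times> UNIV" unfolding QA_def using Ab sQ by (intro AE_restrict_to) auto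
      then show "AE z in QA. ?d (a, snd z) \<le> v z"
        by (rule eventually_mono) (auto simp: v_def dbar_in a)
    qed
    have "cost A R = (\<integral>\<^sup>+j. (\<integral>\<^sup>+z. ?d z \<partial>glue (PD j) (QD j)) \<partial>count_space UNIV)
        + ((\<integral>\<^sup>+z. ?d (fst z, a) \<partial>PA) + (\<integral>\<^sup>+z. ?d (a, snd z) \<partial>QA))"
      unfolding cost_def by (rule IR[OF dm])
    also have "\<dots> \<le> (\<integral>\<^sup>+j. (\<integral>\<^sup>+z. u z \<partial>PD j) + (\<integral>\<^sup>+z. v z \<partial>QD j) \<partial>count_space UNIV)
        + ((\<integral>\<^sup>+z. u z \<partial>PA) + (\<integral>\<^sup>+z. v z \<partial>QA))"
      by (intro add_mono PAle QAle) (rule nn_integral_mono[OF gl])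
    also have "\<dots> = (\<integral>\<^sup>+z. u z \<partial>P) + (\<integral>\<^sup>+z. v z \<partial>Q)"
      unfolding splitP[OF um(1), symmetric] splitQ[OF um(2), symmetric]
      by (subst nn_integral_add) (auto simp: ac_simps)
    also have "(\<integral>\<^sup>+z. u z \<partial>P) = cost A P + ennreal e * (\<integral>\<^sup>+x. ennreal (infdist x A) \<partial>N)"
      unfolding u_def cost_def using mP(1)[OF dm] mP(1)[OF hm(2)] nn_integral_coupling(2)[OF A(1) P im]
      by (simp add: nn_integral_add nn_integral_cmult)
    also have "(\<integral>\<^sup>+z. v z \<partial>Q) = ennreal e * (\<integral>\<^sup>+x. ennreal (infdist x A) \<partial>N) + cost A Q"
      unfolding v_def cost_def using mP(2)[OF dm] mP(2)[OF hm(1)] nn_integral_coupling(1)[OF A(1) Q im]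
      by (simp add: nn_integral_add nn_integral_cmult)
    finally have "cost A R \<le> cost A P + cost A Q
        + (ennreal e + ennreal e) * (\<integral>\<^sup>+x. ennreal (infdist x A) \<partial>N)"
      by (simp only: distrib_right ac_simps)
    moreover have "ennreal (2 * e) = ennreal e + ennreal e" using e by (simp flip: ennreal_plus)
    ultimately show "cost A R \<le> cost A P + cost A Q + ennreal (2 * e) * (\<integral>\<^sup>+x. ennreal (infdist x A) \<partial>N)"
      by (simp only:)
  qed
qed

lemma W1_triangle:
  fixes A :: "'a::polish_space set"
  assumes A: "closed A" "A \<noteq> {}" and \<mu>: "\<mu> \<in> M1 A" "\<nu> \<in> M1 A" "\<kappa> \<in> M1 A"
  shows "W1 A \<mu> \<kappa> \<le> W1 A \<mu> \<nu> + W1 A \<nu> \<kappa>"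
proof (rule ennreal_le_epsilon)
  fix \<epsilon> :: real assume \<epsilon>: "0 < \<epsilon>"
  obtain M where M: "sets M = sets borel" "\<mu> = rel_class A M"
    using M1_representative[OF A(1) \<mu>(1)] .
  obtain N where N: "sets N = sets borel" "\<nu> = rel_class A N" "(\<integral>\<^sup>+x. ennreal (infdist x A) \<partial>N) < \<infinity>"
    using M1_representative[OF A(1) \<mu>(2)] .
  obtain L where L: "sets L = sets borel" "\<kappa> = rel_class A L"
    using M1_representative[OF A(1) \<mu>(3)] .
  have b: "M \<in> borel_measures" "N \<in> borel_measures" "L \<in> borel_measures"
    using M N L by (auto simp: borel_measures_def)
  obtain C where C: "C \<ge> 0" "(\<integral>\<^sup>+x. ennreal (infdist x A) \<partial>N) = ennreal C"
    using N(3) by (cases "\<integral>\<^sup>+x. ennreal (infdist x A) \<partial>N") auto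
  \<comment> \<open>A quarter of \<open>\<epsilon>\<close> is spent on each near-optimal coupling
    and half on the gluing error \<open>2 * e * C\<close>. The denominator has \<open>C + 1\<close>
    because \<open>C\<close> may be 0, and the bound 1 is demanded by the partition into
    cells.\<close>
  define e where "e = min 1 (\<epsilon> / (4 * (C + 1)))"
  have e: "0 < e" "e \<le> 1" using \<epsilon> C by (auto simp: e_def)
  have "2 * e * C \<le> 2 * (\<epsilon> / (4 * (C + 1))) * C"
    using C by (intro mult_right_mono) (auto simp: e_def)
  also have "\<dots> \<le> \<epsilon> / 2" using C \<epsilon> by (simp add: field_simps)
  finally have eC: "2 * e * C \<le> \<epsilon> / 2" .
  have e4: "\<epsilon> / 4 > 0" using \<epsilon> by simp
  obtain P where P: "coupling A M N P" "cost A P < W1 A \<mu> \<nu> + ennreal (\<epsilon> / 4)"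
    using W1_approx_coupling[OF A(1) b(1,2) _ e4] W1_finite[OF A \<mu>(1,2)] unfolding M N by blast
  obtain Q where Q: "coupling A N L Q" "cost A Q < W1 A \<nu> \<kappa> + ennreal (\<epsilon> / 4)"
    using W1_approx_coupling[OF A(1) b(2,3) _ e4] W1_finite[OF A \<mu>(2,3)] unfolding N L by blast
  obtain R where R: "coupling A M L R" "cost A R \<le> cost A P + cost A Q + ennreal (2 * e) * ennreal C"
    using glue_couplings[OF A M(1) N(1) L(1) N(3) P(1) Q(1) e] unfolding C(2) by blast
  have "W1 A \<mu> \<kappa> \<le> cost A R"
    unfolding M L W1_rel_class[OF A(1) b(1,3)] using R by (intro INF_lower) simp
  also have "\<dots> \<le> cost A P + cost A Q + ennreal (2 * e) * ennreal C" by (rule R)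
  also have "ennreal (2 * e) * ennreal C \<le> ennreal (\<epsilon> / 2)"
    using eC e C by (simp add: ennreal_leI flip: ennreal_mult)
  also have "cost A P + cost A Q + ennreal (\<epsilon> / 2)
      \<le> (W1 A \<mu> \<nu> + ennreal (\<epsilon> / 4)) + (W1 A \<nu> \<kappa> + ennreal (\<epsilon> / 4)) + ennreal (\<epsilon> / 2)"
    using P Q by (intro add_mono) auto
  also have "\<dots> = W1 A \<mu> \<nu> + W1 A \<nu> \<kappa> + (ennreal (\<epsilon> / 4) + ennreal (\<epsilon> / 4) + ennreal (\<epsilon> / 2))"
    by (simp only: ac_simps)
  also have "ennreal (\<epsilon> / 4) + ennreal (\<epsilon> / 4) + ennreal (\<epsilon> / 2) = ennreal \<epsilon>"
    using \<epsilon> by (simp flip: ennreal_plus)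
  finally show "W1 A \<mu> \<kappa> \<le> W1 A \<mu> \<nu> + W1 A \<nu> \<kappa> + ennreal \<epsilon>" by simp
qed

section \<open>Compactness of measures with dominated marginals\<close>

text \<open>Tychonoff's theorem in place of a diagonal argument, so that the index set need not be countable.\<close>

lemma pointwise_bounded_subfilter:
  fixes x :: "nat \<Rightarrow> 'b \<Rightarrow> real"
  assumes b: "\<And>n i. x n i \<in> {0..C}"
  obtains G f where "G \<noteq> bot" "G \<le> sequentially" "\<And>i. ((\<lambda>n. x n i) \<longlongrightarrow> f i) G"
proof -
  define S where "S = PiE UNIV (\<lambda>_::'b. {0..C})"
  have "compactin (product_topology (\<lambda>i. euclidean) UNIV) S"
    unfolding S_def by (subst compactin_PiE) auto
  then have "compact S" by (simp add: euclidean_product_topology)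
  moreover have "filtermap x sequentially \<noteq> bot" by (simp add: filtermap_bot_iff)
  moreover have "eventually (\<lambda>g. g \<in> S) (filtermap x sequentially)"
    using b by (simp add: eventually_filtermap S_def PiE_UNIV_domain Pi_def)
  ultimately obtain f where f: "inf (nhds f) (filtermap x sequentially) \<noteq> bot"
    unfolding compact_filter by blast
  \<comment> \<open>The indices whose terms are near the cluster point \<open>f\<close>. That
    \<open>f\<close> is a cluster point makes this filter proper, and being finer than
    \<open>sequentially\<close> it preserves eventual statements.\<close>
  define G where "G = inf (filtercomap x (nhds f)) sequentially"
  have "G \<noteq> bot"
  proof
    assume "G = bot"
    then have "eventually (\<lambda>_. False) G" by simp
    then obtain P Q where P: "eventually P (filtercomap x (nhds f))" "eventually Q sequentially"
      and PQ: "\<And>n. P n \<Longrightarrow> Q n \<Longrightarrow> False"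
      unfolding G_def eventually_inf by blast
    obtain P' where P': "eventually P' (nhds f)" "\<And>n. P' (x n) \<Longrightarrow> P n"
      using P(1) unfolding eventually_filtercomap by blast
    have "eventually (\<lambda>g. \<not> P' g) (filtermap x sequentially)"
      unfolding eventually_filtermap using P(2) by (rule eventually_mono) (use P'(2) PQ in blast)
    with P'(1) have "eventually (\<lambda>_. False) (inf (nhds f) (filtermap x sequentially))"
      unfolding eventually_inf by blast
    then show False using f by (simp add: trivial_limit_def)
  qed
  moreover have "G \<le> sequentially" by (simp add: G_def)
  moreover have "((\<lambda>n. x n i) \<longlongrightarrow> f i) G" for i
  proof -
    have "filterlim x (nhds f) G"
      unfolding filterlim_def G_def
      by (rule order_trans[OF filtermap_mono[OF inf_le1] filtermap_filtercomap])
    from continuous_on_tendsto_compose[OF continuous_on_product_coordinates[of i] this]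
    show ?thesis by simp
  qed
  ultimately show ?thesis by (rule that)
qed

section \<open>Uniform tightness and setwise limits\<close>

text \<open>For \<open>UNIV\<close> this is tightness in the usual sense; for general
  \<open>E\<close> it is inner regularity on \<open>E\<close>, uniform in \<open>n\<close>.\<close>

definition uniformly_tight :: "(nat \<Rightarrow> 'c::topological_space measure) \<Rightarrow> 'c set \<Rightarrow> bool" where
  "uniformly_tight \<rho> E \<longleftrightarrow> (\<forall>e>0. \<exists>K. compact K \<and> K \<subseteq> E \<and> (\<forall>n. measure (\<rho> n) (E - K) \<le> e))"

text \<open>Closed under complements by design, so that it can serve as the algebra on which
  Caratheodory's theorem is applied to the setwise limit.\<close>

definition tight_algebra :: "(nat \<Rightarrow> 'c::topological_space measure) \<Rightarrow> 'c set set" where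
  "tight_algebra \<rho> = {E \<in> sets borel. uniformly_tight \<rho> E \<and> uniformly_tight \<rho> (- E)}"

text \<open>The Hausdorff condition makes compact sets closed, hence Borel.\<close>

locale borel_measure_sequence =
  fixes \<rho> :: "nat \<Rightarrow> 'c::t2_space measure"
  assumes fin: "\<And>n. finite_measure (\<rho> n)" and sets_\<rho>: "\<And>n. sets (\<rho> n) = sets borel"
begin

lemma measure_Diff_le:
  assumes sub: "X \<subseteq> (E - K) \<union> (F - L)"
    and "E \<in> sets borel" "F \<in> sets borel" "compact K" "compact L" "X \<in> sets borel"
  shows "measure (\<rho> n) X \<le> measure (\<rho> n) (E - K) + measure (\<rho> n) (F - L)"
proof -
  interpret finite_measure "\<rho> n" by (rule fin)
  have m: "E - K \<in> sets (\<rho> n)" "F - L \<in> sets (\<rho> n)" "X \<in> sets (\<rho> n)"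
    using assms by (auto simp: sets_\<rho> borel_compact)
  have "measure (\<rho> n) X \<le> measure (\<rho> n) ((E - K) \<union> (F - L))"
    using m sub by (intro finite_measure_mono) auto
  also have "\<dots> \<le> measure (\<rho> n) (E - K) + measure (\<rho> n) (F - L)"
    by (rule measure_Un_le[OF m(1,2)])
  finally show ?thesis .
qed

text \<open>A point missed by \<open>K \<union> L\<close> in the union, or by
  \<open>K \<inter> L\<close> in the intersection, is missed by \<open>K\<close> in \<open>E\<close>
  or by \<open>L\<close> in \<open>F\<close>.\<close>

lemma uniformly_tight_combine:
  assumes E: "uniformly_tight \<rho> E" "uniformly_tight \<rho> F" "E \<in> sets borel" "F \<in> sets borel"
  shows "uniformly_tight \<rho> (E \<union> F)" "uniformly_tight \<rho> (E \<inter> F)"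
proof -
  have *: "\<exists>K. compact K \<and> K \<subseteq> E \<union> F \<and> (\<forall>n. measure (\<rho> n) ((E \<union> F) - K) \<le> e)"
    "\<exists>K. compact K \<and> K \<subseteq> E \<inter> F \<and> (\<forall>n. measure (\<rho> n) ((E \<inter> F) - K) \<le> e)" if e: "e > 0" for e
  proof -
    have e2: "e / 2 > 0" using e by simp
    obtain K where K: "compact K" "K \<subseteq> E" "\<And>n. measure (\<rho> n) (E - K) \<le> e / 2"
      using E(1) e2 unfolding uniformly_tight_def by blast
    obtain L where L: "compact L" "L \<subseteq> F" "\<And>n. measure (\<rho> n) (F - L) \<le> e / 2"
      using E(2) e2 unfolding uniformly_tight_def by blast
    have le: "measure (\<rho> n) X \<le> e" if "X \<subseteq> (E - K) \<union> (F - L)" "X \<in> sets borel" for X n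
      using measure_Diff_le[OF that(1) E(3,4) K(1) L(1) that(2), of n] K(3)[of n] L(3)[of n] by linarith
    have "compact (K \<union> L)" "compact (K \<inter> L)" using K L by (auto intro: compact_Un compact_Int)
    moreover have "K \<union> L \<subseteq> E \<union> F" "K \<inter> L \<subseteq> E \<inter> F" using K L by auto
    moreover have "measure (\<rho> n) ((E \<union> F) - (K \<union> L)) \<le> e" "measure (\<rho> n) ((E \<inter> F) - (K \<inter> L)) \<le> e" for n
      using E(3,4) borel_compact[OF K(1)] borel_compact[OF L(1)] by (auto intro!: le)
    ultimately show "\<exists>K. compact K \<and> K \<subseteq> E \<union> F \<and> (\<forall>n. measure (\<rho> n) ((E \<union> F) - K) \<le> e)"
      "\<exists>K. compact K \<and> K \<subseteq> E \<inter> F \<and> (\<forall>n. measure (\<rho> n) ((E \<inter> F) - K) \<le> e)" by blast+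
  qed
  show "uniformly_tight \<rho> (E \<union> F)" "uniformly_tight \<rho> (E \<inter> F)"
    unfolding uniformly_tight_def using * by blast+
qed

lemma algebra_tight_algebra:
  assumes "uniformly_tight \<rho> UNIV"
  shows "algebra UNIV (tight_algebra \<rho>)"
  unfolding algebra_iff_Un
proof (intro conjI ballI)
  have "uniformly_tight \<rho> {}" unfolding uniformly_tight_def by auto
  then show "{} \<in> tight_algebra \<rho>" using assms by (simp add: tight_algebra_def)
  fix a assume a: "a \<in> tight_algebra \<rho>"
  then show "UNIV - a \<in> tight_algebra \<rho>" by (simp add: tight_algebra_def Compl_eq_Diff_UNIV[symmetric] borel_comp)
  fix b assume "b \<in> tight_algebra \<rho>"
  then show "a \<union> b \<in> tight_algebra \<rho>"
    using a uniformly_tight_combine(1)[of a b] uniformly_tight_combine(2)[of "- a" "- b"]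
    by (auto simp: tight_algebra_def borel_comp)
qed auto

text \<open>The compact-class argument. Compact sets \<open>K i\<close> inside \<open>A i\<close>,
  with losses \<open>e * (1/2) ^ Suc i\<close>, have empty intersection, so finitely many of them
  do. From their largest index on, \<open>A m\<close> is covered by the losses, of total at most
  \<open>e\<close>. The index \<open>m\<close> does not depend on \<open>n\<close>, which is what
  survives a passage to the limit.\<close>

lemma decseq_tight_small:
  assumes A: "range A \<subseteq> tight_algebra \<rho>" "decseq A" "(\<Inter>i. A i) = {}" and e: "0 < e"
  obtains m where "\<And>n. measure (\<rho> n) (A m) \<le> e"
proof -
  have AB: "A i \<in> sets borel" for i using A(1) by (auto simp: tight_algebra_def)
  have "\<forall>i. \<exists>K. compact K \<and> K \<subseteq> A i \<and> (\<forall>n. measure (\<rho> n) (A i - K) \<le> e * (1/2) ^ Suc i)"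
  proof
    fix i
    have "uniformly_tight \<rho> (A i)" "e * (1/2) ^ Suc i > 0" using A(1) e by (auto simp: tight_algebra_def)
    then show "\<exists>K. compact K \<and> K \<subseteq> A i \<and> (\<forall>n. measure (\<rho> n) (A i - K) \<le> e * (1/2) ^ Suc i)"
      unfolding uniformly_tight_def by blast
  qed
  from choice[OF this] obtain K where K': "\<And>i. compact (K i) \<and> K i \<subseteq> A i
      \<and> (\<forall>n. measure (\<rho> n) (A i - K i) \<le> e * (1/2) ^ Suc i)" by blast
  then have K: "\<And>i. compact (K i)" "\<And>i. K i \<subseteq> A i"
    "\<And>i n. measure (\<rho> n) (A i - K i) \<le> e * (1/2) ^ Suc i" by blast+
  have "(\<Inter>i. K i) \<subseteq> (\<Inter>i. A i)" by (rule INT_anti_mono[OF subset_refl K(2)])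
  then have empty: "K 0 \<inter> (\<Inter>i\<in>UNIV. K i) = {}" unfolding A(3) by simp
  have "\<exists>I. finite I \<and> K 0 \<inter> (\<Inter>i\<in>I. K i) = {}"
  proof (rule ccontr)
    assume none: "\<nexists>I. finite I \<and> K 0 \<inter> (\<Inter>i\<in>I. K i) = {}"
    have "K 0 \<inter> (\<Inter>i\<in>UNIV. K i) \<noteq> {}"
      by (rule compact_imp_fip_image[OF K(1)]) (use none K(1) in \<open>auto intro: compact_imp_closed\<close>)
    then show False using empty by contradiction
  qed
  then obtain I where I: "finite I" "K 0 \<inter> (\<Inter>i\<in>I. K i) = {}" by blast
  \<comment> \<open>The index 0 is included because the finite intersection property is used for
    closed sets inside the fixed compact set \<open>K 0\<close>.\<close>
  define m where "m = Max (insert 0 I)"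
  have m: "i \<le> m" if "i \<in> insert 0 I" for i using I(1) that unfolding m_def by (intro Max_ge) auto
  have sub: "A m \<subseteq> (\<Union>i\<in>insert 0 I. A i - K i)"
  proof
    fix x assume x: "x \<in> A m"
    obtain i where i: "i \<in> insert 0 I" "x \<notin> K i" using I(2) by blast
    then have "x \<in> A i" using m[OF i(1)] x A(2) unfolding decseq_def by blast
    then show "x \<in> (\<Union>i\<in>insert 0 I. A i - K i)" using i by blast
  qed
  have half: "(\<lambda>i. e * (1/2) ^ Suc i) sums e"
    using sums_mult[OF power_half_series, of e] by (simp only: mult_1_right)
  have "measure (\<rho> n) (A m) \<le> e" for n
  proof -
    interpret finite_measure "\<rho> n" by (rule fin)
    have d: "A i - K i \<in> sets (\<rho> n)" for i using AB K(1) by (auto simp: sets_\<rho> borel_compact)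
    have "measure (\<rho> n) (A m) \<le> measure (\<rho> n) (\<Union>i\<in>insert 0 I. A i - K i)"
      using I(1) d by (intro finite_measure_mono[OF sub] sets.finite_UN) auto
    also have "\<dots> \<le> (\<Sum>i\<in>insert 0 I. measure (\<rho> n) (A i - K i))"
      using I(1) d by (intro finite_measure_subadditive_finite) auto
    also have "\<dots> \<le> (\<Sum>i\<in>insert 0 I. e * (1/2) ^ Suc i)" by (intro sum_mono K(3))
    also have "\<dots> \<le> (\<Sum>i. e * (1/2) ^ Suc i)"
      using I(1) e by (intro sum_le_suminf[OF sums_summable[OF half]]) auto
    also have "\<dots> = e" by (rule sums_unique[OF half, symmetric])
    finally show ?thesis .
  qed
  then show ?thesis by (rule that)
qed

text \<open>A setwise limit of measures is finitely additive. Uniform tightness gives continuity at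
  the empty set on the algebra, and Caratheodory's theorem extends the limit from there;
  \<open>f\<close> itself is not claimed to be countably additive on all Borel sets.\<close>

lemma limit_measure_exists:
  assumes tight: "uniformly_tight \<rho> UNIV" and gen: "sigma_sets UNIV (tight_algebra \<rho>) = sets borel"
    and G: "G \<noteq> bot" and f: "\<And>E. ((\<lambda>n. measure (\<rho> n) E) \<longlongrightarrow> f E) G"
  obtains R where "sets R = sets borel" "\<And>E. E \<in> tight_algebra \<rho> \<Longrightarrow> emeasure R E = ennreal (f E)"
proof -
  interpret algebra UNIV "tight_algebra \<rho>" by (rule algebra_tight_algebra[OF tight])
  have f0: "0 \<le> f E" for E
    by (rule tendsto_lowerbound[OF f _ G]) simp
  have AB: "E \<in> sets borel" if "E \<in> tight_algebra \<rho>" for E using that by (simp add: tight_algebra_def)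
  have fe: "f {} = 0"
    using tendsto_unique[OF G f[of "{}"]] by simp
  have add: "f (E \<union> F) = f E + f F" if "E \<in> tight_algebra \<rho>" "F \<in> tight_algebra \<rho>" "E \<inter> F = {}" for E F
  proof -
    have "measure (\<rho> n) (E \<union> F) = measure (\<rho> n) E + measure (\<rho> n) F" for n
    proof -
      interpret finite_measure "\<rho> n" by (rule fin)
      show ?thesis using AB[OF that(1)] AB[OF that(2)] that(3) by (intro finite_measure_Union) (auto simp: sets_\<rho>)
    qed
    then have "((\<lambda>n. measure (\<rho> n) (E \<union> F)) \<longlongrightarrow> f E + f F) G"
      using tendsto_add[OF f[of E] f[of F]] by simp
    then show ?thesis by (rule tendsto_unique[OF G f])
  qed
  have cont: "(\<lambda>i. ennreal (f (A i))) \<longlonglongrightarrow> 0"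
    if A: "range A \<subseteq> tight_algebra \<rho>" "decseq A" "(\<Inter>i. A i) = {}" for A
  proof -
    have "(\<lambda>i. f (A i)) \<longlonglongrightarrow> 0"
    proof (rule LIMSEQ_I)
      fix e :: real assume e: "0 < e"
      then have e2: "0 < e / 2" by simp
      obtain m where m: "\<And>n. measure (\<rho> n) (A m) \<le> e / 2" using decseq_tight_small[OF A e2] by blast
      have "norm (f (A i) - 0) < e" if "i \<ge> m" for i
      proof -
        have "measure (\<rho> n) (A i) \<le> e / 2" for n
        proof -
          interpret finite_measure "\<rho> n" by (rule fin)
          have "A m \<in> sets (\<rho> n)" using A(1) AB by (auto simp: sets_\<rho>)
          then have "measure (\<rho> n) (A i) \<le> measure (\<rho> n) (A m)"
            using A(2) that by (intro finite_measure_mono) (auto simp: decseq_def)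
          then show ?thesis using m[of n] by linarith
        qed
        then have "f (A i) \<le> e / 2" by (intro tendsto_upperbound[OF f _ G]) simp
        then show ?thesis using f0[of "A i"] e by simp
      qed
      then show "\<exists>no. \<forall>n\<ge>no. norm (f (A n) - 0) < e" by blast
    qed
    from tendsto_ennrealI[OF this] show ?thesis by (simp only: ennreal_0)
  qed
  have "\<exists>\<mu> :: 'c set \<Rightarrow> ennreal. (\<forall>s\<in>tight_algebra \<rho>. \<mu> s = ennreal (f s)) \<and>
      measure_space UNIV (sigma_sets UNIV (tight_algebra \<rho>)) \<mu>"
  proof (rule caratheodory_empty_continuous)
    show "positive (tight_algebra \<rho>) (\<lambda>s. ennreal (f s))" by (simp add: positive_def fe)
    show "additive (tight_algebra \<rho>) (\<lambda>s. ennreal (f s))"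
      using add f0 by (auto simp: additive_def simp flip: ennreal_plus)
  qed (use cont in auto)
  then obtain \<mu> where \<mu>: "\<And>E. E \<in> tight_algebra \<rho> \<Longrightarrow> \<mu> E = ennreal (f E)"
    and ms: "measure_space UNIV (sets (borel :: 'c measure)) \<mu>" unfolding gen by blast
  define R where "R = measure_of UNIV (sets (borel :: 'c measure)) \<mu>"
  have sR: "sets R = sets borel" unfolding R_def by (metis sets.sets_measure_of_eq space_borel)
  have "emeasure R E = ennreal (f E)" if "E \<in> tight_algebra \<rho>" for E
  proof -
    have "emeasure R E = \<mu> E"
      unfolding R_def using ms AB[OF that] by (intro emeasure_measure_of_sigma) (auto simp: measure_space_def)
    then show ?thesis using \<mu>[OF that] by simp
  qed
  with sR show ?thesis by (rule that)
qed

end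

section \<open>Borel rectangles and dominated marginals\<close>

definition borel_rectangles :: "('a::topological_space \<times> 'b::topological_space) set set" where
  "borel_rectangles = {E \<times> F | E F. E \<in> sets borel \<and> F \<in> sets borel}"

lemma borel_rectangles_borel: "X \<in> borel_rectangles \<Longrightarrow> X \<in> sets borel"
  by (auto simp: borel_rectangles_def intro: sets_borel_Times)

text \<open>Inner regularity of finite Borel measures on Polish spaces, stated through the measure
  of the part that is missed.\<close>

lemma compact_inner_approximation:
  fixes M :: "'a::polish_space measure"
  assumes M: "sets M = sets borel" "finite_measure M" and E: "E \<in> sets borel" and e: "0 < e"
  obtains K where "compact K" "K \<subseteq> E" "emeasure M (E - K) \<le> ennreal e"
proof -
  interpret finite_measure M by fact
  have reg: "emeasure M E = (SUP K\<in>{K. K \<subseteq> E \<and> compact K}. emeasure M K)"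
    by (rule inner_regular[OF M(1) _ E]) simp
  have "\<exists>K\<in>{K. K \<subseteq> E \<and> compact K}. emeasure M E < emeasure M K + ennreal e"
  proof (rule SUP_approx_ennreal[OF _ _ reg])
    show "{K. K \<subseteq> E \<and> compact K} \<noteq> {}" by (auto intro: exI[of _ "{}"])
  qed (use e in auto)
  then obtain K where K: "K \<subseteq> E" "compact K" "emeasure M E < emeasure M K + ennreal e" by blast
  have "emeasure M (E - K) = emeasure M E - emeasure M K"
    using K E borel_compact[OF K(2)] M by (intro emeasure_Diff) auto
  also have "\<dots> \<le> ennreal e"
    using K(3) by (simp add: ennreal_minus_le_iff less_imp_le add.commute)
  finally show ?thesis using that[OF K(2,1)] by blast
qed

lemma sigma_sets_borel_rectangles:
  "sigma_sets UNIV borel_rectangles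
    = sets (borel :: ('a::second_countable_topology \<times> 'b::second_countable_topology) measure)"
proof -
  have "sets (borel :: ('a \<times> 'b) measure) = sets (borel \<Otimes>\<^sub>M borel)" by (simp only: borel_prod)
  also have "\<dots> = sigma_sets UNIV borel_rectangles"
    unfolding sets_pair_measure borel_rectangles_def by simp
  finally show ?thesis ..
qed

text \<open>Compact sets chosen for the dominating measures \<open>M\<close> and \<open>N\<close>
  serve all \<open>n\<close> at once, so every Borel rectangle lies in the tight algebra. Finite
  unions come with it because it is an algebra; they are what lower semicontinuity will
  need.\<close>

lemma limit_of_dominated_marginals:
  fixes \<rho> :: "nat \<Rightarrow> ('a::polish_space \<times> 'b::polish_space) measure"
  assumes M: "sets M = sets borel" "finite_measure M" and N: "sets N = sets borel" "finite_measure N"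
    and \<rho>: "\<And>n. sets (\<rho> n) = sets borel"
    and marg: "\<And>n E. E \<in> sets borel \<Longrightarrow> emeasure (\<rho> n) (E \<times> UNIV) \<le> emeasure M E"
      "\<And>n E. E \<in> sets borel \<Longrightarrow> emeasure (\<rho> n) (UNIV \<times> E) \<le> emeasure N E"
  obtains G R where "G \<noteq> bot" "G \<le> sequentially" "sets R = sets borel" "finite_measure R"
    "\<And>\<U>. finite \<U> \<Longrightarrow> \<U> \<subseteq> borel_rectangles \<Longrightarrow> ((\<lambda>n. emeasure (\<rho> n) (\<Union>\<U>)) \<longlongrightarrow> emeasure R (\<Union>\<U>)) G"
proof -
  have Mfin: "emeasure M UNIV < \<infinity>" using finite_measure.emeasure_finite[OF M(2)] by (simp add: less_top)
  have bound: "emeasure (\<rho> n) UNIV \<le> emeasure M UNIV" for n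
    using marg(1)[of UNIV n] by simp
  have fm: "finite_measure (\<rho> n)" for n
    using bound[of n] Mfin by (intro finite_measureI) (auto simp: space_borel_eq[OF \<rho>] top_unique)
  interpret borel_measure_sequence \<rho>
    by (rule borel_measure_sequence.intro[OF fm \<rho>])
  have bounded: "measure (\<rho> n) E \<in> {0..measure M UNIV}" for n E
  proof -
    interpret finite_measure "\<rho> n" by (rule fin)
    have "measure (\<rho> n) E \<le> measure (\<rho> n) UNIV" using bounded_measure[of E] by (simp add: space_borel_eq[OF \<rho>])
    also have "\<dots> \<le> measure M UNIV"
      using bound[of n] Mfin by (auto simp: measure_def intro: enn2real_mono)
    finally show ?thesis by simp
  qed
  obtain G f where G: "G \<noteq> bot" "G \<le> sequentially" and f: "\<And>E. ((\<lambda>n. measure (\<rho> n) E) \<longlongrightarrow> f E) G"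
    using pointwise_bounded_subfilter[of "\<lambda>n E. measure (\<rho> n) E" "measure M UNIV", OF bounded] by blast
  have tight_rect: "uniformly_tight \<rho> (E \<times> F)" if E: "E \<in> sets borel" and F: "F \<in> sets borel" for E F
    unfolding uniformly_tight_def
  proof (intro allI impI)
    fix e :: real assume "0 < e"
    then have e2: "0 < e / 2" by simp
    obtain K where K: "compact K" "K \<subseteq> E" "emeasure M (E - K) \<le> ennreal (e / 2)"
      by (rule compact_inner_approximation[OF M E e2])
    obtain L where L: "compact L" "L \<subseteq> F" "emeasure N (F - L) \<le> ennreal (e / 2)"
      by (rule compact_inner_approximation[OF N F e2])
    have KL: "E - K \<in> sets borel" "F - L \<in> sets borel"
      using E F borel_compact[OF K(1)] borel_compact[OF L(1)] by auto
    have "measure (\<rho> n) (E \<times> F - K \<times> L) \<le> e" for n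
    proof -
      \<comment> \<open>What \<open>K \<times> L\<close> misses lies in two strips, each controlled
        by one dominated marginal.\<close>
      have sub: "E \<times> F - K \<times> L \<subseteq> (E - K) \<times> UNIV \<union> UNIV \<times> (F - L)" by auto
      have m: "(E - K) \<times> UNIV \<in> sets (\<rho> n)" "UNIV \<times> (F - L) \<in> sets (\<rho> n)"
        unfolding \<rho> using KL by (auto intro: sets_borel_Times)
      have "emeasure (\<rho> n) (E \<times> F - K \<times> L) \<le> emeasure (\<rho> n) ((E - K) \<times> UNIV \<union> UNIV \<times> (F - L))"
        using m by (intro emeasure_mono[OF sub]) auto
      also have "\<dots> \<le> emeasure (\<rho> n) ((E - K) \<times> UNIV) + emeasure (\<rho> n) (UNIV \<times> (F - L))"
        by (rule emeasure_subadditive[OF m])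
      also have "\<dots> \<le> ennreal (e / 2) + ennreal (e / 2)"
        using order_trans[OF marg(1)[OF KL(1)] K(3)] order_trans[OF marg(2)[OF KL(2)] L(3)] by (rule add_mono)
      also have "\<dots> = ennreal e" using e2 by (simp flip: ennreal_plus)
      finally show ?thesis using e2 by (simp add: measure_def enn2real_leI)
    qed
    moreover have "compact (K \<times> L)" by (rule compact_Times[OF K(1) L(1)])
    moreover have "K \<times> L \<subseteq> E \<times> F" using K(2) L(2) by auto
    ultimately show "\<exists>K. compact K \<and> K \<subseteq> E \<times> F \<and> (\<forall>n. measure (\<rho> n) (E \<times> F - K) \<le> e)" by blast
  qed
  have tight: "uniformly_tight \<rho> UNIV" using tight_rect[of UNIV UNIV] by simp
  interpret algebra UNIV "tight_algebra \<rho>" by (rule algebra_tight_algebra[OF tight])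
  have rect: "X \<in> tight_algebra \<rho>" if "X \<in> borel_rectangles" for X
  proof -
    obtain E F where X: "X = E \<times> F" and EF: "E \<in> sets borel" "F \<in> sets borel"
      using \<open>X \<in> borel_rectangles\<close> unfolding borel_rectangles_def by blast
    have cEF: "- E \<in> sets borel" "- F \<in> sets borel" using EF by (auto intro: borel_comp)
    \<comment> \<open>The algebra also demands tightness of the complement, which this decomposition
      into two rectangles provides.\<close>
    have cX: "- X = (- E) \<times> UNIV \<union> UNIV \<times> (- F)" unfolding X by auto
    have "uniformly_tight \<rho> ((- E) \<times> UNIV \<union> UNIV \<times> (- F))"
      using cEF by (intro uniformly_tight_combine(1) tight_rect sets_borel_Times) auto
    then show ?thesis
      using tight_rect[OF EF] borel_rectangles_borel[OF that] by (simp add: tight_algebra_def cX[unfolded X] X)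
  qed
  have gen: "sigma_sets UNIV (tight_algebra \<rho>) = sets borel"
  proof (rule antisym)
    have "tight_algebra \<rho> \<subseteq> sets borel" by (auto simp: tight_algebra_def)
    then show "sigma_sets UNIV (tight_algebra \<rho>) \<subseteq> sets borel"
      using sets.sigma_sets_subset[of "tight_algebra \<rho>" borel] by simp
    show "sets borel \<subseteq> sigma_sets UNIV (tight_algebra \<rho>)"
      unfolding sigma_sets_borel_rectangles[symmetric]
      using rect by (intro sigma_sets_mono') auto
  qed
  obtain R where R: "sets R = sets borel" "\<And>E. E \<in> tight_algebra \<rho> \<Longrightarrow> emeasure R E = ennreal (f E)"
    using limit_measure_exists[OF tight gen G(1) f] by blast
  show ?thesis
  proof (rule that[OF G R(1)])
    have "emeasure R UNIV = ennreal (f UNIV)" by (rule R(2)) (rule top)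
    then show "finite_measure R" by (intro finite_measureI) (simp add: space_borel_eq[OF R(1)])
    fix \<U> :: "('a \<times> 'b) set set" assume \<U>: "finite \<U>" "\<U> \<subseteq> borel_rectangles"
    then have "\<Union>\<U> \<in> tight_algebra \<rho>" using rect by (intro finite_Union) auto
    moreover have "((\<lambda>n. ennreal (measure (\<rho> n) (\<Union>\<U>))) \<longlongrightarrow> ennreal (f (\<Union>\<U>))) G"
      by (rule tendsto_ennrealI[OF f])
    ultimately show "((\<lambda>n. emeasure (\<rho> n) (\<Union>\<U>)) \<longlongrightarrow> emeasure R (\<Union>\<U>)) G"
      using R(2) by (simp add: finite_measure.emeasure_eq_measure[OF fm])
  qed
qed

section \<open>Lower semicontinuity of integrals\<close>

text \<open>A layer-cake sum with step \<open>e\<close>: it counts the levels \<open>e\<close>,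
  \<open>2 * e\<close>, up to \<open>k * e\<close> that lie strictly below \<open>a\<close>. Strict
  levels are chosen because strict superlevel sets will be intersections of rectangles with open
  sets.\<close>

lemma layer_sum_bounds:
  fixes a :: ennreal
  assumes e: "0 < e"
  defines "g \<equiv> \<lambda>k. \<Sum>i<k. ennreal e * (if ennreal (real (Suc i) * e) < a then 1 else 0)"
  shows "g k \<le> a" "min a (ennreal (real k * e)) \<le> g k + ennreal e"
proof -
  have step: "ennreal (real (Suc k) * e) = ennreal (real k * e) + ennreal e" for k
    using e by (simp add: distrib_right add.commute flip: ennreal_plus)
  have mono: "ennreal (real k * e) \<le> ennreal (real (Suc k) * e)" for k
    using e by (intro ennreal_leI mult_right_mono) auto
  have gS: "g (Suc k) = g k + ennreal e * (if ennreal (real (Suc k) * e) < a then 1 else 0)" for k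
    unfolding g_def by simp
  \<comment> \<open>The induction also carries the exact value as long as all levels lie below
    \<open>a\<close>; it yields the upper estimate at the first level that fails.\<close>
  have "g k \<le> a \<and> g k \<le> ennreal (real k * e) \<and> min a (ennreal (real k * e)) \<le> g k + ennreal e
      \<and> (ennreal (real k * e) < a \<longrightarrow> g k = ennreal (real k * e))" for k
  proof (induction k)
    case 0
    show ?case by (simp add: g_def)
  next
    case (Suc k)
    show ?case
    proof (cases "ennreal (real (Suc k) * e) < a")
      case True
      then have "ennreal (real k * e) < a" using mono[of k] by (rule le_less_trans[rotated])
      then have "g k = ennreal (real k * e)" using Suc by blast
      then have "g (Suc k) = ennreal (real (Suc k) * e)" using True by (simp only: gS step if_True mult_1_right)
      then show ?thesis using True by (auto simp: add_increasing2 min_def)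
    next
      case False
      then have g: "g (Suc k) = g k" by (simp only: gS if_False mult_zero_right add_0_right)
      have "a \<le> g k + ennreal e"
      proof (cases "ennreal (real k * e) < a")
        case True
        then have "g k + ennreal e = ennreal (real (Suc k) * e)" using Suc by (simp only: step)
        then show ?thesis using False by simp
      next
        case False
        then have "min a (ennreal (real k * e)) = a" by (simp add: min_absorb1)
        then show ?thesis using Suc by simp
      qed
      moreover have "g k \<le> ennreal (real (Suc k) * e)" using Suc mono[of k] by (blast intro: order_trans)
      ultimately show ?thesis
        using Suc False unfolding g by (meson min.coboundedI1)
    qed
  qed
  then show "g k \<le> a" "min a (ennreal (real k * e)) \<le> g k + ennreal e" by blast+
qed

text \<open>A portmanteau argument. A strict superlevel set is an increasing union of finite unions
  of rectangles, whose measures converge along \<open>G\<close>, so layer sums over \<open>R\<close>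
  inherit the bound \<open>c\<close>. They approximate the integral of a truncation of
  \<open>f\<close> up to \<open>e\<close> times the finite mass of \<open>R\<close>, and monotone
  convergence removes the truncation.\<close>

lemma nn_integral_limit_le:
  fixes \<rho> :: "nat \<Rightarrow> ('a::topological_space \<times> 'b::topological_space) measure"
  assumes G: "G \<noteq> bot" and \<rho>: "\<And>n. sets (\<rho> n) = sets borel" and R: "sets R = sets borel" "finite_measure R"
    and lim: "\<And>\<U>. finite \<U> \<Longrightarrow> \<U> \<subseteq> borel_rectangles \<Longrightarrow> ((\<lambda>n. emeasure (\<rho> n) (\<Union>\<U>)) \<longlongrightarrow> emeasure R (\<Union>\<U>)) G"
    and f: "f \<in> borel_measurable borel"
    and level: "\<And>t. 0 < t \<Longrightarrow> \<exists>X. (\<forall>i::nat. X i \<in> borel_rectangles) \<and> {z. ennreal t < f z} = (\<Union>i. X i)"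
    and ev: "eventually (\<lambda>n. (\<integral>\<^sup>+z. f z \<partial>\<rho> n) \<le> c) G"
  shows "(\<integral>\<^sup>+z. f z \<partial>R) \<le> c"
proof -
  have mf: "f \<in> borel_measurable (\<rho> n)" "f \<in> borel_measurable R" for n
    using f by (auto simp: measurable_cong_sets[OF \<rho> refl] measurable_cong_sets[OF R(1) refl])
  obtain r where r: "emeasure R UNIV = ennreal r" "0 \<le> r"
    using finite_measure.emeasure_finite[OF R(2), of UNIV] by (cases "emeasure R UNIV") auto
  have layers: "(\<Sum>i<k. ennreal e * emeasure R {z. ennreal (real (Suc i) * e) < f z}) \<le> c" if e: "0 < e" for k e
  proof -
    have "\<forall>i. \<exists>X. (\<forall>j::nat. X j \<in> borel_rectangles) \<and> {z. ennreal (real (Suc i) * e) < f z} = (\<Union>j. X j)"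
      using level e by simp
    from choice[OF this] obtain X where X: "\<And>i j::nat. X i j \<in> borel_rectangles"
      and U: "\<And>i. {z. ennreal (real (Suc i) * e) < f z} = (\<Union>j. X i j)" by blast
    \<comment> \<open>Finite partial unions, the sets on which convergence is known.\<close>
    define Y where "Y = (\<lambda>i j. \<Union>(X i ` {..j}))"
    have XB: "X i j \<in> sets borel" for i j by (rule borel_rectangles_borel[OF X])
    have YB: "Y i j \<in> sets borel" for i j unfolding Y_def using XB by auto
    have Yinc: "incseq (Y i)" for i unfolding Y_def incseq_def by force
    have YU: "(\<Union>j. Y i j) = {z. ennreal (real (Suc i) * e) < f z}" for i unfolding U Y_def by auto
    have Ysub: "Y i j \<subseteq> {z. ennreal (real (Suc i) * e) < f z}" for i j unfolding YU[symmetric] by auto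
    have UB: "{z. ennreal (real (Suc i) * e) < f z} \<in> sets borel" for i
      unfolding U using XB by auto
    have "(\<lambda>j. \<Sum>i<k. ennreal e * emeasure R (Y i j))
        \<longlonglongrightarrow> (\<Sum>i<k. ennreal e * emeasure R {z. ennreal (real (Suc i) * e) < f z})"
    proof (intro tendsto_sum ennreal_tendsto_cmult)
      fix i
      have "range (Y i) \<subseteq> sets R" unfolding R(1) using YB by blast
      from Lim_emeasure_incseq[OF this Yinc]
      show "(\<lambda>j. emeasure R (Y i j)) \<longlonglongrightarrow> emeasure R {z. ennreal (real (Suc i) * e) < f z}"
        by (simp only: YU)
    qed simp
    moreover have "(\<Sum>i<k. ennreal e * emeasure R (Y i j)) \<le> c" for j
    proof (rule tendsto_upperbound[OF _ _ G])
      show "((\<lambda>n. \<Sum>i<k. ennreal e * emeasure (\<rho> n) (Y i j)) \<longlongrightarrow> (\<Sum>i<k. ennreal e * emeasure R (Y i j))) G"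
        unfolding Y_def using X by (intro tendsto_sum ennreal_tendsto_cmult lim) auto
      show "\<forall>\<^sub>F n in G. (\<Sum>i<k. ennreal e * emeasure (\<rho> n) (Y i j)) \<le> c"
        using ev
      proof (rule eventually_mono)
        fix n assume n: "(\<integral>\<^sup>+z. f z \<partial>\<rho> n) \<le> c"
        have UBn: "{z. ennreal (real (Suc i) * e) < f z} \<in> sets (\<rho> n)" for i
          unfolding \<rho> by (rule UB)
        have "(\<Sum>i<k. ennreal e * emeasure (\<rho> n) (Y i j))
            \<le> (\<Sum>i<k. ennreal e * emeasure (\<rho> n) {z. ennreal (real (Suc i) * e) < f z})"
          using UB Ysub by (intro sum_mono mult_left_mono emeasure_mono) (auto simp: \<rho>)
        also have "\<dots> = (\<integral>\<^sup>+z. (\<Sum>i<k. ennreal e * indicator {z. ennreal (real (Suc i) * e) < f z} z) \<partial>\<rho> n)"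
          using UBn by (subst nn_integral_sum) (auto simp: nn_integral_cmult_indicator intro!: borel_measurable_times_ennreal)
        also have "\<dots> \<le> (\<integral>\<^sup>+z. f z \<partial>\<rho> n)"
        proof (rule nn_integral_mono)
          fix z
          show "(\<Sum>i<k. ennreal e * indicator {z. ennreal (real (Suc i) * e) < f z} z) \<le> f z"
            using layer_sum_bounds(1)[OF e, of "f z" k] by (simp only: indicator_def mem_Collect_eq of_bool_def)
        qed
        finally show "(\<Sum>i<k. ennreal e * emeasure (\<rho> n) (Y i j)) \<le> c" using n by (rule order_trans)
      qed
    qed
    ultimately show ?thesis
      by (intro LIMSEQ_le_const2) auto
  qed
  have bounded: "(\<integral>\<^sup>+z. min (f z) (real L) \<partial>R) \<le> c" for L :: nat
  proof (rule ennreal_le_epsilon)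
    fix \<epsilon> :: real assume \<epsilon>: "0 < \<epsilon>"
    \<comment> \<open>The step \<open>1 / m\<close> makes the error \<open>e * r\<close> at most
      \<open>\<epsilon>\<close>, and \<open>L * m\<close> such steps reach exactly the truncation
      height \<open>L\<close>.\<close>
    obtain m :: nat where m: "r / \<epsilon> < m" "0 < m"
      using reals_Archimedean2[of "max 0 (r / \<epsilon>)"] by (auto simp: of_nat_0_less_iff)
    define e where "e = 1 / real m"
    have e: "0 < e" using m by (simp add: e_def)
    have re: "e * r \<le> \<epsilon>" using m \<epsilon> by (simp add: e_def field_simps)
    have Le: "real (L * m) * e = real L" using m by (simp add: e_def)
    have UB: "{z. ennreal (real (Suc i) * e) < f z} \<in> sets R" for i
      unfolding R(1) using f by measurable
    have "(\<integral>\<^sup>+z. min (f z) (real L) \<partial>R)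
        \<le> (\<integral>\<^sup>+z. (\<Sum>i<L * m. ennreal e * indicator {z. ennreal (real (Suc i) * e) < f z} z) + ennreal e \<partial>R)"
    proof (rule nn_integral_mono)
      fix z
      show "min (f z) (ennreal (real L))
          \<le> (\<Sum>i<L * m. ennreal e * indicator {z. ennreal (real (Suc i) * e) < f z} z) + ennreal e"
        using layer_sum_bounds(2)[OF e, of "f z" "L * m"] unfolding Le by (simp only: indicator_def mem_Collect_eq of_bool_def)
    qed
    also have "\<dots> = (\<Sum>i<L * m. ennreal e * emeasure R {z. ennreal (real (Suc i) * e) < f z}) + ennreal e * emeasure R UNIV"
    proof -
      have m: "(\<lambda>z. ennreal e * indicator {z. ennreal (real (Suc i) * e) < f z} z) \<in> borel_measurable R" for i
        using UB[of i] by (intro borel_measurable_times_ennreal borel_measurable_const borel_measurable_indicator)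
      then have "(\<integral>\<^sup>+z. (\<Sum>i<L * m. ennreal e * indicator {z. ennreal (real (Suc i) * e) < f z} z) + ennreal e \<partial>R)
          = (\<Sum>i<L * m. \<integral>\<^sup>+z. ennreal e * indicator {z. ennreal (real (Suc i) * e) < f z} z \<partial>R) + (\<integral>\<^sup>+z. ennreal e \<partial>R)"
        by (subst nn_integral_add) (simp_all only: nn_integral_sum borel_measurable_sum borel_measurable_const)
      then show ?thesis
        by (simp only: nn_integral_cmult_indicator[OF UB] nn_integral_const space_borel_eq[OF R(1)])
    qed
    also have "\<dots> \<le> c + ennreal \<epsilon>"
      using layers[OF e, of "L * m"] re e r by (intro add_mono) (simp_all add: ennreal_leI flip: ennreal_mult)
    finally show "(\<integral>\<^sup>+z. min (f z) (real L) \<partial>R) \<le> c + ennreal \<epsilon>" .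
  qed
  have "(SUP L::nat. min a (ennreal (real L))) = a" for a :: ennreal
  proof -
    have "(SUP L::nat. min a (ennreal (real L))) = min a (SUP L::nat. ennreal (real L))"
      using inf_SUP[of a "\<lambda>L::nat. ennreal (real L)" UNIV] by (simp add: inf_min)
    also have "(SUP L::nat. ennreal (real L)) = top"
      by (simp only: ennreal_of_nat_eq_real_of_nat[symmetric] ennreal_SUP_of_nat_eq_top)
    finally show ?thesis by simp
  qed
  then have "(\<integral>\<^sup>+z. f z \<partial>R) = (\<integral>\<^sup>+z. (SUP L::nat. min (f z) (ennreal (real L))) \<partial>R)" by simp
  also have "\<dots> = (SUP L::nat. \<integral>\<^sup>+z. min (f z) (ennreal (real L)) \<partial>R)"
  proof (rule nn_integral_monotone_convergence_SUP)
    show "incseq (\<lambda>L z. min (f z) (ennreal (real L)))"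
      unfolding incseq_def le_fun_def
      by (intro allI impI min.mono order_refl ennreal_leI) simp
  qed (use mf in auto)
  also have "\<dots> \<le> c" by (rule SUP_least) (rule bounded)
  finally show ?thesis .
qed

text \<open>By second countability an open set is a countable union of products of basic open sets,
  and intersecting these with a rectangle gives rectangles. This supplies the superlevel sets for
  \<open>nn_integral_limit_le\<close>.\<close>

lemma rectangle_Int_open:
  fixes V0 :: "('a::second_countable_topology \<times> 'b::second_countable_topology) set"
  assumes V0: "open V0" and E: "E \<in> sets borel" "F \<in> sets borel"
  shows "\<exists>X. (\<forall>i::nat. X i \<in> borel_rectangles) \<and> (E \<times> F) \<inter> V0 = (\<Union>i. X i)"
proof -
  obtain B :: "'a set set" where B: "countable B" "topological_basis B" using ex_countable_basis by blast
  obtain B' :: "'b set set" where B': "countable B'" "topological_basis B'" using ex_countable_basis by blast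
  let ?C = "(\<lambda>(a, b). a \<times> b) ` (B \<times> B')"
  have tb: "topological_basis ?C" by (rule topological_basis_prod[OF B(2) B'(2)])
  have cC: "countable ?C" using B(1) B'(1) by (intro countable_image countable_SIGMA)
  obtain \<S> where S: "\<S> \<subseteq> ?C" "\<Union>\<S> = V0" using tb V0 unfolding topological_basis_def by blast
  \<comment> \<open>The added empty set makes the family nonempty, so that it can be enumerated by
    the natural numbers even if \<open>\<S>\<close> is empty.\<close>
  define \<T> where "\<T> = insert {} ((\<lambda>X. (E \<times> F) \<inter> X) ` \<S>)"
  have "countable \<T>" unfolding \<T>_def using countable_subset[OF S(1) cC] by auto
  have "Y \<in> borel_rectangles" if Y: "Y \<in> \<T>" for Y
  proof (cases "Y = {}")
    case True
    then have "Y = {} \<times> {}" by simp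
    then show ?thesis unfolding borel_rectangles_def by blast
  next
    case False
    then obtain U V where UV: "U \<in> B" "V \<in> B'" "Y = (E \<times> F) \<inter> (U \<times> V)"
      using Y S(1) unfolding \<T>_def by blast
    have "open U" "open V"
      using topological_basis_open[OF B(2) UV(1)] topological_basis_open[OF B'(2) UV(2)] .
    then have "E \<inter> U \<in> sets borel" "F \<inter> V \<in> sets borel" using E by auto
    moreover have "Y = (E \<inter> U) \<times> (F \<inter> V)" unfolding UV(3) by auto
    ultimately show ?thesis unfolding borel_rectangles_def by blast
  qed
  moreover have "range (from_nat_into \<T>) = \<T>"
    using \<open>countable \<T>\<close> by (intro range_from_nat_into) (auto simp: \<T>_def)
  moreover have "\<Union>\<T> = (E \<times> F) \<inter> V0" unfolding \<T>_def S(2)[symmetric] by auto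
  ultimately show ?thesis
    by (intro exI[of _ "from_nat_into \<T>"]) auto
qed

section \<open>Subtraction of measures off A\<close>

text \<open>A difference of measures is available where they are finite, so it is formed on each
  cell of a partition of \<open>- A\<close> and the pieces are summed.\<close>

lemma measure_remainder:
  fixes A :: "'a::polish_space set"
  assumes A: "closed A" "A \<noteq> {}" and s: "sets M = sets borel" "sets L = sets borel"
    and fin: "(\<integral>\<^sup>+x. ennreal (infdist x A) \<partial>M) < \<infinity>"
    and le: "\<And>E. E \<in> sets borel \<Longrightarrow> E \<subseteq> - A \<Longrightarrow> emeasure L E \<le> emeasure M E"
  obtains N where "sets N = sets borel"
    "\<And>E. E \<in> sets borel \<Longrightarrow> E \<subseteq> - A \<Longrightarrow> emeasure L E + emeasure N E = emeasure M E"
proof -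
  obtain D :: "nat \<Rightarrow> 'a set" where D: "disjoint_family D" "(\<Union>j. D j) = - A" and DB: "\<And>j. D j \<in> sets borel"
    and "\<And>j y y'. y \<in> D j \<Longrightarrow> y' \<in> D j \<Longrightarrow> dist y y' \<le> 1 * (infdist y A + infdist y' A)"
    and away: "\<And>j. \<exists>r>0. D j \<subseteq> {y. r < infdist y A}"
    by (rule small_cells[OF A zero_less_one order_refl]) blast
  have DA: "D j \<subseteq> - A" for j using D(2) by blast
  have Mfin: "emeasure M (D j) < \<infinity>" for j
  proof -
    obtain r where r: "r > 0" "D j \<subseteq> {y. r < infdist y A}" using away[of j] by blast
    have "{y. r < infdist y A} \<in> sets M" unfolding s by measurable
    then have "emeasure M (D j) \<le> emeasure M {y. r < infdist y A}" by (rule emeasure_mono[OF r(2)])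
    also have "\<dots> < \<infinity>" by (rule emeasure_away_finite[OF s(1) fin r(1)])
    finally show ?thesis .
  qed
  define MD where "MD = (\<lambda>j. restrict_to M (D j))"
  define LD where "LD = (\<lambda>j. restrict_to L (D j))"
  have sD: "sets (MD j) = sets borel" "sets (LD j) = sets borel" for j
    by (simp_all add: MD_def LD_def s)
  have em: "emeasure (MD j) E = emeasure M (D j \<inter> E)" "emeasure (LD j) E = emeasure L (D j \<inter> E)"
    if "E \<in> sets borel" for j E
    using that DB[of j] unfolding MD_def LD_def by (simp_all add: emeasure_restrict_to s)
  have leD: "emeasure (LD j) E \<le> emeasure (MD j) E" if "E \<in> sets borel" for j E
    unfolding em[OF that] using DA[of j] DB[of j] that by (intro le) auto
  have finD: "finite_measure (MD j)" "finite_measure (LD j)" for j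
  proof -
    have "emeasure (MD j) UNIV < \<infinity>" using Mfin[of j] em(1)[of UNIV j] by simp
    moreover from this have "emeasure (LD j) UNIV < \<infinity>" using leD[of UNIV j] by (simp add: le_less_trans)
    ultimately show "finite_measure (MD j)" "finite_measure (LD j)"
      by (auto intro!: finite_measureI simp: space_borel_eq[OF sD(1)] space_borel_eq[OF sD(2)])
  qed
  have diff: "emeasure (LD j) E + emeasure (diff_measure (MD j) (LD j)) E = emeasure (MD j) E"
    if E: "E \<in> sets borel" for j E
  proof -
    have "emeasure (diff_measure (MD j) (LD j)) E = emeasure (MD j) E - emeasure (LD j) E"
      using E leD[of _ j] by (intro emeasure_diff_measure[OF finD]) (auto simp: sD)
    then show ?thesis using leD[OF E, of j] by (simp add: add_diff_inverse_ennreal)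
  qed
  have total: "(\<Sum>j. emeasure K (D j \<inter> E)) = emeasure K E"
    if "sets K = sets borel" "E \<in> sets borel" "E \<subseteq> - A" for K E
  proof -
    have "(\<Sum>j. emeasure K (D j \<inter> E)) = emeasure K (\<Union>j. D j \<inter> E)"
    proof (rule suminf_emeasure)
      show "range (\<lambda>j. D j \<inter> E) \<subseteq> sets K" using that DB by auto
      show "disjoint_family (\<lambda>j. D j \<inter> E)" using D(1) by (auto simp: disjoint_family_on_def)
    qed
    also have "(\<Union>j. D j \<inter> E) = E" using that(3) D(2) by blast
    finally show ?thesis .
  qed
  show ?thesis
  proof (rule that[of "sum_measure (\<lambda>j. diff_measure (MD j) (LD j))"])
    fix E assume E: "E \<in> sets borel" "E \<subseteq> - A"
    have "emeasure (sum_measure (\<lambda>j. diff_measure (MD j) (LD j))) E = (\<Sum>j. emeasure (diff_measure (MD j) (LD j)) E)"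
      using E(1) by (subst emeasure_sum_measure) (auto simp: sD nn_integral_count_space_nat)
    moreover have "emeasure L E = (\<Sum>j. emeasure (LD j) E)"
      using total[OF s(2) E] em(2)[OF E(1)] by simp
    ultimately have "emeasure L E + emeasure (sum_measure (\<lambda>j. diff_measure (MD j) (LD j))) E
        = (\<Sum>j. emeasure (LD j) E + emeasure (diff_measure (MD j) (LD j)) E)"
      by (simp add: suminf_add)
    also have "\<dots> = emeasure M E"
      unfolding diff[OF E(1)] em(1)[OF E(1)] by (rule total[OF s(1) E])
    finally show "emeasure L E + emeasure (sum_measure (\<lambda>j. diff_measure (MD j) (LD j))) E = emeasure M E" .
  qed simp
qed

section \<open>Existence of optimal couplings\<close>

definition near :: "'a::metric_space set \<Rightarrow> 'a \<times> 'a \<Rightarrow> real" where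
  "near A z = min (infdist (fst z) A) (infdist (snd z) A)"

text \<open>The part of the cost beyond what the 1-Lipschitz function \<open>infdist _ A\<close>
  forces. It vanishes on pairs with a coordinate in \<open>A\<close>.\<close>

definition excess :: "'a::metric_space set \<Rightarrow> 'a \<times> 'a \<Rightarrow> real" where
  "excess A z = dbar A (fst z) (snd z) - \<bar>infdist (fst z) A - infdist (snd z) A\<bar>"

lemma near_nonneg: "0 \<le> near A z" by (simp add: near_def infdist_nonneg)

lemma excess_nonneg: "0 \<le> excess A z"
  using abs_infdist_diff_le_dbar[of "fst z" A "snd z"] by (simp add: excess_def)

lemma continuous_on_near: "continuous_on UNIV (near A)"
  unfolding near_def by (intro continuous_intros)

lemma continuous_on_excess: "continuous_on UNIV (excess A)"
  unfolding excess_def by (intro continuous_intros continuous_on_dbar)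

text \<open>This is \<open>s + t = \<bar>s - t\<bar> + 2 * min s t\<close> for the two distances to
  \<open>A\<close>.\<close>

lemma dbar_near_excess:
  "dbar A (fst z) (snd z) + 2 * near A z = excess A z + (infdist (fst z) A + infdist (snd z) A)"
  by (auto simp: near_def excess_def min_def abs_if)

lemma near_eq_0_iff:
  assumes "closed A" "A \<noteq> {}"
  shows "near A z = 0 \<longleftrightarrow> fst z \<in> A \<or> snd z \<in> A"
  using in_closed_iff_infdist_zero[OF assms, of "fst z"] in_closed_iff_infdist_zero[OF assms, of "snd z"]
    infdist_nonneg[of "fst z" A] infdist_nonneg[of "snd z" A]
  by (auto simp: near_def min_def)

lemma excess_in: "a \<in> A \<Longrightarrow> excess A (x, a) = 0" "a \<in> A \<Longrightarrow> excess A (a, x) = 0"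
  by (simp_all add: excess_def dbar_in infdist_nonneg)

lemma near_in: "a \<in> A \<Longrightarrow> near A (x, a) = 0" "a \<in> A \<Longrightarrow> near A (a, x) = 0"
  by (simp_all add: near_def infdist_nonneg)

text \<open>The bracket on the right is the same for every coupling of \<open>M\<close> and
  \<open>N\<close>, so minimising the cost is a trade between \<open>near\<close> and
  \<open>excess\<close>. The terms stay on two sides because extended nonnegative reals do not
  cancel freely.\<close>

lemma cost_near_excess:
  fixes A :: "'a::metric_space set"
  assumes A: "closed A" and P: "coupling A M N P"
  shows "cost A P + 2 * (\<integral>\<^sup>+z. ennreal (near A z) \<partial>P)
    = (\<integral>\<^sup>+z. ennreal (excess A z) \<partial>P) + ((\<integral>\<^sup>+x. ennreal (infdist x A) \<partial>M) + (\<integral>\<^sup>+x. ennreal (infdist x A) \<partial>N))"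
proof -
  have s: "sets P = sets borel" using P by (simp add: coupling_def)
  have im: "(\<lambda>x. ennreal (infdist x A)) \<in> borel_measurable borel" by measurable
  have m: "(\<lambda>z. ennreal (near A z)) \<in> borel_measurable P" "(\<lambda>z. ennreal (excess A z)) \<in> borel_measurable P"
    "(\<lambda>z. ennreal (dbar A (fst z) (snd z))) \<in> borel_measurable P"
    using borel_measurable_continuous_onI[OF continuous_on_near[of A]]
      borel_measurable_continuous_onI[OF continuous_on_excess[of A]]
    by (auto simp: measurable_cong_sets[OF s refl])
  have mi: "(\<lambda>z. ennreal (infdist (fst z) A)) \<in> borel_measurable P" "(\<lambda>z. ennreal (infdist (snd z) A)) \<in> borel_measurable P"
    using measurable_compose[OF borel_measurable_fst_snd(1) im] measurable_compose[OF borel_measurable_fst_snd(2) im]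
    by (auto simp: measurable_cong_sets[OF s refl])
  have "cost A P + 2 * (\<integral>\<^sup>+z. ennreal (near A z) \<partial>P)
      = (\<integral>\<^sup>+z. ennreal (dbar A (fst z) (snd z)) + 2 * ennreal (near A z) \<partial>P)"
    unfolding cost_def using m by (simp add: nn_integral_add nn_integral_cmult)
  also have "\<dots> = (\<integral>\<^sup>+z. ennreal (excess A z) + (ennreal (infdist (fst z) A) + ennreal (infdist (snd z) A)) \<partial>P)"
  proof (rule nn_integral_cong)
    fix z
    have "ennreal (dbar A (fst z) (snd z)) + 2 * ennreal (near A z)
        = ennreal (dbar A (fst z) (snd z) + 2 * near A z)"
      by (simp add: dbar_nonneg near_nonneg ennreal_mult)
    also have "\<dots> = ennreal (excess A z) + (ennreal (infdist (fst z) A) + ennreal (infdist (snd z) A))"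
      unfolding dbar_near_excess by (simp add: excess_nonneg infdist_nonneg)
    finally show "ennreal (dbar A (fst z) (snd z)) + 2 * ennreal (near A z)
        = ennreal (excess A z) + (ennreal (infdist (fst z) A) + ennreal (infdist (snd z) A))" .
  qed
  also have "\<dots> = (\<integral>\<^sup>+z. ennreal (excess A z) \<partial>P) + ((\<integral>\<^sup>+z. ennreal (infdist (fst z) A) \<partial>P) + (\<integral>\<^sup>+z. ennreal (infdist (snd z) A) \<partial>P))"
    using m mi by (simp add: nn_integral_add)
  finally show ?thesis
    using nn_integral_coupling[OF A P im] by simp
qed

text \<open>Semicontinuity alone bounds the cost of the limit but not that of the mass lost on the
  way. Once sent to \<open>A\<close>, that mass counts neither in \<open>near\<close> nor in
  \<open>excess\<close>, while the totals of \<open>near\<close> converge exactly; so its cost is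
  accounted for without being computed.\<close>

lemma optimal_coupling_exists:
  fixes A :: "'a::polish_space set"
  assumes A: "closed A" "A \<noteq> {}" and M: "sets M = sets borel" "sets N = sets borel"
    and fin: "(\<integral>\<^sup>+x. ennreal (infdist x A) \<partial>M) < \<infinity>" "(\<integral>\<^sup>+x. ennreal (infdist x A) \<partial>N) < \<infinity>"
    and W: "W < \<infinity>" and approx: "\<And>e. 0 < e \<Longrightarrow> \<exists>P. coupling A M N P \<and> cost A P < W + ennreal e"
  shows "\<exists>P. coupling A M N P \<and> cost A P \<le> W"
proof -
  have "\<forall>n. \<exists>P. coupling A M N P \<and> cost A P < W + ennreal (1 / real (Suc n))"
    using approx by simp
  from choice[OF this] obtain P where P: "\<And>n. coupling A M N (P n)"
    and cost_P: "\<And>n. cost A (P n) < W + ennreal (1 / real (Suc n))" by blast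
  have sP: "sets (P n) = sets borel" for n using P[of n] by (simp add: coupling_def)
  note cP = P[unfolded coupling_iff[OF A(1) M sP], rule_format]
  let ?i = "\<lambda>x. ennreal (infdist x A)" and ?m = "\<lambda>z. ennreal (near A z)" and ?k = "\<lambda>z. ennreal (excess A z)"
  have im: "?i \<in> borel_measurable borel" by measurable
  have rm: "near A \<in> borel_measurable borel" "excess A \<in> borel_measurable borel"
    by (intro borel_measurable_continuous_onI continuous_on_near continuous_on_excess)+
  have mm: "?m \<in> borel_measurable borel" "?k \<in> borel_measurable borel" using rm by measurable
  have meas: "f \<in> borel_measurable K" if "sets K = sets borel" "f \<in> borel_measurable borel"
    for f :: "'b::topological_space \<Rightarrow> ennreal" and K
    using that by (simp add: measurable_cong_sets[OF that(1) refl])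
  have AB: "A \<in> sets borel" using A(1) by (rule borel_closed)
  define \<rho> where "\<rho> = (\<lambda>n. density (P n) ?m)"
  have s\<rho>: "sets (\<rho> n) = sets borel" for n by (simp add: \<rho>_def sP)
  have int\<rho>: "(\<integral>\<^sup>+z. f z \<partial>\<rho> n) = (\<integral>\<^sup>+z. ?m z * f z \<partial>P n)" if "f \<in> borel_measurable borel" for f n
    unfolding \<rho>_def by (rule nn_integral_density[OF meas[OF sP mm(1)] meas[OF sP that]])
  define M' where "M' = density M ?i"
  define N' where "N' = density N ?i"
  have sM': "sets M' = sets borel" "sets N' = sets borel" by (simp_all add: M'_def N'_def M)
  have emM': "emeasure M' E = (\<integral>\<^sup>+x. ?i x * indicator E x \<partial>M)" "emeasure N' E = (\<integral>\<^sup>+x. ?i x * indicator E x \<partial>N)"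
    if "E \<in> sets borel" for E
    unfolding M'_def N'_def using that M
    by (auto intro!: emeasure_density meas[OF M(1) im] meas[OF M(2) im])
  have finM': "finite_measure M'" "finite_measure N'"
    using emM'[of UNIV] fin
    by (auto intro!: finite_measureI simp: space_borel_eq[OF sM'(1)] space_borel_eq[OF sM'(2)])
  \<comment> \<open>The weight is at most the distance of either coordinate to \<open>A\<close>, and
    this distance vanishes on \<open>A\<close>, where the marginals are not prescribed.\<close>
  have marg1: "emeasure (\<rho> n) (E \<times> UNIV) \<le> emeasure M' E" and marg2: "emeasure (\<rho> n) (UNIV \<times> E) \<le> emeasure N' E"
    if E: "E \<in> sets borel" for n E
  proof -
    let ?f = "\<lambda>x. ?i x * indicator E x"
    have f: "?f \<in> borel_measurable borel"
      using im E by (intro borel_measurable_times_ennreal borel_measurable_indicator)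
    have f0: "?f x = 0" if "x \<in> A" for x using that by simp
    have B: "E \<times> UNIV \<in> sets (borel :: ('a \<times> 'a) measure)" "UNIV \<times> E \<in> sets (borel :: ('a \<times> 'a) measure)"
      using E by (auto intro: sets_borel_Times)
    have em: "emeasure (\<rho> n) X = (\<integral>\<^sup>+z. ?m z * indicator X z \<partial>P n)" if "X \<in> sets borel" for X
      unfolding \<rho>_def by (rule emeasure_density[OF meas[OF sP mm(1)]]) (simp add: sP that)
    have "emeasure (\<rho> n) (E \<times> UNIV) \<le> (\<integral>\<^sup>+z. ?f (fst z) \<partial>P n)"
      unfolding em[OF B(1)]
      by (intro nn_integral_mono mult_mono) (auto simp: near_def indicator_def intro!: ennreal_leI)
    also have "\<dots> = (\<integral>\<^sup>+x. ?f x \<partial>M)" by (rule nn_integral_coupling(1)[OF A(1) P f f0])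
    finally show "emeasure (\<rho> n) (E \<times> UNIV) \<le> emeasure M' E" by (simp only: emM'(1)[OF E])
    have "emeasure (\<rho> n) (UNIV \<times> E) \<le> (\<integral>\<^sup>+z. ?f (snd z) \<partial>P n)"
      unfolding em[OF B(2)]
      by (intro nn_integral_mono mult_mono) (auto simp: near_def indicator_def intro!: ennreal_leI)
    also have "\<dots> = (\<integral>\<^sup>+x. ?f x \<partial>N)" by (rule nn_integral_coupling(2)[OF A(1) P f f0])
    finally show "emeasure (\<rho> n) (UNIV \<times> E) \<le> emeasure N' E" by (simp only: emM'(2)[OF E])
  qed
  obtain G R where G: "G \<noteq> bot" "G \<le> sequentially" and R: "sets R = sets borel" "finite_measure R"
    and lim: "\<And>\<U>. finite \<U> \<Longrightarrow> \<U> \<subseteq> borel_rectangles \<Longrightarrow> ((\<lambda>n. emeasure (\<rho> n) (\<Union>\<U>)) \<longlongrightarrow> emeasure R (\<Union>\<U>)) G"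
  proof (rule limit_of_dominated_marginals[OF sM'(1) finM'(1) sM'(2) finM'(2) s\<rho> marg1 marg2])
    fix G and R :: "('a \<times> 'a) measure"
    assume "G \<noteq> bot" "G \<le> sequentially" "sets R = sets borel" "finite_measure R"
      and "\<And>\<U>. finite \<U> \<Longrightarrow> \<U> \<subseteq> borel_rectangles \<Longrightarrow> ((\<lambda>n. emeasure (\<rho> n) (\<Union>\<U>)) \<longlongrightarrow> emeasure R (\<Union>\<U>)) G"
    then show thesis by (rule that)
  qed
  have lim_rect: "((\<lambda>n. emeasure (\<rho> n) (E \<times> F)) \<longlongrightarrow> emeasure R (E \<times> F)) G"
    if "E \<in> sets borel" "F \<in> sets borel" for E F
    using lim[of "{E \<times> F}"] that by (auto simp: borel_rectangles_def)
  obtain r where r: "emeasure R UNIV = ennreal r" "0 \<le> r"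
    using finite_measure.emeasure_finite[OF R(2), of UNIV] by (cases "emeasure R UNIV") auto
  \<comment> \<open>Without this, dividing by \<open>near A z\<close> would discard mass of
    \<open>R\<close>, and the total of \<open>near\<close> would drop.\<close>
  have null: "emeasure R (A \<times> UNIV) = 0" "emeasure R (UNIV \<times> A) = 0"
  proof -
    have "emeasure M' A = 0" "emeasure N' A = 0"
    proof -
      have z: "?i x * indicator A x = 0" for x by (cases "x \<in> A") simp_all
      then show "emeasure M' A = 0" "emeasure N' A = 0" 
        unfolding emM'[OF AB] z by simp_all
    qed
    then have z: "emeasure (\<rho> n) (A \<times> UNIV) = 0" "emeasure (\<rho> n) (UNIV \<times> A) = 0" for n
      using marg1[OF AB, of n] marg2[OF AB, of n] by simp_all
    have "((\<lambda>n. 0) \<longlongrightarrow> emeasure R (A \<times> UNIV)) G" "((\<lambda>n. 0) \<longlongrightarrow> emeasure R (UNIV \<times> A)) G"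
      using lim_rect[OF AB, of UNIV] lim_rect[OF _ AB, of UNIV] unfolding z by simp_all
    then show "emeasure R (A \<times> UNIV) = 0" "emeasure R (UNIV \<times> A) = 0"
      using tendsto_unique[OF G(1) _ tendsto_const] by blast+
  qed
  text \<open>Where one coordinate lies in \<open>A\<close>, the weight \<open>1 / near A z\<close> is \<open>1 / 0 = 0\<close>.\<close>
  define w where "w = (\<lambda>z. ennreal (1 / near A z))"
  have wm: "w \<in> borel_measurable borel" unfolding w_def using rm by measurable
  define \<pi> where "\<pi> = density R w"
  have s\<pi>: "sets \<pi> = sets borel" by (simp add: \<pi>_def R)
  have int\<pi>: "(\<integral>\<^sup>+z. f z \<partial>\<pi>) = (\<integral>\<^sup>+z. w z * f z \<partial>R)" if "f \<in> borel_measurable borel" for f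
    unfolding \<pi>_def by (rule nn_integral_density[OF meas[OF R(1) wm] meas[OF R(1) that]])
  \<comment> \<open>Weighting by \<open>near\<close> and dividing by it again leaves at most
    \<open>P n\<close>.\<close>
  have mw: "?m z * w z = (if near A z = 0 then 0 else 1)" for z
    using near_nonneg[of A z] unfolding w_def by (auto simp flip: ennreal_mult)
  have pos: "0 < near A z \<longleftrightarrow> near A z \<noteq> 0" for z using near_nonneg[of A z] by linarith
  \<comment> \<open>Applied to strips over \<open>E\<close> off \<open>A\<close>, where all
    \<open>P n\<close> have mass \<open>emeasure M E\<close> or \<open>emeasure N E\<close>, this
    bounds the marginals of \<open>\<pi>\<close>. It is the setwise convergence on rectangles that
    allows arbitrary Borel \<open>E\<close> and \<open>F\<close>.\<close>
  have sub: "emeasure \<pi> (E \<times> F) \<le> c"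
    if E: "E \<in> sets borel" "F \<in> sets borel" and c: "\<And>n. emeasure (P n) (E \<times> F) \<le> c" for E F c
  proof -
    have EF: "E \<times> F \<in> sets borel" using E by (rule sets_borel_Times)
    let ?f = "\<lambda>z. w z * indicator (E \<times> F) z"
    have f: "?f \<in> borel_measurable borel"
      using wm EF by (intro borel_measurable_times_ennreal borel_measurable_indicator)
    have "emeasure \<pi> (E \<times> F) = (\<integral>\<^sup>+z. ?f z \<partial>R)"
      unfolding \<pi>_def by (rule emeasure_density[OF meas[OF R(1) wm]]) (simp add: R EF)
    also have "\<dots> \<le> c"
    proof (rule nn_integral_limit_le[OF G(1) s\<rho> R lim f])
      fix t :: real assume t: "0 < t"
      have "open {z. 0 < near A z \<and> t * near A z < 1}"
        by (intro open_Collect_conj open_Collect_less continuous_intros continuous_on_near)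
      moreover have "{z. ennreal t < ?f z} = (E \<times> F) \<inter> {z. 0 < near A z \<and> t * near A z < 1}"
      proof -
        have "ennreal t < w z \<longleftrightarrow> 0 < near A z \<and> t * near A z < 1" for z
          using t near_nonneg[of A z] unfolding w_def
          by (cases "near A z = 0") (auto simp: pos ennreal_less_iff less_divide_eq)
        moreover have "ennreal t < ?f z \<longleftrightarrow> z \<in> E \<times> F \<and> ennreal t < w z" for z
          by (cases "z \<in> E \<times> F") simp_all
        ultimately show ?thesis by blast
      qed
      ultimately show "\<exists>X. (\<forall>i::nat. X i \<in> borel_rectangles) \<and> {z. ennreal t < ?f z} = (\<Union>i. X i)"
        using rectangle_Int_open[OF _ E] by simp
    next
      have "(\<integral>\<^sup>+z. ?f z \<partial>\<rho> n) \<le> c" for n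
      proof -
        have "(\<integral>\<^sup>+z. ?f z \<partial>\<rho> n) \<le> (\<integral>\<^sup>+z. indicator (E \<times> F) z \<partial>P n)"
          unfolding int\<rho>[OF f] mult.assoc[symmetric] mw
          by (intro nn_integral_mono) (auto simp: indicator_def)
        also have "\<dots> = emeasure (P n) (E \<times> F)" using EF by (intro nn_integral_indicator) (simp add: sP)
        finally show ?thesis using c[of n] by (rule order_trans)
      qed
      then show "\<forall>\<^sub>F n in G. (\<integral>\<^sup>+z. ?f z \<partial>\<rho> n) \<le> c" by simp
    qed
    finally show ?thesis .
  qed
  \<comment> \<open>The strips over \<open>A\<close> are null for \<open>R\<close>, so dividing by
    \<open>near\<close> and weighting again loses nothing.\<close>
  have near_\<pi>: "(\<integral>\<^sup>+z. ?m z \<partial>\<pi>) = emeasure R UNIV"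
  proof -
    have "A \<times> UNIV \<in> null_sets R" "UNIV \<times> A \<in> null_sets R"
      using null AB by (auto simp: null_sets_def R intro: sets_borel_Times)
    then have "AE z in R. z \<notin> A \<times> UNIV" "AE z in R. z \<notin> UNIV \<times> A" by (auto intro: AE_not_in)
    then have "AE z in R. w z * ?m z = 1"
    proof eventually_elim
      case (elim z)
      then have "near A z \<noteq> 0" by (auto simp: near_eq_0_iff[OF A] mem_Times_iff)
      then show ?case using mw[of z] by (simp add: mult.commute)
    qed
    then have "(\<integral>\<^sup>+z. w z * ?m z \<partial>R) = (\<integral>\<^sup>+z. 1 \<partial>R)" by (rule nn_integral_cong_AE)
    then show ?thesis unfolding int\<pi>[OF mm(1)] by (simp add: space_borel_eq[OF R(1)])
  qed
  \<comment> \<open>The integrand \<open>w z * excess A z\<close> has open strict superlevel sets,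
    and an eventual bound along \<open>G\<close> is enough.\<close>
  have excess_\<pi>: "(\<integral>\<^sup>+z. ?k z \<partial>\<pi>) \<le> c" if c: "eventually (\<lambda>n. (\<integral>\<^sup>+z. ?k z \<partial>P n) \<le> c) G" for c
  proof -
    let ?f = "\<lambda>z. w z * ?k z"
    have f: "?f \<in> borel_measurable borel" using wm mm(2) by (rule borel_measurable_times_ennreal)
    show ?thesis
      unfolding int\<pi>[OF mm(2)]
    proof (rule nn_integral_limit_le[OF G(1) s\<rho> R lim f])
      fix t :: real assume t: "0 < t"
      have "open {z. 0 < near A z \<and> t * near A z < excess A z}"
        by (intro open_Collect_conj open_Collect_less continuous_intros continuous_on_near continuous_on_excess)
      moreover have "{z. ennreal t < ?f z} = UNIV \<times> UNIV \<inter> {z. 0 < near A z \<and> t * near A z < excess A z}"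
      proof -
        have "ennreal t < ?f z \<longleftrightarrow> 0 < near A z \<and> t * near A z < excess A z" for z
        proof -
          have "?f z = ennreal (excess A z / near A z)"
            unfolding w_def by (simp add: near_nonneg excess_nonneg flip: ennreal_mult)
          then have "ennreal t < ?f z \<longleftrightarrow> t < excess A z / near A z"
            using t by (simp add: ennreal_less_iff)
          also have "\<dots> \<longleftrightarrow> 0 < near A z \<and> t * near A z < excess A z"
            using t near_nonneg[of A z] by (cases "near A z = 0") (auto simp: pos less_divide_eq)
          finally show ?thesis .
        qed
        then show ?thesis by auto
      qed
      ultimately show "\<exists>X. (\<forall>i::nat. X i \<in> borel_rectangles) \<and> {z. ennreal t < ?f z} = (\<Union>i. X i)"
        using rectangle_Int_open[of _ UNIV UNIV] by simp
    next
      show "\<forall>\<^sub>F n in G. (\<integral>\<^sup>+z. ?f z \<partial>\<rho> n) \<le> c"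
        using c
      proof (rule eventually_mono)
        fix n assume n: "(\<integral>\<^sup>+z. ?k z \<partial>P n) \<le> c"
        have "(\<integral>\<^sup>+z. ?f z \<partial>\<rho> n) \<le> (\<integral>\<^sup>+z. ?k z \<partial>P n)"
          unfolding int\<rho>[OF f] mult.assoc[symmetric] mw by (intro nn_integral_mono) auto
        then show "(\<integral>\<^sup>+z. ?f z \<partial>\<rho> n) \<le> c" using n by (rule order_trans)
      qed
    qed
  qed
  have m12: "fst \<in> borel_measurable \<pi>" "snd \<in> borel_measurable \<pi>"
    using borel_measurable_fst_snd by (auto simp: measurable_cong_sets[OF s\<pi> refl])
  have vim: "fst -` E = E \<times> (UNIV :: 'a set)" "snd -` E = (UNIV :: 'a set) \<times> E" for E :: "'a set" by auto
  have d12: "emeasure (distr \<pi> borel fst) E = emeasure \<pi> (E \<times> UNIV)"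
     "emeasure (distr \<pi> borel snd) E = emeasure \<pi> (UNIV \<times> E)" if "E \<in> sets borel" for E
    using that m12 by (simp_all add: emeasure_distr vim space_borel_eq[OF s\<pi>])
  \<comment> \<open>The part of \<open>M\<close> that \<open>\<pi>\<close> does not transport: the
    mass lost in the limit, together with what the couplings \<open>P n\<close> had already sent to
    \<open>A\<close>.\<close>
  obtain M2 where M2: "sets M2 = sets borel"
    "\<And>E. E \<in> sets borel \<Longrightarrow> E \<subseteq> - A \<Longrightarrow> emeasure (distr \<pi> borel fst) E + emeasure M2 E = emeasure M E"
  proof (rule measure_remainder[OF A M(1) _ fin(1)])
    fix E assume E: "E \<in> sets borel" "E \<subseteq> - A"
    show "emeasure (distr \<pi> borel fst) E \<le> emeasure M E"
      unfolding d12[OF E(1)] using cP[OF E] E(1) by (intro sub) auto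
  qed auto
  obtain N2 where N2: "sets N2 = sets borel"
    "\<And>E. E \<in> sets borel \<Longrightarrow> E \<subseteq> - A \<Longrightarrow> emeasure (distr \<pi> borel snd) E + emeasure N2 E = emeasure N E"
  proof (rule measure_remainder[OF A M(2) _ fin(2)])
    fix E assume E: "E \<in> sets borel" "E \<subseteq> - A"
    show "emeasure (distr \<pi> borel snd) E \<le> emeasure N E"
      unfolding d12[OF E(1)] using cP[OF E] E(1) by (intro sub) auto
  qed auto
  obtain a where a: "a \<in> A" using A(2) by blast
  define Q where "Q = add_measure \<pi> (to_point a M2 N2)"
  have sQ: "sets Q = sets borel" by (simp add: Q_def)
  have Q: "coupling A M N Q"
    unfolding coupling_iff[OF A(1) M sQ]
  proof (intro ballI impI)
    fix E assume E: "E \<in> sets borel" "E \<subseteq> - A"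
    have "a \<notin> E" using a E(2) by blast
    moreover have "E \<times> UNIV \<in> sets (borel :: ('a \<times> 'a) measure)" "UNIV \<times> E \<in> sets (borel :: ('a \<times> 'a) measure)"
      using E(1) by (auto intro: sets_borel_Times)
    ultimately show "emeasure Q (E \<times> UNIV) = emeasure M E \<and> emeasure Q (UNIV \<times> E) = emeasure N E"
      using M2(2)[OF E] N2(2)[OF E] E(1)
      by (simp add: Q_def emeasure_add_measure s\<pi> emeasure_to_point_Times[OF M2(1) N2(1)] d12)
  qed
  \<comment> \<open>The completion lives on pairs with a coordinate \<open>a\<close>, where
    \<open>near\<close> and \<open>excess\<close> vanish.\<close>
  have intQ: "(\<integral>\<^sup>+z. f z \<partial>Q) = (\<integral>\<^sup>+z. f z \<partial>\<pi>)"
    if "f \<in> borel_measurable borel" "\<And>x. f (x, a) = 0" "\<And>x. f (a, x) = 0" for f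
    unfolding Q_def using that by (simp add: nn_integral_add_measure s\<pi> nn_integral_to_point[OF M2(1) N2(1)])
  define C where "C = (\<integral>\<^sup>+x. ?i x \<partial>M) + (\<integral>\<^sup>+x. ?i x \<partial>N)"
  have C: "C < \<infinity>" using fin by (simp add: C_def)
  have cost_Q: "cost A Q + 2 * ennreal r = (\<integral>\<^sup>+z. ?k z \<partial>\<pi>) + C"
    using cost_near_excess[OF A(1) Q] intQ[OF mm(1)] intQ[OF mm(2)] near_\<pi> r
    by (simp add: near_in[OF a] excess_in[OF a] C_def)
  have cost_P': "cost A (P n) + 2 * emeasure (\<rho> n) UNIV = (\<integral>\<^sup>+z. ?k z \<partial>P n) + C" for n
  proof -
    have "emeasure (\<rho> n) UNIV = (\<integral>\<^sup>+z. ?m z \<partial>P n)"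
      using int\<rho>[of "\<lambda>_. 1" n] by (simp add: space_borel_eq[OF s\<rho>])
    then show ?thesis using cost_near_excess[OF A(1) P[of n]] by (simp add: C_def)
  qed
  have two: "2 * ennreal x = ennreal (2 * x)" if "0 \<le> x" for x
    using that by (simp add: ennreal_mult)
  have "cost A Q \<le> W"
  proof (rule ennreal_le_epsilon)
    fix e :: real assume e: "0 < e"
    \<comment> \<open>The weighted mass enters with the factor 2, so \<open>e / 4\<close> here and
      \<open>e / 2\<close> for the cost add up to \<open>e\<close>.\<close>
    have "eventually (\<lambda>n. emeasure (\<rho> n) UNIV < ennreal (r + e / 4)) G"
      using lim_rect[of UNIV UNIV] r e by (intro order_tendstoD(2)[where y = "ennreal r"]) (auto simp: ennreal_less_iff)
    moreover have "eventually (\<lambda>n. 1 / real (Suc n) < e / 2) G"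
    proof (rule filter_leD[OF G(2)])
      have "(\<lambda>n. 1 / real (Suc n)) \<longlonglongrightarrow> 0"
        using LIMSEQ_inverse_real_of_nat by (simp add: inverse_eq_divide)
      then show "\<forall>\<^sub>F n in sequentially. 1 / real (Suc n) < e / 2"
        using e by (intro order_tendstoD(2)) auto
    qed
    ultimately have ev: "eventually (\<lambda>n. (\<integral>\<^sup>+z. ?k z \<partial>P n) + C \<le> W + (2 * ennreal r + ennreal e)) G"
    proof eventually_elim
      case (elim n)
      have "(\<integral>\<^sup>+z. ?k z \<partial>P n) + C \<le> (W + ennreal (e / 2)) + 2 * ennreal (r + e / 4)"
        unfolding cost_P'[symmetric]
      proof (intro add_mono mult_left_mono)
        have "ennreal (1 / real (Suc n)) \<le> ennreal (e / 2)" using elim(2) by (intro ennreal_leI) simp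
        then show "cost A (P n) \<le> W + ennreal (e / 2)"
          using cost_P[of n] by (meson add_left_mono less_imp_le order_trans)
      qed (use elim(1) in auto)
      also have "\<dots> = W + (ennreal (e / 2) + 2 * ennreal (r + e / 4))" by (simp only: add.assoc)
      also have "2 * ennreal (r + e / 4) = ennreal (2 * (r + e / 4))"
        using e r by (intro two) simp
      also have "ennreal (e / 2) + ennreal (2 * (r + e / 4)) = ennreal (e / 2 + 2 * (r + e / 4))"
        using e r by (intro ennreal_plus[symmetric]) auto
      also have "e / 2 + 2 * (r + e / 4) = 2 * r + e" by simp
      also have "ennreal (2 * r + e) = 2 * ennreal r + ennreal e"
        using e r by (simp add: two)
      finally show ?case .
    qed
    define c where "c = W + (2 * ennreal r + ennreal e)"
    \<comment> \<open>A single index, available because \<open>G\<close> is proper, shows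
      \<open>C \<le> c\<close>, so that the truncated difference \<open>c - C\<close> can be added
      back.\<close>
    obtain n where n: "(\<integral>\<^sup>+z. ?k z \<partial>P n) + C \<le> c"
      using eventually_happens[OF ev] G(1) unfolding c_def by auto
    have "C \<le> (\<integral>\<^sup>+z. ?k z \<partial>P n) + C" by simp
    then have Cc: "C \<le> c" using n by (rule order_trans)
    have "eventually (\<lambda>n. (\<integral>\<^sup>+z. ?k z \<partial>P n) \<le> c - C) G"
      using ev unfolding c_def[symmetric]
    proof (rule eventually_mono)
      fix n assume "(\<integral>\<^sup>+z. ?k z \<partial>P n) + C \<le> c"
      then show "(\<integral>\<^sup>+z. ?k z \<partial>P n) \<le> c - C" by (simp add: ennreal_le_minus_iff)
    qed
    then have "(\<integral>\<^sup>+z. ?k z \<partial>\<pi>) \<le> c - C" by (rule excess_\<pi>)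
    then have "(\<integral>\<^sup>+z. ?k z \<partial>\<pi>) + C \<le> (c - C) + C" by (rule add_right_mono)
    also have "\<dots> = c" using Cc by (rule diff_add_cancel_ennreal)
    finally have "cost A Q + 2 * ennreal r \<le> c" by (simp only: cost_Q)
    \<comment> \<open>The common summand is finite and may be cancelled.\<close>
    then have "2 * ennreal r + cost A Q \<le> 2 * ennreal r + (W + ennreal e)"
      unfolding c_def by (simp only: ac_simps)
    then show "cost A Q \<le> W + ennreal e"
      by (subst (asm) ennreal_add_left_cancel_le) (auto simp: ennreal_mult_eq_top_iff)
  qed
  with Q show ?thesis by blast
qed

section \<open>Optimal couplings of relative measures and the embedding of X/A\<close>

lemma W1_optimal_coupling:
  fixes A :: "'a::polish_space set"
  assumes A: "closed A" "A \<noteq> {}" and \<mu>: "\<mu> \<in> M1 A" "\<nu> \<in> M1 A"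
  shows "\<exists>\<pi>\<in>couplings A \<mu> \<nu>. W1 A \<mu> \<nu> = transport_cost A \<pi>"
proof -
  obtain M where M: "sets M = sets borel" "\<mu> = rel_class A M" "(\<integral>\<^sup>+x. ennreal (infdist x A) \<partial>M) < \<infinity>"
    using M1_representative[OF A(1) \<mu>(1)] .
  obtain N where N: "sets N = sets borel" "\<nu> = rel_class A N" "(\<integral>\<^sup>+x. ennreal (infdist x A) \<partial>N) < \<infinity>"
    using M1_representative[OF A(1) \<mu>(2)] .
  have b: "M \<in> borel_measures" "N \<in> borel_measures" using M N by (auto simp: borel_measures_def)
  have W: "W1 A (rel_class A M) (rel_class A N) < \<infinity>"
    using W1_finite[OF A \<mu>] by (simp only: M(2) N(2))
  have "\<exists>P. coupling A M N P \<and> cost A P < W1 A (rel_class A M) (rel_class A N) + ennreal e" if "0 < e" for e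
    using W1_approx_coupling[OF A(1) b W that] by blast
  from optimal_coupling_exists[OF A M(1) N(1) M(3) N(3) W this]
  obtain P where P: "coupling A M N P" "cost A P \<le> W1 A \<mu> \<nu>" unfolding M(2) N(2) by blast
  have "P \<in> borel_measures" using P(1) by (simp add: coupling_def borel_measures_def)
  then have tc: "transport_cost A (rel_class (A \<times> A) P) = cost A P"
    by (rule transport_cost_rel_class[OF A(1)])
  have mem: "rel_class (A \<times> A) P \<in> couplings A \<mu> \<nu>"
    unfolding M(2) N(2) couplings_eq[OF A(1) b] using P(1) by blast
  then have "W1 A \<mu> \<nu> \<le> cost A P"
    unfolding W1_def tc[symmetric] by (rule INF_lower)
  then have "W1 A \<mu> \<nu> = transport_cost A (rel_class (A \<times> A) P)" unfolding tc using P(2) by (rule antisym)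
  then show ?thesis using mem by blast
qed

lemma quotient_embedding_collapse:
  fixes A :: "'a::metric_space set"
  assumes A: "closed A"
  shows "quotient_embedding A (collapse A `` {x}) = rel_dirac A x"
proof (cases "x \<in> A")
  case True
  then have "collapse A `` {x} = A" by (auto simp: collapse_def)
  then show ?thesis using rel_zero_eq_dirac[OF A True] by (simp add: quotient_embedding_def)
next
  case False
  then have "collapse A `` {x} = {x}" by (auto simp: collapse_def)
  moreover have "{x} \<noteq> A" using False by auto
  ultimately show ?thesis by (simp add: quotient_embedding_def)
qed

theorem theorem1p7:
  fixes A :: "'a::polish_space set"
  assumes "closed A" and "A \<noteq> {}"
  shows "(\<forall>\<mu>\<in>M1 A. \<forall>\<nu>\<in>M1 A. W1 A \<mu> \<nu> < \<infinity>)
    \<and> Metric_space (M1 A) (\<lambda>\<mu> \<nu>. enn2real (W1 A \<mu> \<nu>))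
    \<and> isometric_embedding (quotient_space A) (quotient_dist A)
         (M1 A) (\<lambda>\<mu> \<nu>. enn2real (W1 A \<mu> \<nu>)) (quotient_embedding A)
    \<and> ((\<forall>S::'a set. closed S \<and> bounded S \<longrightarrow> compact S) \<longrightarrow>
         (\<forall>\<mu>\<in>M1 A. \<forall>\<nu>\<in>M1 A. \<exists>\<pi>\<in>couplings A \<mu> \<nu>. W1 A \<mu> \<nu> = transport_cost A \<pi>))"
proof (intro conjI impI ballI)
  note A = assms
  show fin: "W1 A \<mu> \<nu> < \<infinity>" if "\<mu> \<in> M1 A" "\<nu> \<in> M1 A" for \<mu> \<nu>
    by (rule W1_finite[OF A that])
  show "\<exists>\<pi>\<in>couplings A \<mu> \<nu>. W1 A \<mu> \<nu> = transport_cost A \<pi>" if "\<mu> \<in> M1 A" "\<nu> \<in> M1 A" for \<mu> \<nu>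
    by (rule W1_optimal_coupling[OF A that])
  show "Metric_space (M1 A) (\<lambda>\<mu> \<nu>. enn2real (W1 A \<mu> \<nu>))"
  proof
    show "0 \<le> enn2real (W1 A \<mu> \<nu>)" "enn2real (W1 A \<mu> \<nu>) = enn2real (W1 A \<nu> \<mu>)" for \<mu> \<nu>
      using W1_sym[OF A(1), of \<mu> \<nu>] by simp_all
    \<comment> \<open>Finiteness enters because \<open>enn2real\<close> also maps
      \<open>\<infinity>\<close> to 0.\<close>
    show "enn2real (W1 A \<mu> \<nu>) = 0 \<longleftrightarrow> \<mu> = \<nu>" if "\<mu> \<in> M1 A" "\<nu> \<in> M1 A" for \<mu> \<nu>
      using fin[OF that] W1_eq_0_iff[OF A that] by (auto simp: enn2real_eq_0_iff)
    fix \<mu> \<nu> \<kappa> assume \<mu>: "\<mu> \<in> M1 A" "\<nu> \<in> M1 A" "\<kappa> \<in> M1 A"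
    have "enn2real (W1 A \<mu> \<kappa>) \<le> enn2real (W1 A \<mu> \<nu> + W1 A \<nu> \<kappa>)"
      using W1_triangle[OF A \<mu>] fin \<mu> by (intro enn2real_mono) auto
    also have "\<dots> = enn2real (W1 A \<mu> \<nu>) + enn2real (W1 A \<nu> \<kappa>)"
      using fin \<mu> by (intro enn2real_plus) auto
    finally show "enn2real (W1 A \<mu> \<kappa>) \<le> enn2real (W1 A \<mu> \<nu>) + enn2real (W1 A \<nu> \<kappa>)" .
  qed
  show "isometric_embedding (quotient_space A) (quotient_dist A)
      (M1 A) (\<lambda>\<mu> \<nu>. enn2real (W1 A \<mu> \<nu>)) (quotient_embedding A)"
    unfolding isometric_embedding_def
  proof (intro conjI ballI)
    show "quotient_embedding A \<in> quotient_space A \<rightarrow> M1 A"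
      using rel_dirac_in_M1[OF A(1)]
      by (auto simp: quotient_space_def quotient_embedding_collapse[OF A(1)] elim!: quotientE)
    fix C D assume "C \<in> quotient_space A" "D \<in> quotient_space A"
    then obtain x y where "C = collapse A `` {x}" "D = collapse A `` {y}"
      unfolding quotient_space_def by (blast elim: quotientE)
    then show "enn2real (W1 A (quotient_embedding A C) (quotient_embedding A D)) = quotient_dist A C D"
      by (simp add: quotient_embedding_collapse[OF A(1)] W1_dirac[OF A] quotient_dist_collapse[OF A] dbar_nonneg)
  qed
qed

end
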